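(* Let $0<\lambda<1$ be such that $\Omega\subset\mathbb{R}^m$ is a bounded, open domain with $C^{2,\lambda}$ boundary, $\tilde g\in C^{2,\lambda}(\bar\Omega)$ and $\hat f\in C^{0,\lambda}(\bar\Omega)$. Then Poisson's problem $$-\Delta \hat u=\hat f\ \text{ in }\Omega,\qquad \hat u=\tilde g\ \text{ on }\partial\Omega,$$ has a unique solution $\hat u\in H^1(\Omega)$. Furthermore, let $2\le p\le\infty$. Then there exists a function $u\in H^1(\Omega)$ of the form $$u(x)=d_{\partial\Omega}(x)\cdot u_{NN}(x)+\tilde g(x),$$ where $u_{NN}$ is a feedforward neural network, with the estimate $$\forall \epsilon>0\ \exists\delta>0:\quad \hat L_p(u)<\delta\ \Longrightarrow\ \|u-\hat u\|_{H^1(\Omega)}<\epsilon .$$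
   Context: The function $\tilde g$ is an extension to $\bar\Omega$ of the Dirichlet boundary data $g$, so $g=\tilde g|_{\partial\Omega}$. The function $d_{\partial\Omega}:\bar\Omega\to\mathbb{R}$ is a fixed function, continuously differentiable up to the order of the differential operator (here twice), with $d_{\partial\Omega}(x)=0$ for $x\in\partial\Omega$ and $d_{\partial\Omega}(x)\neq0$ for $x\in\Omega$. A feedforward neural network $u_{NN}:\mathbb{R}^m\to\mathbb{R}$ is a function of the form $u_{NN}=T^{(L)}\circ\sigma\circ T^{(L-1)}\circ\cdots\circ\sigma\circ T^{(1)}$, where $T^{(i)}:\mathbb{R}^{n_{i-1}}\to\mathbb{R}^{n_i}$, $T^{(i)}(y)=W^{(i)}y+b^{(i)}$ for $1\le i\le L$, are affine maps with weight matrices $W^{(i)}\in\mathbb{R}^{n_i\times n_{i-1}}$ and bias vectors $b^{(i)}\in\mathbb{R}^{n_i}$, $n_0=m$, $n_L=1$, and the activation function $\sigma=\tanh$ is applied componentwise. The generalized loss is the averaged $p$-th power of the residual of Poisson's equation, $$\hat L_p(u)=\frac{1}{|\Omega|}\int_\Omega\bigl|-\Delta u(x)-\hat f(x)\bigr|^p\,\mathrm{d}x,$$ where $|\Omega|$ denotes the Lebesgue measure of $\Omega$; for $p=\infty$ it is read as the essential supremum over $\Omega$ of $|-\Delta u-\hat f|$. *)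

theory Defs
  imports "HOL-Probability.Probability" "Jordan_Normal_Form.Matrix"
begin

unbundle no vec_syntax

section \<open>Classical function spaces\<close>

definition pderiv_at :: "'m \<Rightarrow> (real ^ 'm \<Rightarrow> real) \<Rightarrow> real ^ 'm::finite \<Rightarrow> real" where
  "pderiv_at i f x = frechet_derivative f (at x) (axis i 1)"

definition pderivs :: "'m list \<Rightarrow> (real ^ 'm \<Rightarrow> real) \<Rightarrow> real ^ 'm::finite \<Rightarrow> real" where
  "pderivs is f = foldr pderiv_at is f"

definition laplacian :: "(real ^ 'm::finite \<Rightarrow> real) \<Rightarrow> real ^ 'm \<Rightarrow> real" where
  "laplacian f x = (\<Sum>i\<in>UNIV. pderivs [i, i] f x)"

text \<open>The space $C^k(\Omega)$ for open $\Omega$.\<close>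

definition C_on :: "nat \<Rightarrow> (real ^ 'm::finite) set \<Rightarrow> (real ^ 'm \<Rightarrow> real) \<Rightarrow> bool" where
  "C_on k \<Omega> f \<longleftrightarrow>
     (\<forall>is. length is < k \<longrightarrow> (\<forall>x\<in>\<Omega>. pderivs is f differentiable (at x))) \<and>
     (\<forall>is. length is \<le> k \<longrightarrow> continuous_on \<Omega> (pderivs is f))"

text \<open>The space $C^k(\bar\Omega)$: all derivatives up to order $k$ on $\Omega$ have continuous
  extensions to the closure. The functions are total, so \<^const>\<open>pderivs\<close> is meaningful
  on the open set only; the extension of $f$ itself has to be $f$.\<close>

definition C_closure :: "nat \<Rightarrow> (real ^ 'm::finite) set \<Rightarrow> (real ^ 'm \<Rightarrow> real) \<Rightarrow> bool" where
  "C_closure k \<Omega> f \<longleftrightarrow> C_on k \<Omega> f \<and> continuous_on (closure \<Omega>) f \<and>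
     (\<forall>is. length is \<le> k \<longrightarrow>
        (\<exists>F. continuous_on (closure \<Omega>) F \<and> (\<forall>x\<in>\<Omega>. F x = pderivs is f x)))"

definition hoelder_on :: "real \<Rightarrow> (real ^ 'm::finite) set \<Rightarrow> (real ^ 'm \<Rightarrow> real) \<Rightarrow> bool" where
  "hoelder_on \<alpha> \<Omega> f \<longleftrightarrow> (\<exists>C. \<forall>x\<in>\<Omega>. \<forall>y\<in>\<Omega>. \<bar>f x - f y\<bar> \<le> C * dist x y powr \<alpha>)"

text \<open>The space $C^{k,\alpha}(\bar\Omega)$.\<close>

definition C_hoelder :: "nat \<Rightarrow> real \<Rightarrow> (real ^ 'm::finite) set \<Rightarrow> (real ^ 'm \<Rightarrow> real) \<Rightarrow> bool" where
  "C_hoelder k \<alpha> \<Omega> f \<longleftrightarrow>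
     C_closure k \<Omega> f \<and> (\<forall>is. length is = k \<longrightarrow> hoelder_on \<alpha> \<Omega> (pderivs is f))"

text \<open>Boundary of class $C^{k,\alpha}$ (Gilbarg--Trudinger, Section 6.2): near every boundary point
  there is a $C^{k,\alpha}$ diffeomorphism straightening the boundary. Requiring
  the regularity up to the closure of the ball $B$ and of its image is no restriction, since $B$
  may be shrunk.\<close>

definition C_hoelder_boundary :: "nat \<Rightarrow> real \<Rightarrow> (real ^ 'm::finite) set \<Rightarrow> bool" where
  "C_hoelder_boundary k \<alpha> \<Omega> \<longleftrightarrow>
     (\<forall>x0\<in>frontier \<Omega>. \<exists>r>0. \<exists>(\<psi> :: real ^ 'm \<Rightarrow> real ^ 'm) \<chi> j.
        (let B = ball x0 r; D = \<psi> ` B in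
           open D \<and> (\<forall>x\<in>B. \<chi> (\<psi> x) = x) \<and>
           (\<forall>x\<in>B \<inter> \<Omega>. vec_nth (\<psi> x) j > 0) \<and>
           (\<forall>x\<in>B \<inter> frontier \<Omega>. vec_nth (\<psi> x) j = 0) \<and>
           (\<forall>i. C_hoelder k \<alpha> B (\<lambda>x. vec_nth (\<psi> x) i)) \<and>
           (\<forall>i. C_hoelder k \<alpha> D (\<lambda>y. vec_nth (\<chi> y) i))))"


section \<open>Sobolev spaces\<close>

text \<open>Elements of $L^2(\Omega)$ and $H^1(\Omega)$ are represented by functions; only their values on
  $\Omega$ matter, up to null sets.\<close>

definition L2_on :: "(real ^ 'm::finite) set \<Rightarrow> (real ^ 'm \<Rightarrow> real) \<Rightarrow> bool" where
  "L2_on \<Omega> u \<longleftrightarrow> u \<in> borel_measurable (lebesgue_on \<Omega>) \<and> integrable (lebesgue_on \<Omega>) (\<lambda>x. (u x)\<^sup>2)"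

text \<open>The space $C_c^\infty(\Omega)$.\<close>

definition test_function :: "(real ^ 'm::finite) set \<Rightarrow> (real ^ 'm \<Rightarrow> real) \<Rightarrow> bool" where
  "test_function \<Omega> \<phi> \<longleftrightarrow>
     (\<forall>k. C_on k UNIV \<phi>) \<and> compact (closure {x. \<phi> x \<noteq> 0}) \<and> closure {x. \<phi> x \<noteq> 0} \<subseteq> \<Omega>"

definition has_weak_gradient ::
  "(real ^ 'm::finite) set \<Rightarrow> (real ^ 'm \<Rightarrow> real) \<Rightarrow> (real ^ 'm \<Rightarrow> real ^ 'm) \<Rightarrow> bool" where
  "has_weak_gradient \<Omega> u v \<longleftrightarrow> (\<forall>i. L2_on \<Omega> (\<lambda>x. vec_nth (v x) i) \<and>
     (\<forall>\<phi>. test_function \<Omega> \<phi> \<longrightarrow>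
        integral\<^sup>L (lebesgue_on \<Omega>) (\<lambda>x. u x * pderiv_at i \<phi> x) =
        - integral\<^sup>L (lebesgue_on \<Omega>) (\<lambda>x. vec_nth (v x) i * \<phi> x)))"

definition weak_gradient ::
  "(real ^ 'm::finite) set \<Rightarrow> (real ^ 'm \<Rightarrow> real) \<Rightarrow> real ^ 'm \<Rightarrow> real ^ 'm" where
  "weak_gradient \<Omega> u = (SOME v. has_weak_gradient \<Omega> u v)"

definition H1 :: "(real ^ 'm::finite) set \<Rightarrow> (real ^ 'm \<Rightarrow> real) \<Rightarrow> bool" where
  "H1 \<Omega> u \<longleftrightarrow> L2_on \<Omega> u \<and> (\<exists>v. has_weak_gradient \<Omega> u v)"

definition H1_norm :: "(real ^ 'm::finite) set \<Rightarrow> (real ^ 'm \<Rightarrow> real) \<Rightarrow> real" where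
  "H1_norm \<Omega> u = sqrt (integral\<^sup>L (lebesgue_on \<Omega>) (\<lambda>x. (u x)\<^sup>2) +
     integral\<^sup>L (lebesgue_on \<Omega>) (\<lambda>x. (norm (weak_gradient \<Omega> u x))\<^sup>2))"

text \<open>The space $H^1_0(\Omega)$: the closure of $C_c^\infty(\Omega)$ in $H^1(\Omega)$.\<close>

definition H1_0 :: "(real ^ 'm::finite) set \<Rightarrow> (real ^ 'm \<Rightarrow> real) \<Rightarrow> bool" where
  "H1_0 \<Omega> u \<longleftrightarrow> H1 \<Omega> u \<and> (\<forall>e>0. \<exists>\<phi>. test_function \<Omega> \<phi> \<and> H1_norm \<Omega> (\<lambda>x. u x - \<phi> x) < e)"


section \<open>Poisson's problem\<close>

text \<open>Solutions in $H^1(\Omega)$ are weak solutions, with the boundary condition in the sense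
  $u - g \in H^1_0(\Omega)$.\<close>

definition poisson_solution ::
  "(real ^ 'm::finite) set \<Rightarrow> (real ^ 'm \<Rightarrow> real) \<Rightarrow> (real ^ 'm \<Rightarrow> real) \<Rightarrow> (real ^ 'm \<Rightarrow> real) \<Rightarrow> bool"
  where
  "poisson_solution \<Omega> f g u \<longleftrightarrow> H1 \<Omega> u \<and>
     (\<forall>\<phi>. test_function \<Omega> \<phi> \<longrightarrow>
        integral\<^sup>L (lebesgue_on \<Omega>)
          (\<lambda>x. \<Sum>i\<in>UNIV. vec_nth (weak_gradient \<Omega> u x) i * pderiv_at i \<phi> x) =
        integral\<^sup>L (lebesgue_on \<Omega>) (\<lambda>x. f x * \<phi> x)) \<and>
     H1_0 \<Omega> (\<lambda>x. u x - g x)"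

definition poisson_loss ::
  "(real ^ 'm::finite) set \<Rightarrow> (real ^ 'm \<Rightarrow> real) \<Rightarrow> ennreal \<Rightarrow> (real ^ 'm \<Rightarrow> real) \<Rightarrow> ennreal"
  where
  "poisson_loss \<Omega> f p u =
     (if p = \<infinity> then esssup (lebesgue_on \<Omega>) (\<lambda>x. ennreal \<bar>- laplacian u x - f x\<bar>)
      else (\<integral>\<^sup>+ x. ennreal (\<bar>- laplacian u x - f x\<bar> powr enn2real p) \<partial>lebesgue_on \<Omega>)
             / emeasure lebesgue \<Omega>)"


section \<open>Feedforward neural networks\<close>

text \<open>A network is the list of its layers $(W^{(i)}, b^{(i)})$.\<close>

type_synonym layers = "(real mat \<times> real Matrix.vec) list"

fun layers_dims :: "nat \<Rightarrow> nat \<Rightarrow> layers \<Rightarrow> bool" where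
  "layers_dims n n' [] \<longleftrightarrow> False"
| "layers_dims n n' [(W, b)] \<longleftrightarrow> W \<in> carrier_mat n' n \<and> b \<in> carrier_vec n'"
| "layers_dims n n' ((W, b) # l # ls) \<longleftrightarrow>
     (\<exists>k>0. W \<in> carrier_mat k n \<and> b \<in> carrier_vec k \<and> layers_dims k n' (l # ls))"

fun eval_layers :: "layers \<Rightarrow> real Matrix.vec \<Rightarrow> real Matrix.vec" where
  "eval_layers [] y = y"
| "eval_layers [(W, b)] y = W *\<^sub>v y + b"
| "eval_layers ((W, b) # l # ls) y = eval_layers (l # ls) (map_vec tanh (W *\<^sub>v y + b))"

text \<open>The enumeration of the coordinates is immaterial: another one permutes the columns of the
  first weight matrix.\<close>

definition coord_vec :: "real ^ 'm::finite \<Rightarrow> real Matrix.vec" where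
  "coord_vec x = Matrix.vec CARD('m) (\<lambda>i. vec_nth x (from_nat_into UNIV i))"

definition neural_network :: "(real ^ 'm::finite \<Rightarrow> real) \<Rightarrow> bool" where
  "neural_network u \<longleftrightarrow>
     (\<exists>ls. layers_dims CARD('m) 1 ls \<and> (\<forall>x. u x = vec_index (eval_layers ls (coord_vec x)) 0))"

definition nn_ansatz ::
  "(real ^ 'm::finite) set \<Rightarrow> (real ^ 'm \<Rightarrow> real) \<Rightarrow> (real ^ 'm \<Rightarrow> real) \<Rightarrow> (real ^ 'm \<Rightarrow> real) \<Rightarrow> bool"
  where
  "nn_ansatz \<Omega> d g u \<longleftrightarrow>
     (\<exists>u_NN. neural_network u_NN \<and> (\<forall>x\<in>closure \<Omega>. u x = d x * u_NN x + g x))"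

end

theory Submission
  imports Defs
begin

text \<open>
  Poisson's equation with right-hand side in $L^2$ is stable: if $w \in H^1_0(\Omega)$ satisfies
  $-\Delta w = r$ weakly, then testing with $w$ itself gives
  $\|\nabla w\|^2 = \int r w \le \|r\| \|w\|$, and Poincare's inequality
  $\|w\|^2 \le C \|\nabla w\|^2$ turns this into a bound of the $H^1$ norm of $w$ by the $L^2$ norm
  of $r$. This is \<open>energy_estimate\<close>. For $r = 0$ it yields uniqueness. For $w = u - \hat u$ the
  right-hand side $r = -\Delta u - \hat f$ is the residual, and \<open>poisson_loss_controls_L2\<close> makes its
  $L^2$ norm small when the loss is small, because $p \ge 2$ and $\Omega$ has finite measure.
  The constant depends on $\Omega$ alone, so one $\delta$ serves all networks; the zero
  network gives the ansatz function $u = \tilde g$.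

  Everything therefore rests on three facts about $H^1_0(\Omega)$, the closure of the smooth
  compactly supported functions.

  First, the weak problem is solvable (\<open>weak_dirichlet_problem_solvable\<close>): with
  $\hat u = w + \tilde g$, a minimizing sequence of the Dirichlet energy over test
  functions is a Cauchy sequence by the parallelogram identity, its limit exists because $L^2$ is
  complete, and the Euler-Lagrange equation survives the limit.

  Second, $d_{\partial\Omega} \cdot u_{NN}$ belongs to $H^1_0(\Omega)$
  (\<open>test_approx_vanishing_on_boundary\<close>). One multiplies by a smooth function of
  $d_{\partial\Omega}$ that vanishes near the boundary; the cutoff is built from
  $d_{\partial\Omega}$ and not from the product, since $d_{\partial\Omega} \neq 0$ inside $\Omega$
  while the network may have zeros there. The cut off function is only as smooth as
  $d_{\partial\Omega}$, and mollification (\<open>test_function_approximation\<close>) replaces it by a test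
  function.

  Third, weak gradients are unique almost everywhere (\<open>weak_gradient_unique\<close>), so that the $H^1$ norm
  can be computed from any of them, in particular from the classical one.

  The tools behind these facts are elementary. Integration by parts comes from the translation
  invariance of Lebesgue measure, Poincare's inequality from integrating
  $\phi^2 \, \partial_i x_i$ by parts, and the fundamental lemma of the calculus of variations from
  Lebesgue's differentiation theorem on boxes.\<close>

section \<open>Calculus of the classes $C^k$\<close>

lemma pderiv_at_eq:
  fixes f :: "real ^ 'm::finite \<Rightarrow> real"
  assumes "(f has_derivative f') (at x)"
  shows "pderiv_at i f x = f' (axis i 1)"
  using frechet_derivative_at[OF assms] by (simp add: pderiv_at_def)

lemma pderiv_at_cong:
  fixes f g :: "real ^ 'm::finite \<Rightarrow> real"
  assumes "open S" "x \<in> S" "\<And>y. y \<in> S \<Longrightarrow> f y = g y"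
  shows "pderiv_at i f x = pderiv_at i g x"
proof -
  have "(f has_derivative f') (at x) \<longleftrightarrow> (g has_derivative f') (at x)" for f'
    using has_derivative_transform_within_open[OF _ assms(1,2)] assms(3) by metis
  then show ?thesis
    by (simp add: pderiv_at_def frechet_derivative_def)
qed

lemma pderivs_snoc: "pderivs (is @ [i]) f = pderivs is (pderiv_at i f)"
  by (simp add: pderivs_def)

lemma pderivs_Nil [simp]: "pderivs [] f = f"
  by (simp add: pderivs_def)

lemma pderivs_Cons: "pderivs (i # is) f = pderiv_at i (pderivs is f)"
  by (simp add: pderivs_def)

lemma pderivs_cong:
  assumes "open S" "x \<in> S" "\<And>y. y \<in> S \<Longrightarrow> f y = g y"
  shows "pderivs is f x = pderivs is g x"
  using assms(2)
proof (induction "is" arbitrary: x)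
  case (Cons i "is")
  then show ?case
    unfolding pderivs_Cons by (intro pderiv_at_cong[OF assms(1)]) auto
qed (use assms in auto)

lemma C_on_0: "C_on 0 \<Omega> f \<longleftrightarrow> continuous_on \<Omega> f"
  by (simp add: C_on_def)

text \<open>Multi-indices are lists whose last entry is differentiated first, so splitting off that entry
  turns the definition of $C^{k+1}$ into a recursion. All closure properties of $C^k$ are
  proved by induction along it.\<close>

lemma C_on_Suc:
  "C_on (Suc k) \<Omega> f \<longleftrightarrow>
     (\<forall>x\<in>\<Omega>. f differentiable (at x)) \<and> continuous_on \<Omega> f \<and> (\<forall>i. C_on k \<Omega> (pderiv_at i f))"
  (is "?L \<longleftrightarrow> ?R")
proof
  assume L: ?L
  have "C_on k \<Omega> (pderiv_at i f)" for i
    unfolding C_on_def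
  proof (intro conjI allI impI)
    fix "is" :: "'a list"
    show "\<forall>x\<in>\<Omega>. pderivs is (pderiv_at i f) differentiable at x" if "length is < k"
      using L[unfolded C_on_def, THEN conjunct1, rule_format, of "is @ [i]"] that
      by (simp add: pderivs_snoc)
    show "continuous_on \<Omega> (pderivs is (pderiv_at i f))" if "length is \<le> k"
      using L[unfolded C_on_def, THEN conjunct2, rule_format, of "is @ [i]"] that
      by (simp add: pderivs_snoc)
  qed
  moreover have "\<forall>x\<in>\<Omega>. f differentiable (at x)" "continuous_on \<Omega> f"
    using L[unfolded C_on_def, THEN conjunct1, rule_format, of "[]"]
      L[unfolded C_on_def, THEN conjunct2, rule_format, of "[]"] by auto
  ultimately show ?R by blast
next
  assume R: ?R
  show ?L
    unfolding C_on_def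
  proof (intro conjI allI impI)
    fix "is" :: "'a list"
    show "\<forall>x\<in>\<Omega>. pderivs is f differentiable at x" if "length is < Suc k"
      using R that by (cases "is" rule: rev_cases) (auto simp: pderivs_snoc C_on_def)
    show "continuous_on \<Omega> (pderivs is f)" if "length is \<le> Suc k"
      using R that by (cases "is" rule: rev_cases) (auto simp: pderivs_snoc C_on_def)
  qed
qed

lemma C_on_mono: "C_on k \<Omega> f \<Longrightarrow> l \<le> k \<Longrightarrow> C_on l \<Omega> f"
  by (auto simp: C_on_def)

lemma C_on_subset: "C_on k T f \<Longrightarrow> S \<subseteq> T \<Longrightarrow> C_on k S f"
  by (auto simp: C_on_def intro: continuous_on_subset)

lemma C_on_continuous: "C_on k \<Omega> f \<Longrightarrow> continuous_on \<Omega> f"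
  using C_on_mono[of k \<Omega> f 0] by (simp add: C_on_0)

lemma linear_eq_sum_axis:
  fixes L :: "real ^ 'm::finite \<Rightarrow> real"
  assumes "linear L"
  shows "L h = (\<Sum>i\<in>UNIV. vec_nth h i * L (axis i 1))"
proof -
  have "h = (\<Sum>i\<in>UNIV. vec_nth h i *\<^sub>R axis i 1)"
    by (simp add: Finite_Cartesian_Product.vec_eq_iff axis_def sum_component if_distrib[of "(*) _"] cong: if_cong)
  then have "L h = L (\<Sum>i\<in>UNIV. vec_nth h i *\<^sub>R axis i 1)"
    by simp
  also have "\<dots> = (\<Sum>i\<in>UNIV. vec_nth h i * L (axis i 1))"
    by (simp add: linear_sum[OF assms] linear_cmul[OF assms])
  finally show ?thesis .
qed

lemma has_derivative_pderiv_at: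
  fixes f :: "real ^ 'm::finite \<Rightarrow> real"
  assumes "f differentiable (at x)"
  shows "(f has_derivative (\<lambda>h. \<Sum>i\<in>UNIV. vec_nth h i * pderiv_at i f x)) (at x)"
proof -
  from assms have *: "(f has_derivative frechet_derivative f (at x)) (at x)"
    by (simp add: frechet_derivative_works)
  moreover have "frechet_derivative f (at x) = (\<lambda>h. \<Sum>i\<in>UNIV. vec_nth h i * pderiv_at i f x)"
    unfolding pderiv_at_def
    by (rule ext, rule linear_eq_sum_axis[OF has_derivative_linear[OF *]])
  ultimately show ?thesis by simp
qed

lemma C_on_cong:
  assumes "open \<Omega>" "\<And>x. x \<in> \<Omega> \<Longrightarrow> f x = g x" "C_on k \<Omega> f"
  shows "C_on k \<Omega> g"
proof -
  have *: "pderivs is f x = pderivs is g x" if "x \<in> \<Omega>" for "is" x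
    using pderivs_cong[OF assms(1) that assms(2)] .
  have "pderivs is g differentiable (at x)"
    if "pderivs is f differentiable (at x)" "x \<in> \<Omega>" for "is" x
    using that * has_derivative_transform_within_open[OF _ assms(1) that(2)]
    unfolding differentiable_def by metis
  moreover have "continuous_on \<Omega> (pderivs is g)" if "continuous_on \<Omega> (pderivs is f)" for "is"
    using that * by (subst continuous_on_cong[OF refl, of _ _ "pderivs is f"]) auto
  ultimately show ?thesis
    using assms(3) unfolding C_on_def by blast
qed

text \<open>The derivative is given as a linear form with coefficients \<open>D i\<close>, so that one application of the
  differentiation rules for Frechet derivatives yields all partial derivatives at once.\<close>

lemma C_on_SucI:
  fixes f :: "real ^ 'm::finite \<Rightarrow> real"
  assumes "open \<Omega>"
    and der: "\<And>x. x \<in> \<Omega> \<Longrightarrow> (f has_derivative (\<lambda>h. \<Sum>i\<in>UNIV. vec_nth h i * D i x)) (at x)"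
    and "\<And>i. C_on k \<Omega> (D i)"
  shows "C_on (Suc k) \<Omega> f"
  unfolding C_on_Suc
proof (intro conjI ballI allI)
  show "f differentiable (at x)" if "x \<in> \<Omega>" for x
    using der[OF that] by (auto simp: differentiable_def)
  then show "continuous_on \<Omega> f"
    by (meson continuous_at_imp_continuous_on differentiable_imp_continuous_within)
  have "pderiv_at i f x = D i x" if "x \<in> \<Omega>" for i x
    using pderiv_at_eq[OF der[OF that], of i]
    by (simp add: axis_def if_distrib[of "\<lambda>u. u * _"] cong: if_cong)
  then show "C_on k \<Omega> (pderiv_at i f)" for i
    using C_on_cong[OF assms(1) _ assms(3)[of i], of "pderiv_at i f"] by simp
qed

lemma C_on_SucD:
  assumes "C_on (Suc k) \<Omega> f"
  shows "x \<in> \<Omega> \<Longrightarrow> (f has_derivative (\<lambda>h. \<Sum>i\<in>UNIV. vec_nth h i * pderiv_at i f x)) (at x)"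
    and "C_on k \<Omega> (pderiv_at i f)"
  using assms by (auto simp: C_on_Suc intro: has_derivative_pderiv_at)

lemma sum_axis_mult [simp]:
  fixes a :: "'m::finite \<Rightarrow> real"
  shows "(\<Sum>j\<in>UNIV. vec_nth (axis i 1) j * a j) = a i"
  by (simp add: axis_def if_distrib[of "\<lambda>u. u * _"] cong: if_cong)

lemma pderiv_at_const: "pderiv_at i (\<lambda>x. c) x = 0"
  using pderiv_at_eq[OF has_derivative_const] .

lemma C_on_const: "open \<Omega> \<Longrightarrow> C_on k \<Omega> (\<lambda>x. c)"
proof (induction k arbitrary: c)
  case (Suc k)
  then show ?case
    by (intro C_on_SucI[where D = "\<lambda>i x. 0"]) auto
qed (simp add: C_on_0)

lemma pderiv_at_add:
  assumes "f differentiable (at x)" "g differentiable (at x)"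
  shows "pderiv_at i (\<lambda>x. f x + g x) x = pderiv_at i f x + pderiv_at i g x"
  using pderiv_at_eq[OF has_derivative_add[OF assms[THEN has_derivative_pderiv_at]], of i] by simp

lemma pderiv_at_diff:
  assumes "f differentiable (at x)" "g differentiable (at x)"
  shows "pderiv_at i (\<lambda>x. f x - g x) x = pderiv_at i f x - pderiv_at i g x"
  using pderiv_at_eq[OF has_derivative_diff[OF assms[THEN has_derivative_pderiv_at]], of i] by simp

lemma pderiv_at_mult:
  assumes "f differentiable (at x)" "g differentiable (at x)"
  shows "pderiv_at i (\<lambda>x. f x * g x) x = pderiv_at i f x * g x + f x * pderiv_at i g x"
  using pderiv_at_eq[OF has_derivative_mult[OF assms[THEN has_derivative_pderiv_at]], of i] by simp

lemma pderiv_at_cmult: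
  assumes "f differentiable (at x)"
  shows "pderiv_at i (\<lambda>x. c * f x) x = c * pderiv_at i f x"
  using pderiv_at_mult[OF _ assms, of "\<lambda>x. c" i] by (simp add: pderiv_at_const)

lemma pderiv_at_compose:
  assumes "f differentiable (at x)" "(h has_real_derivative h') (at (f x))"
  shows "pderiv_at i (\<lambda>x. h (f x)) x = h' * pderiv_at i f x"
proof -
  have "((\<lambda>x. h (f x)) has_derivative (\<lambda>y. h' * (\<Sum>i\<in>UNIV. vec_nth y i * pderiv_at i f x))) (at x)"
    using has_derivative_compose[OF has_derivative_pderiv_at[OF assms(1)]
        assms(2)[unfolded has_field_derivative_def]] .
  from pderiv_at_eq[OF this, of i] show ?thesis by simp
qed

lemma C_on_add:
  "open \<Omega> \<Longrightarrow> C_on k \<Omega> f \<Longrightarrow> C_on k \<Omega> g \<Longrightarrow> C_on k \<Omega> (\<lambda>x. f x + g x)"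
proof (induction k arbitrary: f g)
  case (Suc k)
  show ?case
    using has_derivative_add[OF C_on_SucD(1)[OF Suc.prems(2)] C_on_SucD(1)[OF Suc.prems(3)]]
    by (intro C_on_SucI[where D = "\<lambda>i x. pderiv_at i f x + pderiv_at i g x"]
        Suc C_on_SucD(2)[OF Suc.prems(2)] C_on_SucD(2)[OF Suc.prems(3)])
      (auto simp: sum.distrib algebra_simps)
qed (auto simp: C_on_0 intro: continuous_intros)

lemma C_on_mult:
  "open \<Omega> \<Longrightarrow> C_on k \<Omega> f \<Longrightarrow> C_on k \<Omega> g \<Longrightarrow> C_on k \<Omega> (\<lambda>x. f x * g x)"
proof (induction k arbitrary: f g)
  case (Suc k)
  have "C_on k \<Omega> f" "C_on k \<Omega> g"
    using Suc.prems C_on_mono le_SucI by blast+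
  then show ?case
    using has_derivative_mult[OF C_on_SucD(1)[OF Suc.prems(2)] C_on_SucD(1)[OF Suc.prems(3)]]
    by (intro C_on_SucI[where D = "\<lambda>i x. f x * pderiv_at i g x + pderiv_at i f x * g x"] C_on_add
        Suc.IH Suc.prems C_on_SucD(2)[OF Suc.prems(2)] C_on_SucD(2)[OF Suc.prems(3)])
      (auto simp: sum.distrib algebra_simps sum_distrib_left sum_distrib_right)
qed (auto simp: C_on_0 intro: continuous_intros)

lemma C_on_diff:
  "open \<Omega> \<Longrightarrow> C_on k \<Omega> f \<Longrightarrow> C_on k \<Omega> g \<Longrightarrow> C_on k \<Omega> (\<lambda>x. f x - g x)"
  using C_on_add[of \<Omega> k f "\<lambda>x. -1 * g x"] C_on_mult[of \<Omega> k "\<lambda>x. -1" g] C_on_const[of \<Omega> k "-1"]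
  by simp

lemma C_on_sum:
  "open \<Omega> \<Longrightarrow> (\<And>i. i \<in> I \<Longrightarrow> C_on k \<Omega> (f i)) \<Longrightarrow> C_on k \<Omega> (\<lambda>x. \<Sum>i\<in>I. f i x)"
  by (induction I rule: infinite_finite_induct) (auto intro: C_on_const C_on_add)

lemma C_on_prod:
  "open \<Omega> \<Longrightarrow> (\<And>i. i \<in> I \<Longrightarrow> C_on k \<Omega> (f i)) \<Longrightarrow> C_on k \<Omega> (\<lambda>x. \<Prod>i\<in>I. f i x)"
  by (induction I rule: infinite_finite_induct) (auto intro: C_on_const C_on_mult)

lemma has_derivative_coord:
  "((\<lambda>x. vec_nth x j) has_derivative
      (\<lambda>h. \<Sum>i\<in>UNIV. vec_nth h i * (if i = j then 1 else 0 :: real))) (at x)"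
  by (simp add: bounded_linear_imp_has_derivative[OF bounded_linear_vec_nth]
      if_distrib[of "(*) _"] cong: if_cong)

lemma pderiv_at_coord: "pderiv_at i (\<lambda>x. vec_nth x j) x = (if i = j then 1 else 0)"
  using pderiv_at_eq[OF has_derivative_coord, of i] by simp

lemma C_on_coord: "open \<Omega> \<Longrightarrow> C_on k \<Omega> (\<lambda>x. vec_nth x j)"
proof (cases k)
  case (Suc l)
  assume "open \<Omega>"
  then show ?thesis
    unfolding Suc using has_derivative_coord[of j]
    by (intro C_on_SucI[where D = "\<lambda>i x. (if i = j then 1 else 0)"] C_on_const)
qed (auto simp: C_on_0 intro: continuous_intros)

text \<open>Chain rule for a family of functions of one variable that is closed under differentiation.\<close>

text \<open>Chain rule for a family of functions of one variable whose derivatives are expressible in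
  the family again. Induction over the whole family is what makes the step go through: the
  derivative of one member involves other members, of which only $C^k$ regularity is known.\<close>

lemma C_on_compose:
  fixes h :: "'i \<Rightarrow> real \<Rightarrow> real"
  assumes "open \<Omega>"
    and der: "\<And>n t. (h n has_real_derivative h' n t) (at t)"
    and step: "\<And>k n. (\<And>m. C_on k \<Omega> (\<lambda>x. h m (f x))) \<Longrightarrow> C_on k \<Omega> (\<lambda>x. h' n (f x))"
  shows "C_on k \<Omega> f \<Longrightarrow> C_on k \<Omega> (\<lambda>x. h n (f x))"
proof (induction k arbitrary: n)
  case 0
  have "continuous_on UNIV (h n)"
    using der by (meson DERIV_isCont continuous_at_imp_continuous_on)
  then show ?case
    using 0 by (auto simp: C_on_0 intro: continuous_on_compose2)
next
  case (Suc k)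
  have "C_on k \<Omega> f"
    using Suc.prems C_on_mono le_SucI by blast
  then have "C_on k \<Omega> (\<lambda>x. h' n (f x))"
    by (intro step Suc.IH)
  moreover have "((\<lambda>x. h n (f x)) has_derivative
      (\<lambda>y. \<Sum>i\<in>UNIV. vec_nth y i * (h' n (f x) * pderiv_at i f x))) (at x)" if "x \<in> \<Omega>" for x
    using has_derivative_compose[OF C_on_SucD(1)[OF Suc.prems that]
        der[of n "f x", unfolded has_field_derivative_def]]
    by (simp add: sum_distrib_left mult_ac)
  ultimately show ?case
    by (intro C_on_SucI[where D = "\<lambda>i x. h' n (f x) * pderiv_at i f x"] C_on_mult assms(1)
        C_on_SucD(2)[OF Suc.prems])
qed

lemma C_on_tanh:
  assumes "open \<Omega>" "C_on k \<Omega> f"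
  shows "C_on k \<Omega> (\<lambda>x. tanh (f x))"
proof (rule C_on_compose[where h = "\<lambda>_::unit. tanh" and h' = "\<lambda>_ t. 1 - tanh t * tanh t"])
  show "(tanh has_real_derivative 1 - tanh t * tanh t) (at t)" for t :: real
    by (auto intro!: derivative_eq_intros simp: power2_eq_square)
qed (use assms in \<open>auto intro!: C_on_diff C_on_mult C_on_const\<close>)

section \<open>Flat functions and bumps\<close>

text \<open>The functions $e^{-1/t} t^{-n}$ for $t > 0$, extended by $0$. The parameter \<open>n\<close> makes the family
  closed under differentiation.\<close>

definition flat_exp :: "nat \<Rightarrow> real \<Rightarrow> real" where
  "flat_exp n t = (if t > 0 then exp (- 1 / t) / t ^ n else 0)"

lemma power_le_fact_exp:
  fixes s :: real
  assumes "s \<ge> 0"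
  shows "s ^ n \<le> fact n * exp s"
proof -
  have "(\<Sum>k\<in>{n}. s ^ k /\<^sub>R fact k) \<le> (\<Sum>k. s ^ k /\<^sub>R fact k)"
    using assms by (intro sum_le_suminf) (auto intro: summable_exp_generic simp del: real_scaleR_def intro!: scaleR_nonneg_nonneg)
  then have "s ^ n / fact n \<le> exp s"
    by (simp add: exp_def divide_inverse mult.commute)
  then show ?thesis
    by (simp add: field_simps)
qed

lemma flat_exp_nonneg: "flat_exp n t \<ge> 0"
  by (simp add: flat_exp_def)

text \<open>From $s^n \le n! \, e^s$ at $s = 1/t$.\<close>

lemma flat_exp_le_fact: "flat_exp n t \<le> fact n"
proof (cases "t > 0")
  case True
  have "(1 / t) ^ n \<le> fact n * exp (1 / t)"
    using True by (intro power_le_fact_exp) auto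
  then have "(1 / t) ^ n * exp (- 1 / t) \<le> (fact n * exp (1 / t)) * exp (- 1 / t)"
    by (intro mult_right_mono) auto
  also have "\<dots> = fact n"
    by (simp add: mult.assoc flip: exp_add)
  finally show ?thesis
    using True by (simp add: flat_exp_def power_divide)
qed (simp add: flat_exp_def)

lemma flat_exp_Suc: "flat_exp n t = t * flat_exp (Suc n) t"
  by (simp add: flat_exp_def)

text \<open>At the origin the difference quotient of the $n$-th function is the value of the next one, which
  is bounded by $|t|$ times a constant because the function after it is bounded.\<close>

lemma has_real_derivative_flat_exp:
  "(flat_exp n has_real_derivative flat_exp (n + 2) t - n * flat_exp (Suc n) t) (at t)"
proof -
  consider "t < 0" | "t = 0" | "t > 0" by linarith
  then show ?thesis
  proof cases
    case 1
    have "((\<lambda>_. 0) has_real_derivative 0) (at t)" by simp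
    then have "(flat_exp n has_real_derivative 0) (at t)"
      by (rule has_field_derivative_transform_within_open[of _ _ _ "{..<0}"])
        (use 1 in \<open>auto simp: flat_exp_def\<close>)
    then show ?thesis using 1 by (simp add: flat_exp_def)
  next
    case 2
    have "(\<lambda>h. flat_exp (Suc n) h) \<midarrow>0\<rightarrow> 0"
    proof (rule Lim_null_comparison)
      show "\<forall>\<^sub>F h in at 0. norm (flat_exp (Suc n) h) \<le> \<bar>h\<bar> * fact (Suc (Suc n))"
        using flat_exp_Suc[of "Suc n"] flat_exp_le_fact[of "Suc (Suc n)"]
          flat_exp_nonneg[of "Suc (Suc n)"]
        by (intro always_eventually allI) (metis abs_ge_zero abs_mult abs_of_nonneg mult_left_mono real_norm_def)
      show "(\<lambda>h. \<bar>h\<bar> * fact (Suc (Suc n)) :: real) \<midarrow>0\<rightarrow> 0"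
        by (auto intro!: tendsto_eq_intros)
    qed
    then have "(\<lambda>h. (flat_exp n (0 + h) - flat_exp n 0) / h) \<midarrow>0\<rightarrow> 0"
      by (rule Lim_transform_eventually)
        (auto simp: eventually_at_filter flat_exp_Suc[of n] intro!: always_eventually)
    then show ?thesis
      using 2 by (simp add: DERIV_def flat_exp_def)
  next
    case 3
    have "((\<lambda>t. exp (- 1 / t) / t ^ n) has_real_derivative
        ((1 / t\<^sup>2) * exp (- 1 / t) * t ^ n - exp (- 1 / t) * (n * t ^ (n - 1))) / (t ^ n * t ^ n)) (at t)"
      using 3 by (auto intro!: derivative_eq_intros simp: power2_eq_square)
    moreover have "((1 / t\<^sup>2) * exp (- 1 / t) * t ^ n - exp (- 1 / t) * (n * t ^ (n - 1))) / (t ^ n * t ^ n)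
        = flat_exp (n + 2) t - n * flat_exp (Suc n) t"
      using 3 by (cases n) (auto simp: flat_exp_def field_simps power2_eq_square)
    ultimately have "((\<lambda>t. exp (- 1 / t) / t ^ n) has_real_derivative
        flat_exp (n + 2) t - n * flat_exp (Suc n) t) (at t)" by simp
    then show ?thesis
      by (rule has_field_derivative_transform_within_open[of _ _ _ "{0<..}"])
        (use 3 in \<open>auto simp: flat_exp_def\<close>)
  qed
qed

lemma C_on_flat_exp:
  assumes "open \<Omega>" "C_on k \<Omega> f"
  shows "C_on k \<Omega> (\<lambda>x. flat_exp n (f x))"
  by (rule C_on_compose[where h = flat_exp and
        h' = "\<lambda>n t. flat_exp (n + 2) t - n * flat_exp (Suc n) t"])
    (use assms in \<open>auto intro!: C_on_diff C_on_mult C_on_const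
      simp: has_real_derivative_flat_exp[simplified]\<close>)

text \<open>A smooth function that is positive exactly on the box; for \<open>s \<rightarrow> \<infinity>\<close> it increases to the
  indicator function.\<close>

definition box_bump :: "real \<Rightarrow> real ^ 'm::finite \<Rightarrow> real ^ 'm \<Rightarrow> real ^ 'm \<Rightarrow> real" where
  "box_bump s a b x = (\<Prod>i\<in>UNIV. flat_exp 0 (s * (vec_nth x i - vec_nth a i)) *
                                   flat_exp 0 (s * (vec_nth b i - vec_nth x i)))"

lemma C_on_box_bump: "C_on k UNIV (box_bump s a b)"
  unfolding box_bump_def[abs_def]
  by (intro C_on_prod C_on_mult C_on_flat_exp C_on_diff C_on_const C_on_coord open_UNIV)

lemma mem_box_vec:
  "x \<in> box a (b :: real ^ 'm::finite) \<longleftrightarrow> (\<forall>i. vec_nth a i < vec_nth x i \<and> vec_nth x i < vec_nth b i)"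
  by (auto simp: mem_box Basis_vec_def inner_axis)

lemma box_bump_pos: "s > 0 \<Longrightarrow> x \<in> box a b \<Longrightarrow> box_bump s a b x > 0"
  unfolding box_bump_def mem_box_vec by (intro prod_pos) (auto simp: flat_exp_def)

lemma box_bump_nonneg: "box_bump s a b x \<ge> 0"
  unfolding box_bump_def by (intro prod_nonneg) (auto simp: flat_exp_nonneg)

lemma box_bump_le_1: "box_bump s a b x \<le> 1"
  unfolding box_bump_def
  by (intro prod_le_1)
    (use flat_exp_nonneg[of 0] flat_exp_le_fact[of 0] in \<open>auto intro!: mult_le_one\<close>)

lemma box_bump_eq_0:
  assumes "s > 0" "x \<notin> box a b"
  shows "box_bump s a b x = 0"
proof -
  obtain i where "vec_nth x i \<le> vec_nth a i \<or> vec_nth b i \<le> vec_nth x i"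
    using assms(2) unfolding mem_box_vec by (auto simp: not_less)
  then have "flat_exp 0 (s * (vec_nth x i - vec_nth a i)) * flat_exp 0 (s * (vec_nth b i - vec_nth x i)) = 0"
    using assms(1) by (auto simp: flat_exp_def zero_less_mult_iff)
  then show ?thesis
    unfolding box_bump_def by (intro prod_zero) auto
qed

lemma box_bump_tendsto:
  "(\<lambda>n. box_bump (real (Suc n)) a b x) \<longlonglongrightarrow> indicator (box a b) x"
proof (cases "x \<in> box a b")
  case True
  have *: "(\<lambda>n. flat_exp 0 (real (Suc n) * t)) \<longlonglongrightarrow> 1" if "t > 0" for t
  proof -
    have "(\<lambda>n. exp (- (1 / t) * inverse (real (Suc n)))) \<longlonglongrightarrow> exp (- (1 / t) * 0)"
      by (intro tendsto_intros LIMSEQ_inverse_real_of_nat)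
    then show ?thesis
      using that by (simp add: flat_exp_def zero_less_mult_iff divide_simps mult.commute
          del: of_nat_Suc)
  qed
  have "(\<lambda>n. box_bump (real (Suc n)) a b x) \<longlonglongrightarrow> (\<Prod>i\<in>(UNIV :: 'a set). 1 * 1)"
    unfolding box_bump_def
    by (intro tendsto_prod tendsto_mult *) (use True in \<open>auto simp: mem_box_vec\<close>)
  then show ?thesis using True by simp
next
  case False
  then show ?thesis by (simp add: box_bump_eq_0)
qed

section \<open>Integration by parts\<close>

lemma pderiv_at_outside_support:
  assumes "x \<notin> closure {x. \<psi> x \<noteq> 0}"
  shows "pderiv_at i \<psi> x = 0"
proof -
  have "pderiv_at i \<psi> x = pderiv_at i (\<lambda>_. 0) x"
    using assms closure_subset[of "{x. \<psi> x \<noteq> 0}"]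
    by (intro pderiv_at_cong[where S = "- closure {x. \<psi> x \<noteq> 0}"]) auto
  then show ?thesis by (simp add: pderiv_at_const)
qed

lemma integrable_continuous_bounded_support:
  fixes f :: "'a::euclidean_space \<Rightarrow> real"
  assumes "continuous_on UNIV f" "bounded {x. f x \<noteq> 0}"
  shows "integrable lborel f"
proof -
  have "integrable lborel (\<lambda>x. indicator (closure {x. f x \<noteq> 0}) x *\<^sub>R f x)"
    using assms by (intro borel_integrable_compact) (auto intro: continuous_on_subset)
  also have "(\<lambda>x. indicator (closure {x. f x \<noteq> 0}) x *\<^sub>R f x) = f"
    using closure_subset[of "{x. f x \<noteq> 0}"] by (auto simp: indicator_def fun_eq_iff)
  finally show ?thesis .
qed

lemma bounded_continuous_bounded_support:
  fixes f :: "'a::euclidean_space \<Rightarrow> real"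
  assumes "continuous_on UNIV f" "bounded {x. f x \<noteq> 0}"
  obtains K where "K > 0" "\<And>x. \<bar>f x\<bar> \<le> K"
proof -
  have "bounded (f ` closure {x. f x \<noteq> 0})"
    using assms by (intro compact_imp_bounded compact_continuous_image)
      (auto intro: continuous_on_subset)
  then obtain K where K: "K > 0" "\<And>x. x \<in> closure {x. f x \<noteq> 0} \<Longrightarrow> \<bar>f x\<bar> \<le> K"
    unfolding bounded_pos by auto
  moreover have "\<bar>f x\<bar> \<le> K" for x
    using K closure_subset[of "{x. f x \<noteq> 0}"] by (cases "f x = 0") auto
  ultimately show ?thesis using that by blast
qed

lemma lborel_integral_translation:
  fixes f :: "'a::euclidean_space \<Rightarrow> real"
  assumes "f \<in> borel_measurable borel"
  shows "(LINT x|lborel. f (c + x)) = (LINT x|lborel. f x)"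
  using integral_distr[of "(+) c" lborel borel f] assms by (simp add: lborel_distr_plus)

lemma has_real_derivative_along_axis:
  fixes f :: "real ^ 'm::finite \<Rightarrow> real"
  assumes "C_on 1 UNIV f"
  shows "((\<lambda>t. f (x + t *\<^sub>R axis i 1)) has_real_derivative
           pderiv_at i f (x + t *\<^sub>R axis i 1)) (at t)"
proof -
  have 1: "((\<lambda>t. x + t *\<^sub>R axis i 1) has_derivative (\<lambda>t. t *\<^sub>R axis i 1)) (at t)"
    by (auto intro!: derivative_eq_intros)
  have "((\<lambda>t. f (x + t *\<^sub>R axis i 1)) has_derivative
      (\<lambda>s. s * pderiv_at i f (x + t *\<^sub>R axis i 1))) (at t)"
    using has_derivative_compose[OF 1 C_on_SucD(1)[OF assms(1)[unfolded One_nat_def]]]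
    by (simp add: mult.assoc flip: sum_distrib_left)
  moreover have "(\<lambda>s. s * pderiv_at i f (x + t *\<^sub>R axis i 1)) = (*) (pderiv_at i f (x + t *\<^sub>R axis i 1))"
    by auto
  ultimately show ?thesis
    by (simp add: has_field_derivative_def)
qed

lemma pderiv_at_MVT:
  fixes f :: "real ^ 'm::finite \<Rightarrow> real"
  assumes "C_on 1 UNIV f" "0 < h"
  obtains z where "f (x + h *\<^sub>R axis i 1) - f x = h * pderiv_at i f (x + z *\<^sub>R axis i 1)"
  using MVT2[OF assms(2) has_real_derivative_along_axis[OF assms(1)], of x i] by auto

lemma pderiv_at_bounded_support:
  "bounded {x. \<psi> x \<noteq> 0} \<Longrightarrow> bounded {x. pderiv_at i \<psi> x \<noteq> 0}"
  by (rule bounded_subset[of "closure {x. \<psi> x \<noteq> 0}"]) (use pderiv_at_outside_support in auto)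

text \<open>The difference quotients in direction $e_i$ have integral $0$ by translation invariance, and they
  converge to $\partial_i \psi$ dominated by a multiple of the indicator function of a ball.\<close>

lemma integral_pderiv_at_eq_0:
  fixes \<psi> :: "real ^ 'm::finite \<Rightarrow> real"
  assumes C1: "C_on 1 UNIV \<psi>" and supp: "bounded {x. \<psi> x \<noteq> 0}"
  shows "(LINT x|lborel. pderiv_at i \<psi> x) = 0"
proof -
  let ?e = "axis i 1 :: real ^ 'm"
  define q where "q n x = (\<psi> (inverse (real (Suc n)) *\<^sub>R ?e + x) - \<psi> x) / inverse (real (Suc n))" for n x
  have cont: "continuous_on UNIV \<psi>" "continuous_on UNIV (pderiv_at i \<psi>)"
    using C1 by (auto simp: C_on_Suc C_on_0)
  have int: "integrable lborel \<psi>"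
    using integrable_continuous_bounded_support[OF cont(1) supp] .
  have meas [measurable]: "\<psi> \<in> borel_measurable borel" "pderiv_at i \<psi> \<in> borel_measurable borel"
    using cont by (auto intro: borel_measurable_continuous_onI)
  obtain K where K: "K > 0" "\<And>x. \<bar>pderiv_at i \<psi> x\<bar> \<le> K"
    using bounded_continuous_bounded_support[OF cont(2) pderiv_at_bounded_support[OF supp]] by blast
  obtain R where R: "\<And>x. \<psi> x \<noteq> 0 \<Longrightarrow> norm x \<le> R"
    using supp unfolding bounded_iff by auto
  have tr: "integrable lborel (\<lambda>x. \<psi> (c + x))" for c
    using integrable_distr_eq[of "(+) c" lborel borel \<psi>] int by (simp add: lborel_distr_plus)
  have "(\<lambda>n. LINT x|lborel. q n x) \<longlonglongrightarrow> (LINT x|lborel. pderiv_at i \<psi> x)"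
  proof (rule integral_dominated_convergence)
    show "integrable lborel (\<lambda>x. K * indicator (cball 0 (R + 1) :: (real ^ 'm) set) x)"
      using emeasure_lborel_cball_finite[of "0 :: real ^ 'm" "R + 1"] by simp
    show "AE x in lborel. (\<lambda>n. q n x) \<longlonglongrightarrow> pderiv_at i \<psi> x"
    proof (rule AE_I2)
      fix x
      have "(\<lambda>h. (\<psi> (x + h *\<^sub>R ?e) - \<psi> x) / h) \<midarrow>0\<rightarrow> pderiv_at i \<psi> x"
        using has_real_derivative_along_axis[OF C1, of x i 0] by (simp add: DERIV_def)
      moreover have "filterlim (\<lambda>n. inverse (real (Suc n))) (at 0) sequentially"
        by (intro filterlim_atI LIMSEQ_inverse_real_of_nat) auto
      ultimately show "(\<lambda>n. q n x) \<longlonglongrightarrow> pderiv_at i \<psi> x"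
        unfolding q_def add.commute[of _ x] by (rule filterlim_compose)
    qed
    show "AE x in lborel. norm (q n x) \<le> K * indicator (cball 0 (R + 1)) x" for n
    proof (rule AE_I2)
      fix x
      let ?h = "inverse (real (Suc n))"
      show "norm (q n x) \<le> K * indicator (cball 0 (R + 1)) x"
      proof (cases "norm x \<le> R + 1")
        case True
        obtain z where "\<psi> (x + ?h *\<^sub>R ?e) - \<psi> x = ?h * pderiv_at i \<psi> (x + z *\<^sub>R ?e)"
          using pderiv_at_MVT[OF C1, of ?h] by auto
        then have "q n x = pderiv_at i \<psi> (x + z *\<^sub>R ?e)"
          by (simp add: q_def add.commute del: of_nat_Suc)
        then show ?thesis using K True by simp
      next
        case False
        have "?h \<le> 1" by (simp add: field_simps)
        then have "norm (?h *\<^sub>R ?e) \<le> 1" by (simp del: of_nat_Suc)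
        moreover have "norm x \<le> norm (?h *\<^sub>R ?e + x) + norm (?h *\<^sub>R ?e)"
          using norm_triangle_ineq4[of "?h *\<^sub>R ?e + x" "?h *\<^sub>R ?e"] by simp
        ultimately have "norm (?h *\<^sub>R ?e + x) > R" using False by linarith
        then have "\<psi> (?h *\<^sub>R ?e + x) = 0" "\<psi> x = 0" using R[of x] R[of "?h *\<^sub>R ?e + x"] False by force+
        then show ?thesis using K by (simp add: q_def)
      qed
    qed
  qed (auto simp: q_def[abs_def])
  moreover have "(LINT x|lborel. q n x) = 0" for n
    unfolding q_def using tr int by (simp add: lborel_integral_translation)
  ultimately show ?thesis using LIMSEQ_unique[OF _ tendsto_const] by force
qed

lemma C_on_Un:
  assumes "open S" "open T" "C_on k S f" "C_on k T f"
  shows "C_on k (S \<union> T) f"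
  using assms(3,4) continuous_on_open_Un[OF assms(1,2)] unfolding C_on_def by blast

text \<open>The extension is $C^k$ on $\Omega$ and on the complement of $K$, and these two open sets cover
  the space.\<close>

lemma C_on_zero_extension:
  assumes "open \<Omega>" "C_on k \<Omega> f" "closed K" "K \<subseteq> \<Omega>" "\<And>x. x \<in> \<Omega> - K \<Longrightarrow> f x = 0"
  shows "C_on k UNIV (\<lambda>x. if x \<in> \<Omega> then f x else 0)"
proof -
  have "C_on k (\<Omega> \<union> - K) (\<lambda>x. if x \<in> \<Omega> then f x else 0)"
  proof (rule C_on_Un)
    show "C_on k \<Omega> (\<lambda>x. if x \<in> \<Omega> then f x else 0)"
      by (rule C_on_cong[OF assms(1) _ assms(2)]) auto
    show "C_on k (- K) (\<lambda>x. if x \<in> \<Omega> then f x else 0)"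
      by (rule C_on_cong[OF _ _ C_on_const[of _ _ 0]]) (use assms in auto)
  qed (use assms in auto)
  moreover have "\<Omega> \<union> - K = UNIV" using assms(4) by auto
  ultimately show ?thesis by simp
qed

text \<open>The support condition of \<^const>\<open>test_function\<close> alone, to be combined with lower regularity.\<close>

definition compact_support_in :: "(real ^ 'm::finite) set \<Rightarrow> (real ^ 'm \<Rightarrow> real) \<Rightarrow> bool" where
  "compact_support_in \<Omega> \<phi> \<longleftrightarrow> compact (closure {x. \<phi> x \<noteq> 0}) \<and> closure {x. \<phi> x \<noteq> 0} \<subseteq> \<Omega>"

lemma test_function_iff: "test_function \<Omega> \<phi> \<longleftrightarrow> (\<forall>k. C_on k UNIV \<phi>) \<and> compact_support_in \<Omega> \<phi>"
  by (simp add: test_function_def compact_support_in_def)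

lemma compact_support_inI:
  assumes "compact K" "K \<subseteq> \<Omega>" "\<And>x. x \<notin> K \<Longrightarrow> \<phi> x = 0"
  shows "compact_support_in \<Omega> \<phi>"
proof -
  have "closure {x. \<phi> x \<noteq> 0} \<subseteq> K"
    using assms by (intro closure_minimal compact_imp_closed) auto
  then show ?thesis
    using assms compact_Int_closed[OF assms(1) closed_closure[of "{x. \<phi> x \<noteq> 0}"]]
    unfolding compact_support_in_def by (auto simp: Int_absorb1)
qed

lemma compact_support_in_bounded: "compact_support_in \<Omega> \<phi> \<Longrightarrow> bounded {x. \<phi> x \<noteq> 0}"
  unfolding compact_support_in_def by (meson bounded_subset closure_subset compact_imp_bounded)

lemma compact_support_in_pderiv_at:
  assumes "compact_support_in \<Omega> \<phi>"
  shows "compact_support_in \<Omega> (pderiv_at i \<phi>)"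
  using assms pderiv_at_outside_support[of _ \<phi> i]
  by (intro compact_support_inI[of "closure {x. \<phi> x \<noteq> 0}"]) (auto simp: compact_support_in_def)

lemma lebesgue_on_integral_zero_extension:
  fixes F :: "'a::euclidean_space \<Rightarrow> real"
  assumes "open \<Omega>" "continuous_on \<Omega> F" "compact K" "K \<subseteq> \<Omega>" "\<And>x. x \<in> \<Omega> - K \<Longrightarrow> F x = 0"
  shows "integrable (lebesgue_on \<Omega>) F"
    and "(LINT x|lebesgue_on \<Omega>. F x) = (LINT x|lborel. (if x \<in> \<Omega> then F x else 0))"
proof -
  let ?G = "\<lambda>x. if x \<in> \<Omega> then F x else 0"
  have "integrable lborel (\<lambda>x. indicator K x *\<^sub>R F x)"
    using assms by (intro borel_integrable_compact) (auto intro: continuous_on_subset)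
  also have "(\<lambda>x. indicator K x *\<^sub>R F x) = ?G"
    using assms(4,5) by (auto simp: indicator_def fun_eq_iff)
  finally have int: "integrable lborel ?G" .
  have eq: "?G = (\<lambda>x. indicator \<Omega> x *\<^sub>R F x)"
    by (auto simp: indicator_def)
  have "\<Omega> \<inter> space lebesgue \<in> sets lebesgue" using assms(1) by auto
  then show "integrable (lebesgue_on \<Omega>) F"
    using integrable_completion[of ?G lborel] int borel_measurable_integrable[OF int]
    by (simp add: integrable_restrict_space eq)
  show "(LINT x|lebesgue_on \<Omega>. F x) = (LINT x|lborel. ?G x)"
    using integral_completion[of ?G lborel] borel_measurable_integrable[OF int]
      integral_restrict_space[OF \<open>\<Omega> \<inter> space lebesgue \<in> sets lebesgue\<close>, of F]
    by (simp add: eq)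
qed

lemma integrable_mult_compact_support:
  assumes "open \<Omega>" "continuous_on \<Omega> h" "continuous_on UNIV \<phi>" "compact_support_in \<Omega> \<phi>"
  shows "integrable (lebesgue_on \<Omega>) (\<lambda>x. h x * \<phi> x)"
  by (rule lebesgue_on_integral_zero_extension(1)[where K = "closure {x. \<phi> x \<noteq> 0}"])
    (use assms closure_subset[of "{x. \<phi> x \<noteq> 0}"] continuous_on_subset[OF assms(3), of \<Omega>] in
      \<open>auto simp: compact_support_in_def intro!: continuous_intros\<close>)

text \<open>The product $h \phi$, extended by $0$, is $C^1$ with compact support on the whole space, so
  the integral of its partial derivative vanishes.\<close>

lemma integration_by_parts:
  fixes h \<phi> :: "real ^ 'm::finite \<Rightarrow> real"
  assumes "open \<Omega>" and h: "C_on 1 \<Omega> h" and phi: "C_on 1 UNIV \<phi>" and supp: "compact_support_in \<Omega> \<phi>"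
  shows "(LINT x|lebesgue_on \<Omega>. h x * pderiv_at i \<phi> x) = - (LINT x|lebesgue_on \<Omega>. pderiv_at i h x * \<phi> x)"
proof -
  let ?K = "closure {x. \<phi> x \<noteq> 0}"
  let ?P = "\<lambda>x. if x \<in> \<Omega> then h x * \<phi> x else 0"
  have K: "compact ?K" "closed ?K" "?K \<subseteq> \<Omega>"
    using supp by (auto simp: compact_support_in_def)
  have phi0: "\<phi> x = 0" if "x \<notin> ?K" for x
    using that closure_subset[of "{x. \<phi> x \<noteq> 0}"] by auto
  have prod: "C_on 1 \<Omega> (\<lambda>x. h x * \<phi> x)"
    using assms by (intro C_on_mult C_on_subset[OF phi]) auto
  have "C_on 1 UNIV ?P"
    by (rule C_on_zero_extension[OF assms(1) prod K(2,3)]) (metis DiffD2 mult_zero_right phi0)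
  moreover have "bounded {x. ?P x \<noteq> 0}"
    by (rule bounded_subset[OF compact_support_in_bounded[OF supp]]) auto
  ultimately have "(LINT x|lborel. pderiv_at i ?P x) = 0"
    by (rule integral_pderiv_at_eq_0)
  also have "pderiv_at i ?P = (\<lambda>x. if x \<in> \<Omega> then h x * pderiv_at i \<phi> x + pderiv_at i h x * \<phi> x else 0)"
  proof
    fix x
    show "pderiv_at i ?P x = (if x \<in> \<Omega> then h x * pderiv_at i \<phi> x + pderiv_at i h x * \<phi> x else 0)"
    proof (cases "x \<in> \<Omega>")
      case True
      have "pderiv_at i ?P x = pderiv_at i (\<lambda>x. h x * \<phi> x) x"
        by (rule pderiv_at_cong[OF assms(1) True]) auto
      then show ?thesis
        using True h phi by (simp add: pderiv_at_mult C_on_Suc)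
    next
      case False
      then have "x \<in> - ?K" using K by auto
      moreover have "open (- ?K)" by (rule open_Compl[OF closed_closure])
      moreover have "?P y = 0" if "y \<in> - ?K" for y
        using phi0[of y] that by simp
      ultimately have "pderiv_at i ?P x = pderiv_at i (\<lambda>x. 0) x"
        using pderiv_at_cong[of "- ?K" x ?P "\<lambda>x. 0"] by blast
      then show ?thesis using False by (simp add: pderiv_at_const)
    qed
  qed
  also have "(LINT x|lborel. (if x \<in> \<Omega> then h x * pderiv_at i \<phi> x + pderiv_at i h x * \<phi> x else 0)) =
      (LINT x|lebesgue_on \<Omega>. h x * pderiv_at i \<phi> x + pderiv_at i h x * \<phi> x)"
  proof (rule lebesgue_on_integral_zero_extension(2)[OF assms(1) _ K(1,3), symmetric])
    show "continuous_on \<Omega> (\<lambda>x. h x * pderiv_at i \<phi> x + pderiv_at i h x * \<phi> x)"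
      using h C_on_subset[OF phi subset_UNIV, of \<Omega>]
      by (intro continuous_intros) (simp_all add: C_on_Suc C_on_0)
    show "h x * pderiv_at i \<phi> x + pderiv_at i h x * \<phi> x = 0" if "x \<in> \<Omega> - ?K" for x
      using that phi0[of x] pderiv_at_outside_support[of x \<phi> i] by simp
  qed
  also have "\<dots> = (LINT x|lebesgue_on \<Omega>. h x * pderiv_at i \<phi> x) + (LINT x|lebesgue_on \<Omega>. pderiv_at i h x * \<phi> x)"
    using h phi assms(1) supp compact_support_in_pderiv_at[OF supp, of i]
    by (intro Bochner_Integration.integral_add integrable_mult_compact_support)
      (auto simp: C_on_Suc C_on_0)
  finally show ?thesis by linarith
qed

section \<open>The fundamental lemma of the calculus of variations\<close>

lemma test_function_box_bump:
  assumes "cbox a b \<subseteq> \<Omega>" "s > 0"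
  shows "test_function \<Omega> (box_bump s a b)"
  unfolding test_function_iff
proof (intro conjI allI C_on_box_bump)
  show "compact_support_in \<Omega> (box_bump s a b)"
    by (rule compact_support_inI[of "cbox a b"])
      (use assms(1) in \<open>auto intro!: box_bump_eq_0[OF assms(2)] dest: subsetD[OF box_subset_cbox]\<close>)
qed

text \<open>Bumps on the box increase to its indicator function.\<close>

lemma integral_box_eq_0:
  fixes w :: "real ^ 'm::finite \<Rightarrow> real"
  assumes "open \<Omega>" "integrable (lebesgue_on \<Omega>) w" "cbox a b \<subseteq> \<Omega>"
    and test: "\<And>\<phi>. test_function \<Omega> \<phi> \<Longrightarrow> (LINT x|lebesgue_on \<Omega>. w x * \<phi> x) = 0"
  shows "(LINT x|lebesgue_on \<Omega>. w x * indicator (box a b) x) = 0"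
proof -
  have meas: "box_bump s a b \<in> borel_measurable (lebesgue_on \<Omega>)" for s
    using C_on_continuous[OF C_on_box_bump[of 0 s a b]] assms(1)
    by (intro continuous_imp_measurable_on_sets_lebesgue) (auto intro: continuous_on_subset)
  have "(\<lambda>n. LINT x|lebesgue_on \<Omega>. w x * box_bump (real (Suc n)) a b x) \<longlonglongrightarrow>
      (LINT x|lebesgue_on \<Omega>. w x * indicator (box a b) x)"
  proof (rule integral_dominated_convergence)
    show "integrable (lebesgue_on \<Omega>) (\<lambda>x. \<bar>w x\<bar>)" using assms(2) by simp
    show "AE x in lebesgue_on \<Omega>. (\<lambda>n. w x * box_bump (real (Suc n)) a b x) \<longlonglongrightarrow> w x * indicator (box a b) x"
      by (intro AE_I2 tendsto_mult tendsto_const box_bump_tendsto)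
    show "AE x in lebesgue_on \<Omega>. norm (w x * box_bump (real (Suc n)) a b x) \<le> \<bar>w x\<bar>" for n
      using box_bump_nonneg[of "real (Suc n)" a b] box_bump_le_1[of "real (Suc n)" a b]
      by (intro AE_I2) (auto simp: abs_mult intro!: mult_left_le)
    have "indicator (box a b) \<in> borel_measurable (lebesgue_on \<Omega>)"
      by (intro measurable_restrict_space1 borel_measurable_indicator) simp
    then show "(\<lambda>x. w x * indicator (box a b) x) \<in> borel_measurable (lebesgue_on \<Omega>)"
      using assms(2) by (intro borel_measurable_times) auto
    show "(\<lambda>x. w x * box_bump (real (Suc n)) a b x) \<in> borel_measurable (lebesgue_on \<Omega>)" for n
      using assms(2) meas by (intro borel_measurable_times) auto
  qed
  moreover have "(LINT x|lebesgue_on \<Omega>. w x * box_bump (real (Suc n)) a b x) = 0" for n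
    using assms(3) by (intro test test_function_box_bump) auto
  ultimately show ?thesis using LIMSEQ_unique[OF _ tendsto_const] by force
qed

text \<open>The integrals of $w$ over small boxes with lower corner $x$ vanish, and by Lebesgue's
  differentiation theorem their averages tend to $w(x)$ for almost every $x$.\<close>

lemma fundamental_lemma:
  fixes w :: "real ^ 'm::finite \<Rightarrow> real"
  assumes "open \<Omega>" "integrable (lebesgue_on \<Omega>) w"
    and test: "\<And>\<phi>. test_function \<Omega> \<phi> \<Longrightarrow> (LINT x|lebesgue_on \<Omega>. w x * \<phi> x) = 0"
  shows "AE x in lebesgue_on \<Omega>. w x = 0"
proof -
  let ?f = "\<lambda>x. if x \<in> \<Omega> then w x else 0"
  have Om: "\<Omega> \<in> sets lebesgue" using assms(1) by auto
  have feq: "?f = (\<lambda>x. indicator \<Omega> x *\<^sub>R w x)" by (auto simp: indicator_def)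
  have f: "integrable lebesgue ?f"
    using assms(2) Om by (simp add: feq integrable_restrict_space)
  then have fb: "integrable (lebesgue_on S) ?f" if "S \<in> sets lebesgue" for S
    using that integrable_mult_indicator[OF that f] by (simp add: integrable_restrict_space)
  have "?f integrable_on cbox a b" for a b
    using fb[of "cbox a b"] by (auto intro: integrable_on_lebesgue_on)
  then obtain N where N: "negligible N" "\<And>x e. x \<notin> N \<Longrightarrow> 0 < e \<Longrightarrow>
      \<exists>d>0. \<forall>h. 0 < h \<and> h < d \<longrightarrow>
        norm (integral (cbox x (x + h *\<^sub>R One)) ?f /\<^sub>R h ^ DIM(real ^ 'm) - ?f x) < e"
    using integrable_ccontinuous_explicit[of ?f] by blast
  have box: "integral (cbox a b) ?f = 0" if "cbox a b \<subseteq> \<Omega>" for a b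
  proof -
    have "integral (cbox a b) ?f = integral (box a b) ?f"
      by (simp add: integral_open_interval)
    also have "\<dots> = (LINT x|lebesgue_on (box a b). ?f x)"
      by (rule lebesgue_integral_eq_integral[symmetric]) (auto intro!: fb)
    also have "\<dots> = (LINT x|lebesgue. indicator (box a b) x *\<^sub>R ?f x)"
      by (rule integral_restrict_space) auto
    also have "(\<lambda>x. indicator (box a b) x *\<^sub>R ?f x) = (\<lambda>x. indicator \<Omega> x *\<^sub>R (w x * indicator (box a b) x))"
      by (auto simp: indicator_def)
    also have "(LINT x|lebesgue. indicator \<Omega> x *\<^sub>R (w x * indicator (box a b) x)) =
        (LINT x|lebesgue_on \<Omega>. w x * indicator (box a b) x)"
      by (rule integral_restrict_space[symmetric]) (use Om in auto)
    also have "\<dots> = 0"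
      using that by (intro integral_box_eq_0 assms)
    finally show ?thesis .
  qed
  have "w x = 0" if x: "x \<in> \<Omega>" "x \<notin> N" for x
  proof (rule ccontr)
    assume "w x \<noteq> 0"
    then obtain d where d: "d > 0" "\<And>h. 0 < h \<Longrightarrow> h < d \<Longrightarrow>
        norm (integral (cbox x (x + h *\<^sub>R One)) ?f /\<^sub>R h ^ DIM(real ^ 'm) - ?f x) < \<bar>w x\<bar>"
      using N(2)[OF x(2), of "\<bar>w x\<bar>"] x(1) unfolding zero_less_abs_iff if_P[OF x(1)] by blast
    obtain r where r: "r > 0" "ball x r \<subseteq> \<Omega>" using assms(1) x(1) openE by blast
    \<comment> \<open>A side length below \<open>d\<close> for which the box stays in the ball of radius \<open>r\<close>.\<close>
    define h where "h = min (d / 2) (r / (2 * (norm (One :: real ^ 'm) + 1)))"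
    have n1: "norm (One :: real ^ 'm) + 1 > 0" using norm_ge_zero[of "One :: real ^ 'm"] by linarith
    have h: "0 < h" "h < d" using d(1) r(1) n1 by (auto simp: h_def min_less_iff_disj)
    have "h * (norm (One :: real ^ 'm) + 1) \<le> r / (2 * (norm (One :: real ^ 'm) + 1)) * (norm (One :: real ^ 'm) + 1)"
      using n1 by (intro mult_right_mono) (auto simp: h_def)
    also have "\<dots> = r / 2" using n1 by (simp add: field_simps)
    finally have hr: "h * norm (One :: real ^ 'm) < r" using h(1) r(1) by (simp add: distrib_left)
    have "cbox x (x + h *\<^sub>R One) \<subseteq> cball x (norm (h *\<^sub>R (One :: real ^ 'm)))"
    proof
      fix y assume y: "y \<in> cbox x (x + h *\<^sub>R One)"
      have "norm (y - x) \<le> norm (h *\<^sub>R (One :: real ^ 'm))"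
      proof (rule norm_le_componentwise)
        fix b :: "real ^ 'm" assume b: "b \<in> Basis"
        have "inner x b \<le> inner y b" "inner y b \<le> inner x b + h"
          using y b by (auto simp: mem_box inner_add_left)
        then show "\<bar>inner (y - x) b\<bar> \<le> \<bar>inner (h *\<^sub>R One) b\<bar>"
          using b by (simp add: inner_diff_left)
      qed
      then show "y \<in> cball x (norm (h *\<^sub>R (One :: real ^ 'm)))"
        by (metis dist_commute dist_norm mem_cball)
    qed
    moreover have "cball x (norm (h *\<^sub>R (One :: real ^ 'm))) \<subseteq> ball x r"
      using hr h(1) by auto
    ultimately have "cbox x (x + h *\<^sub>R One) \<subseteq> \<Omega>"
      using r(2) by order
    from d(2)[OF h] box[OF this] x(1) show False by simp
  qed
  then have "AE x in lebesgue. x \<in> \<Omega> \<longrightarrow> w x = 0"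
    using N(1) by (intro AE_I'[of N]) (auto simp: negligible_iff_null_sets)
  then show ?thesis
    using Om by (simp add: AE_restrict_space_iff)
qed

section \<open>Convergence and completeness in $L^2$\<close>

lemma L2_on_mult_integrable:
  assumes "L2_on \<Omega> u" "L2_on \<Omega> v"
  shows "integrable (lebesgue_on \<Omega>) (\<lambda>x. u x * v x)"
proof (rule Bochner_Integration.integrable_bound)
  show "integrable (lebesgue_on \<Omega>) (\<lambda>x. (u x)\<^sup>2 + (v x)\<^sup>2)"
    using assms by (auto simp: L2_on_def)
  show "(\<lambda>x. u x * v x) \<in> borel_measurable (lebesgue_on \<Omega>)"
    using assms by (auto simp: L2_on_def)
  have "\<bar>a * b\<bar> \<le> a\<^sup>2 + b\<^sup>2" for a b :: real
  proof -
    have "2 * (\<bar>a\<bar> * \<bar>b\<bar>) \<le> \<bar>a\<bar>\<^sup>2 + \<bar>b\<bar>\<^sup>2"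
      using sum_squares_bound[of "\<bar>a\<bar>" "\<bar>b\<bar>"] by (simp only: mult.assoc)
    moreover have "0 \<le> \<bar>a\<bar> * \<bar>b\<bar>" by simp
    ultimately show ?thesis unfolding abs_mult power2_abs by linarith
  qed
  then show "AE x in lebesgue_on \<Omega>. norm (u x * v x) \<le> norm ((u x)\<^sup>2 + (v x)\<^sup>2)"
    by (intro AE_I2) simp
qed

lemma L2_on_cmult: "L2_on \<Omega> u \<Longrightarrow> L2_on \<Omega> (\<lambda>x. c * u x)"
  by (auto simp: L2_on_def power_mult_distrib)

lemma L2_on_add:
  assumes "L2_on \<Omega> u" "L2_on \<Omega> v"
  shows "L2_on \<Omega> (\<lambda>x. u x + v x)"
proof -
  have "(\<lambda>x. (u x + v x)\<^sup>2) = (\<lambda>x. (u x)\<^sup>2 + (v x)\<^sup>2 + 2 * (u x * v x))"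
    by (simp add: power2_sum mult.assoc)
  then show ?thesis
    using assms L2_on_mult_integrable[OF assms] by (auto simp: L2_on_def)
qed

lemma L2_on_diff: "L2_on \<Omega> u \<Longrightarrow> L2_on \<Omega> v \<Longrightarrow> L2_on \<Omega> (\<lambda>x. u x - v x)"
  using L2_on_add[of \<Omega> u "\<lambda>x. -1 * v x"] L2_on_cmult[of \<Omega> v "-1"] by simp

lemma integral_square_sum:
  assumes "L2_on \<Omega> u" "L2_on \<Omega> v"
  shows "(LINT x|lebesgue_on \<Omega>. (a * u x + b * v x)\<^sup>2) =
    a\<^sup>2 * (LINT x|lebesgue_on \<Omega>. (u x)\<^sup>2) + 2 * a * b * (LINT x|lebesgue_on \<Omega>. u x * v x) +
    b\<^sup>2 * (LINT x|lebesgue_on \<Omega>. (v x)\<^sup>2)"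
proof -
  have "(\<lambda>x. (a * u x + b * v x)\<^sup>2) =
      (\<lambda>x. a\<^sup>2 * (u x)\<^sup>2 + (2 * a * b) * (u x * v x) + b\<^sup>2 * (v x)\<^sup>2)"
    by (auto simp: power2_eq_square algebra_simps)
  then show ?thesis
    using assms L2_on_mult_integrable[OF assms] by (simp add: L2_on_def)
qed

text \<open>The quadratic form $\int (a u + b v)^2$ in $(a, b)$ is nonnegative.\<close>

lemma L2_Cauchy_Schwarz:
  assumes "L2_on \<Omega> u" "L2_on \<Omega> v"
  shows "(LINT x|lebesgue_on \<Omega>. u x * v x)\<^sup>2 \<le>
    (LINT x|lebesgue_on \<Omega>. (u x)\<^sup>2) * (LINT x|lebesgue_on \<Omega>. (v x)\<^sup>2)"
proof -
  define A where "A = (LINT x|lebesgue_on \<Omega>. (u x)\<^sup>2)"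
  define B where "B = (LINT x|lebesgue_on \<Omega>. (v x)\<^sup>2)"
  define C where "C = (LINT x|lebesgue_on \<Omega>. u x * v x)"
  have nn: "0 \<le> a\<^sup>2 * A + 2 * a * b * C + b\<^sup>2 * B" for a b
    unfolding A_def B_def C_def by (subst integral_square_sum[OF assms, symmetric]) simp
  have "B \<ge> 0" by (simp add: B_def)
  then consider "B > 0" | "B = 0" by linarith
  then have "C\<^sup>2 \<le> A * B"
  proof cases
    case 1
    have "0 \<le> B * (A * B - C\<^sup>2)"
      using nn[of B "- C"] by (simp add: power2_eq_square algebra_simps)
    then show ?thesis using 1 by (simp add: zero_le_mult_iff)
  next
    case 2
    have "C = 0"
    proof (rule ccontr)
      assume "C \<noteq> 0"
      then show False using nn[of 1 "- (A + 1) / (2 * C)"] 2 by (simp add: field_simps)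
    qed
    then show ?thesis using 2 by simp
  qed
  then show ?thesis by (simp add: A_def B_def C_def)
qed

definition L2_lim :: "(real ^ 'm::finite) set \<Rightarrow> (nat \<Rightarrow> real ^ 'm \<Rightarrow> real) \<Rightarrow> (real ^ 'm \<Rightarrow> real) \<Rightarrow> bool" where
  "L2_lim \<Omega> s w \<longleftrightarrow> (\<forall>n. L2_on \<Omega> (s n)) \<and> L2_on \<Omega> w \<and>
     (\<lambda>n. LINT x|lebesgue_on \<Omega>. (s n x - w x)\<^sup>2) \<longlonglongrightarrow> 0"

text \<open>Norm convergence implies weak convergence. This is how equations, weak gradients and norms
  are carried over to limits.\<close>

lemma L2_lim_mult:
  assumes "L2_lim \<Omega> s w" "L2_on \<Omega> z"
  shows "(\<lambda>n. LINT x|lebesgue_on \<Omega>. s n x * z x) \<longlonglongrightarrow> (LINT x|lebesgue_on \<Omega>. w x * z x)"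
proof -
  define Z where "Z = (LINT x|lebesgue_on \<Omega>. (z x)\<^sup>2)"
  have L2: "L2_on \<Omega> (s n)" "L2_on \<Omega> w" for n
    using assms by (auto simp: L2_lim_def)
  have eq: "(LINT x|lebesgue_on \<Omega>. s n x * z x) - (LINT x|lebesgue_on \<Omega>. w x * z x) =
      (LINT x|lebesgue_on \<Omega>. (s n x - w x) * z x)" for n
    using L2_on_mult_integrable[OF L2(1) assms(2)] L2_on_mult_integrable[OF L2(2) assms(2)]
    by (simp add: left_diff_distrib)
  have "(\<lambda>n. (LINT x|lebesgue_on \<Omega>. s n x * z x) - (LINT x|lebesgue_on \<Omega>. w x * z x)) \<longlonglongrightarrow> 0"
  proof (rule Lim_null_comparison)
    have "\<bar>LINT x|lebesgue_on \<Omega>. (s n x - w x) * z x\<bar> \<le>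
        sqrt ((LINT x|lebesgue_on \<Omega>. (s n x - w x)\<^sup>2) * Z)" for n
      using L2_Cauchy_Schwarz[OF L2_on_diff[OF L2] assms(2)] unfolding Z_def
      by (intro real_le_rsqrt) simp
    then show "\<forall>\<^sub>F n in sequentially. norm ((LINT x|lebesgue_on \<Omega>. s n x * z x) - (LINT x|lebesgue_on \<Omega>. w x * z x))
        \<le> sqrt ((LINT x|lebesgue_on \<Omega>. (s n x - w x)\<^sup>2) * Z)"
      by (simp add: eq)
    have "(\<lambda>n. sqrt ((LINT x|lebesgue_on \<Omega>. (s n x - w x)\<^sup>2) * Z)) \<longlonglongrightarrow> sqrt (0 * Z)"
      using assms(1) by (intro tendsto_intros) (simp add: L2_lim_def)
    then show "(\<lambda>n. sqrt ((LINT x|lebesgue_on \<Omega>. (s n x - w x)\<^sup>2) * Z)) \<longlonglongrightarrow> 0" by simp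
  qed
  then show ?thesis by (simp add: LIM_zero_iff)
qed

lemma L2_lim_square:
  assumes "L2_lim \<Omega> s w"
  shows "(\<lambda>n. LINT x|lebesgue_on \<Omega>. (s n x)\<^sup>2) \<longlonglongrightarrow> (LINT x|lebesgue_on \<Omega>. (w x)\<^sup>2)"
proof -
  have L2: "L2_on \<Omega> (s n)" "L2_on \<Omega> w" for n
    using assms by (auto simp: L2_lim_def)
  have eq: "(LINT x|lebesgue_on \<Omega>. (s n x)\<^sup>2) = (LINT x|lebesgue_on \<Omega>. (s n x - w x)\<^sup>2) +
      2 * (LINT x|lebesgue_on \<Omega>. s n x * w x) - (LINT x|lebesgue_on \<Omega>. (w x)\<^sup>2)" for n
    using integral_square_sum[OF L2(1)[of n] L2(2), of 1 "-1"] by simp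
  have "(\<lambda>n. (LINT x|lebesgue_on \<Omega>. (s n x - w x)\<^sup>2) +
      2 * (LINT x|lebesgue_on \<Omega>. s n x * w x) - (LINT x|lebesgue_on \<Omega>. (w x)\<^sup>2)) \<longlonglongrightarrow>
      0 + 2 * (LINT x|lebesgue_on \<Omega>. w x * w x) - (LINT x|lebesgue_on \<Omega>. (w x)\<^sup>2)"
    using assms by (intro tendsto_intros L2_lim_mult[OF assms L2(2)]) (simp add: L2_lim_def)
  then show ?thesis
    unfolding eq by (simp add: power2_eq_square)
qed

lemma L2_lim_add:
  assumes "L2_lim \<Omega> s w" "L2_lim \<Omega> t z"
  shows "L2_lim \<Omega> (\<lambda>n x. s n x + t n x) (\<lambda>x. w x + z x)"
proof -
  have L2: "L2_on \<Omega> (s n)" "L2_on \<Omega> w" "L2_on \<Omega> (t n)" "L2_on \<Omega> z" for n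
    using assms by (auto simp: L2_lim_def)
  have int: "integrable (lebesgue_on \<Omega>) (\<lambda>x. (s n x - w x)\<^sup>2)"
    "integrable (lebesgue_on \<Omega>) (\<lambda>x. (t n x - z x)\<^sup>2)"
    "integrable (lebesgue_on \<Omega>) (\<lambda>x. (s n x + t n x - (w x + z x))\<^sup>2)" for n
    using L2_on_diff[OF L2(1,2)] L2_on_diff[OF L2(3,4)] L2_on_diff[OF L2_on_add[OF L2(1,3)] L2_on_add[OF L2(2,4)]]
    by (auto simp: L2_on_def)
  have "(\<lambda>n. LINT x|lebesgue_on \<Omega>. (s n x + t n x - (w x + z x))\<^sup>2) \<longlonglongrightarrow> 0"
  proof (rule tendsto_sandwich[of "\<lambda>_. 0"])
    have "(a + b - (c + d))\<^sup>2 \<le> 2 * (a - c)\<^sup>2 + 2 * (b - d)\<^sup>2" for a b c d :: real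
      using zero_le_power2[of "(a - c) - (b - d)"] by (simp add: power2_eq_square algebra_simps)
    then have "(LINT x|lebesgue_on \<Omega>. (s n x + t n x - (w x + z x))\<^sup>2) \<le>
        (LINT x|lebesgue_on \<Omega>. 2 * (s n x - w x)\<^sup>2 + 2 * (t n x - z x)\<^sup>2)" for n
      using int by (intro integral_mono) auto
    then show "\<forall>\<^sub>F n in sequentially. (LINT x|lebesgue_on \<Omega>. (s n x + t n x - (w x + z x))\<^sup>2) \<le>
        2 * (LINT x|lebesgue_on \<Omega>. (s n x - w x)\<^sup>2) + 2 * (LINT x|lebesgue_on \<Omega>. (t n x - z x)\<^sup>2)"
      using int by simp
    have "(\<lambda>n. 2 * (LINT x|lebesgue_on \<Omega>. (s n x - w x)\<^sup>2) + 2 * (LINT x|lebesgue_on \<Omega>. (t n x - z x)\<^sup>2)) \<longlonglongrightarrow> 2 * 0 + 2 * 0"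
      using assms by (intro tendsto_intros) (auto simp: L2_lim_def)
    then show "(\<lambda>n. 2 * (LINT x|lebesgue_on \<Omega>. (s n x - w x)\<^sup>2) + 2 * (LINT x|lebesgue_on \<Omega>. (t n x - z x)\<^sup>2)) \<longlonglongrightarrow> 0" by simp
  qed auto
  then show ?thesis
    using L2 by (auto simp: L2_lim_def intro: L2_on_add)
qed

lemma L2_lim_cmult:
  assumes "L2_lim \<Omega> s w"
  shows "L2_lim \<Omega> (\<lambda>n x. c * s n x) (\<lambda>x. c * w x)"
proof -
  have "(\<lambda>n. c\<^sup>2 * (LINT x|lebesgue_on \<Omega>. (s n x - w x)\<^sup>2)) \<longlonglongrightarrow> c\<^sup>2 * 0"
    using assms by (intro tendsto_intros) (auto simp: L2_lim_def)
  moreover have "(LINT x|lebesgue_on \<Omega>. (c * s n x - c * w x)\<^sup>2) = c\<^sup>2 * (LINT x|lebesgue_on \<Omega>. (s n x - w x)\<^sup>2)" for n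
    by (simp add: power_mult_distrib flip: right_diff_distrib)
  ultimately show ?thesis
    using assms by (auto simp: L2_lim_def intro: L2_on_cmult)
qed

lemma L2_lim_diff:
  "L2_lim \<Omega> s w \<Longrightarrow> L2_lim \<Omega> t z \<Longrightarrow> L2_lim \<Omega> (\<lambda>n x. s n x - t n x) (\<lambda>x. w x - z x)"
  using L2_lim_add[of \<Omega> s w "\<lambda>n x. -1 * t n x" "\<lambda>x. -1 * z x"] L2_lim_cmult[of \<Omega> t z "-1"] by simp

text \<open>On a finite measure space an $L^2$ Cauchy sequence is an $L^1$ Cauchy sequence and therefore has a
  subsequence that converges almost everywhere; Fatou's lemma shows that the pointwise limit is the
  $L^2$ limit.\<close>

lemma L2_complete:
  fixes s :: "nat \<Rightarrow> real ^ 'm::finite \<Rightarrow> real"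
  assumes fin: "finite_measure (lebesgue_on \<Omega>)" and L2: "\<And>n. L2_on \<Omega> (s n)"
    and Cauchy: "\<And>e. e > 0 \<Longrightarrow> \<exists>N. \<forall>i\<ge>N. \<forall>j\<ge>N. (LINT x|lebesgue_on \<Omega>. (s i x - s j x)\<^sup>2) < e"
  obtains w where "L2_lim \<Omega> s w"
proof -
  let ?M = "lebesgue_on \<Omega>"
  interpret finite_measure ?M by fact
  have meas [measurable]: "s n \<in> borel_measurable ?M" for n
    using L2 by (simp add: L2_on_def)
  have L2_1: "L2_on \<Omega> (\<lambda>_. 1)" by (simp add: L2_on_def)
  have int: "integrable ?M (s n)" for n
    using L2_on_mult_integrable[OF L2 L2_1] by simp
  obtain r where r: "strict_mono r" "AE x in ?M. Cauchy (\<lambda>i. s (r i) x)"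
  proof (rule cauchy_L1_AE_cauchy_subseq[OF int])
    fix e :: real assume "e > 0"
    have "0 \<le> measure ?M (space ?M)" by simp
    then have "0 < e\<^sup>2 / (measure ?M (space ?M) + 1)" using \<open>e > 0\<close> by (simp add: divide_pos_pos add_nonneg_pos)
    then obtain N where N: "\<And>i j. i \<ge> N \<Longrightarrow> j \<ge> N \<Longrightarrow> (LINT x|?M. (s i x - s j x)\<^sup>2) < e\<^sup>2 / (measure ?M (space ?M) + 1)"
      using Cauchy by blast
    have "(LINT x|?M. norm (s i x - s j x)) < e" if "i \<ge> N" "j \<ge> N" for i j
    proof -
      have abs: "L2_on \<Omega> (\<lambda>x. \<bar>s i x - s j x\<bar>)"
        using L2_on_diff[OF L2 L2] by (auto simp: L2_on_def)
      have "(LINT x|?M. norm (s i x - s j x))\<^sup>2 \<le> (LINT x|?M. (s i x - s j x)\<^sup>2) * measure ?M (space ?M)"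
        using L2_Cauchy_Schwarz[OF abs L2_1] by simp
      also have "\<dots> \<le> (LINT x|?M. (s i x - s j x)\<^sup>2) * (measure ?M (space ?M) + 1)"
        by (intro mult_left_mono) auto
      also have "\<dots> < e\<^sup>2"
        using N[OF that] measure_nonneg[of ?M "space ?M"] by (simp add: pos_less_divide_eq add_nonneg_pos)
      finally show ?thesis using \<open>e > 0\<close> by (simp add: power2_less_imp_less)
    qed
    then show "\<exists>N. \<forall>i\<ge>N. \<forall>j\<ge>N. (LINT x|?M. norm (s i x - s j x)) < e" by blast
  qed
  define w where "w x = lim (\<lambda>i. s (r i) x)" for x
  have w_meas [measurable]: "w \<in> borel_measurable ?M"
    unfolding w_def[abs_def] by (rule borel_measurable_lim_metric) simp
  have conv: "AE x in ?M. (\<lambda>i. s (r i) x) \<longlonglongrightarrow> w x"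
    using r(2) by eventually_elim (auto simp: w_def Cauchy_convergent_iff convergent_LIMSEQ_iff)
  have bound: "integrable ?M (\<lambda>x. (s n x - w x)\<^sup>2) \<and> (LINT x|?M. (s n x - w x)\<^sup>2) \<le> e"
    if e: "e > 0" and n: "\<And>j. j \<ge> N \<Longrightarrow> (LINT x|?M. (s n x - s j x)\<^sup>2) < e" for n N e
  proof -
    have "(\<integral>\<^sup>+ x. ennreal ((s n x - w x)\<^sup>2) \<partial>?M) = (\<integral>\<^sup>+ x. liminf (\<lambda>i. ennreal ((s n x - s (r i) x)\<^sup>2)) \<partial>?M)"
    proof (rule nn_integral_cong_AE, use conv in eventually_elim)
      fix x assume "(\<lambda>i. s (r i) x) \<longlonglongrightarrow> w x"
      then have "(\<lambda>i. ennreal ((s n x - s (r i) x)\<^sup>2)) \<longlonglongrightarrow> ennreal ((s n x - w x)\<^sup>2)"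
        by (intro tendsto_intros)
      then show "ennreal ((s n x - w x)\<^sup>2) = liminf (\<lambda>i. ennreal ((s n x - s (r i) x)\<^sup>2))"
        by (intro lim_imp_Liminf[symmetric]) auto
    qed
    also have "\<dots> \<le> liminf (\<lambda>i. \<integral>\<^sup>+ x. ennreal ((s n x - s (r i) x)\<^sup>2) \<partial>?M)"
      by (rule nn_integral_liminf) simp
    also have "\<dots> \<le> ennreal e"
    proof (rule Liminf_le)
      show "\<forall>\<^sub>F i in sequentially. (\<integral>\<^sup>+ x. ennreal ((s n x - s (r i) x)\<^sup>2) \<partial>?M) \<le> ennreal e"
        using eventually_ge_at_top[of N]
      proof eventually_elim
        fix i assume "N \<le> i"
        then have "N \<le> r i" using strict_mono_imp_increasing[OF r(1), of i] by linarith
        have "(\<integral>\<^sup>+ x. ennreal ((s n x - s (r i) x)\<^sup>2) \<partial>?M) = ennreal (LINT x|?M. (s n x - s (r i) x)\<^sup>2)"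
          using L2_on_diff[OF L2 L2] by (intro nn_integral_eq_integral) (auto simp: L2_on_def)
        also have "\<dots> \<le> ennreal e"
          using n[OF \<open>N \<le> r i\<close>] by (intro ennreal_leI) auto
        finally show "(\<integral>\<^sup>+ x. ennreal ((s n x - s (r i) x)\<^sup>2) \<partial>?M) \<le> ennreal e" .
      qed
    qed simp
    finally have le: "(\<integral>\<^sup>+ x. ennreal ((s n x - w x)\<^sup>2) \<partial>?M) \<le> ennreal e" .
    then have "integrable ?M (\<lambda>x. (s n x - w x)\<^sup>2)"
      by (intro integrableI_bounded) (auto simp: le_less_trans)
    moreover have "(LINT x|?M. (s n x - w x)\<^sup>2) \<le> e"
      using le e by (intro integral_real_bounded) auto
    ultimately show ?thesis by blast
  qed
  \<comment> \<open>The limit is in $L^2$, since it differs from one member of the sequence by an $L^2$ function.\<close>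
  obtain N1 where N1: "\<And>i j. i \<ge> N1 \<Longrightarrow> j \<ge> N1 \<Longrightarrow> (LINT x|?M. (s i x - s j x)\<^sup>2) < 1"
    using Cauchy[of 1] by auto
  have "integrable ?M (\<lambda>x. (s N1 x - w x)\<^sup>2)"
    using bound[of 1 N1 N1] N1 by auto
  then have "L2_on \<Omega> (\<lambda>x. s N1 x - w x)" by (simp add: L2_on_def)
  from L2_on_diff[OF L2[of N1] this] have w: "L2_on \<Omega> w" by simp
  have "(\<lambda>n. LINT x|?M. (s n x - w x)\<^sup>2) \<longlonglongrightarrow> 0"
  proof (rule LIMSEQ_I)
    fix e :: real assume "e > 0"
    then obtain N where N: "\<And>i j. i \<ge> N \<Longrightarrow> j \<ge> N \<Longrightarrow> (LINT x|?M. (s i x - s j x)\<^sup>2) < e / 2"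
      using Cauchy[of "e / 2"] by auto
    have "norm ((LINT x|?M. (s n x - w x)\<^sup>2) - 0) < e" if "n \<ge> N" for n
      using bound[of "e / 2" N n] N[OF that] \<open>e > 0\<close> by auto
    then show "\<exists>no. \<forall>n\<ge>no. norm ((LINT x|?M. (s n x - w x)\<^sup>2) - 0) < e" by blast
  qed
  then show ?thesis
    using that w L2 by (auto simp: L2_lim_def)
qed

section \<open>Weak gradients and $H^1_0$\<close>

definition grad :: "(real ^ 'm::finite \<Rightarrow> real) \<Rightarrow> real ^ 'm \<Rightarrow> real ^ 'm" where
  "grad f x = vec_lambda (\<lambda>i. pderiv_at i f x)"

lemma grad_nth [simp]: "vec_nth (grad f x) i = pderiv_at i f x"
  by (simp add: grad_def)

lemma L2_on_continuous_bounded: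
  assumes "open \<Omega>" "finite_measure (lebesgue_on \<Omega>)" "continuous_on \<Omega> u" "\<And>x. x \<in> \<Omega> \<Longrightarrow> \<bar>u x\<bar> \<le> K"
  shows "L2_on \<Omega> u"
  unfolding L2_on_def
proof
  show meas: "u \<in> borel_measurable (lebesgue_on \<Omega>)"
    using assms(1,3) by (intro continuous_imp_measurable_on_sets_lebesgue) auto
  interpret finite_measure "lebesgue_on \<Omega>" by fact
  show "integrable (lebesgue_on \<Omega>) (\<lambda>x. (u x)\<^sup>2)"
  proof (rule integrable_const_bound[where B = "K\<^sup>2"])
    show "AE x in lebesgue_on \<Omega>. norm ((u x)\<^sup>2) \<le> K\<^sup>2"
      using power_mono[OF assms(4) abs_ge_zero, of _ 2]
      by (intro AE_I2) (auto simp: space_restrict_space)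
  qed (use meas in auto)
qed

lemma L2_on_compact_support:
  assumes "open \<Omega>" "continuous_on UNIV \<phi>" "compact_support_in \<Omega> \<phi>"
  shows "L2_on \<Omega> \<phi>"
proof -
  have 1: "continuous_on \<Omega> \<phi>" using assms(2) continuous_on_subset by blast
  then have "\<phi> \<in> borel_measurable (lebesgue_on \<Omega>)"
    using assms(1) by (intro continuous_imp_measurable_on_sets_lebesgue) auto
  then show ?thesis
    using integrable_mult_compact_support[OF assms(1) 1 assms(2,3)]
    by (simp add: L2_on_def power2_eq_square)
qed

lemma test_functionD:
  assumes "test_function \<Omega> \<phi>"
  shows "C_on k UNIV \<phi>" "continuous_on UNIV \<phi>" "continuous_on UNIV (pderiv_at i \<phi>)"
    "compact_support_in \<Omega> \<phi>" "compact_support_in \<Omega> (pderiv_at i \<phi>)" "\<phi> differentiable (at x)"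
proof -
  have "C_on 1 UNIV \<phi>" using assms by (simp add: test_function_iff)
  then show "continuous_on UNIV \<phi>" "continuous_on UNIV (pderiv_at i \<phi>)" "\<phi> differentiable (at x)"
    by (auto simp: C_on_Suc C_on_0)
qed (use assms compact_support_in_pderiv_at in \<open>auto simp: test_function_iff\<close>)

lemma test_function_lin:
  assumes "test_function \<Omega> \<phi>" "test_function \<Omega> \<psi>"
  shows "test_function \<Omega> (\<lambda>x. \<phi> x + t * \<psi> x)"
  unfolding test_function_iff
proof (intro conjI allI)
  show "compact_support_in \<Omega> (\<lambda>x. \<phi> x + t * \<psi> x)"
  proof (rule compact_support_inI[of "closure {x. \<phi> x \<noteq> 0} \<union> closure {x. \<psi> x \<noteq> 0}"])
    show "\<phi> x + t * \<psi> x = 0" if "x \<notin> closure {x. \<phi> x \<noteq> 0} \<union> closure {x. \<psi> x \<noteq> 0}" for x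
    proof -
      have "\<phi> x = 0" "\<psi> x = 0"
        using that closure_subset[of "{x. \<phi> x \<noteq> 0}"] closure_subset[of "{x. \<psi> x \<noteq> 0}"] by blast+
      then show ?thesis by simp
    qed
  qed (use assms in \<open>auto simp: test_function_iff compact_support_in_def\<close>)
qed (use assms in \<open>auto simp: test_function_iff intro!: C_on_add C_on_mult C_on_const\<close>)

lemma test_function_0: "test_function \<Omega> (\<lambda>x. 0)"
  by (auto simp: test_function_iff compact_support_in_def intro: C_on_const)

lemma pderiv_at_lin:
  assumes "test_function \<Omega> \<phi>" "test_function \<Omega> \<psi>"
  shows "pderiv_at i (\<lambda>x. \<phi> x + t * \<psi> x) x = pderiv_at i \<phi> x + t * pderiv_at i \<psi> x"
proof -
  note d = test_functionD(6)[OF assms(1), of x] test_functionD(6)[OF assms(2), of x]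
  show ?thesis
    using pderiv_at_add[OF d(1) differentiable_mult[OF differentiable_const d(2)]] pderiv_at_cmult[OF d(2)]
    by simp
qed

lemma L2_on_test_function:
  assumes "open \<Omega>" "test_function \<Omega> \<phi>"
  shows "L2_on \<Omega> \<phi>" "L2_on \<Omega> (pderiv_at i \<phi>)"
  using test_functionD[OF assms(2)] by (auto intro!: L2_on_compact_support assms(1))

lemma L2_on_cong:
  assumes "\<And>x. x \<in> \<Omega> \<Longrightarrow> u x = v x"
  shows "L2_on \<Omega> u \<longleftrightarrow> L2_on \<Omega> v"
  unfolding L2_on_def using assms
  by (intro arg_cong2[of _ _ _ _ "(\<and>)"] measurable_cong Bochner_Integration.integrable_cong)
    (auto simp: space_restrict_space)

lemma has_weak_gradientD:
  assumes "has_weak_gradient \<Omega> u v"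
  shows "L2_on \<Omega> (\<lambda>x. vec_nth (v x) i)"
    and "test_function \<Omega> \<phi> \<Longrightarrow> (LINT x|lebesgue_on \<Omega>. u x * pderiv_at i \<phi> x) =
        - (LINT x|lebesgue_on \<Omega>. vec_nth (v x) i * \<phi> x)"
  using assms unfolding has_weak_gradient_def by blast+

text \<open>A classical gradient in $L^2$ is a weak one, by integration by parts.\<close>

lemma has_weak_gradient_grad:
  assumes "open \<Omega>" "C_on 1 \<Omega> h" "\<And>i. L2_on \<Omega> (pderiv_at i h)"
  shows "has_weak_gradient \<Omega> h (grad h)"
  unfolding has_weak_gradient_def
  using assms integration_by_parts[OF assms(1,2)] by (auto simp: test_function_iff)

lemma has_weak_gradient_test_function:
  assumes "open \<Omega>" "test_function \<Omega> \<phi>"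
  shows "has_weak_gradient \<Omega> \<phi> (grad \<phi>)"
  using assms L2_on_test_function[OF assms]
  by (intro has_weak_gradient_grad) (auto simp: test_function_iff intro: C_on_subset)

lemma has_weak_gradient_lin:
  assumes "open \<Omega>" "L2_on \<Omega> u" "L2_on \<Omega> u'" "has_weak_gradient \<Omega> u v" "has_weak_gradient \<Omega> u' v'"
  shows "has_weak_gradient \<Omega> (\<lambda>x. u x + c * u' x) (\<lambda>x. v x + c *\<^sub>R v' x)"
  unfolding has_weak_gradient_def
proof (intro allI conjI impI)
  fix i
  note v = has_weak_gradientD(1)[OF assms(4), of i] has_weak_gradientD(1)[OF assms(5), of i]
  show "L2_on \<Omega> (\<lambda>x. vec_nth (v x + c *\<^sub>R v' x) i)"
    using L2_on_add[OF v(1) L2_on_cmult[OF v(2)]] by simp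
  fix \<phi> assume phi: "test_function \<Omega> \<phi>"
  note L2 = L2_on_test_function[OF assms(1) phi]
  show "(LINT x|lebesgue_on \<Omega>. (u x + c * u' x) * pderiv_at i \<phi> x) =
      - (LINT x|lebesgue_on \<Omega>. vec_nth (v x + c *\<^sub>R v' x) i * \<phi> x)"
    using L2_on_mult_integrable[OF assms(2) L2(2)[of i]] L2_on_mult_integrable[OF assms(3) L2(2)[of i]]
      L2_on_mult_integrable[OF v(1) L2(1)] L2_on_mult_integrable[OF v(2) L2(1)]
      has_weak_gradientD(2)[OF assms(4) phi, of i] has_weak_gradientD(2)[OF assms(5) phi, of i]
    by (simp add: distrib_right mult.assoc)
qed

lemma has_weak_gradient_lim:
  assumes "open \<Omega>" "L2_lim \<Omega> s w" "\<And>n. has_weak_gradient \<Omega> (s n) (G n)"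
    and "\<And>i. L2_lim \<Omega> (\<lambda>n x. vec_nth (G n x) i) (\<lambda>x. vec_nth (v x) i)"
  shows "has_weak_gradient \<Omega> w v"
  unfolding has_weak_gradient_def
proof (intro allI conjI impI)
  fix i
  show "L2_on \<Omega> (\<lambda>x. vec_nth (v x) i)"
    using assms(4)[of i] by (simp add: L2_lim_def)
  fix \<phi> assume phi: "test_function \<Omega> \<phi>"
  note L2 = L2_on_test_function[OF assms(1) phi]
  have "(\<lambda>n. LINT x|lebesgue_on \<Omega>. s n x * pderiv_at i \<phi> x) \<longlonglongrightarrow> (LINT x|lebesgue_on \<Omega>. w x * pderiv_at i \<phi> x)"
    by (rule L2_lim_mult[OF assms(2) L2(2)])
  moreover have "(\<lambda>n. - (LINT x|lebesgue_on \<Omega>. vec_nth (G n x) i * \<phi> x)) \<longlonglongrightarrow> - (LINT x|lebesgue_on \<Omega>. vec_nth (v x) i * \<phi> x)"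
    by (intro tendsto_minus L2_lim_mult[OF assms(4) L2(1)])
  ultimately show "(LINT x|lebesgue_on \<Omega>. w x * pderiv_at i \<phi> x) = - (LINT x|lebesgue_on \<Omega>. vec_nth (v x) i * \<phi> x)"
    using has_weak_gradientD(2)[OF assms(3) phi] LIMSEQ_unique by simp
qed

lemma weak_gradient_unique:
  assumes "open \<Omega>" "finite_measure (lebesgue_on \<Omega>)" "has_weak_gradient \<Omega> u v" "has_weak_gradient \<Omega> u v'"
  shows "AE x in lebesgue_on \<Omega>. v x = v' x"
proof -
  interpret finite_measure "lebesgue_on \<Omega>" by fact
  \<comment> \<open>The difference is orthogonal to all test functions.\<close>
  have "AE x in lebesgue_on \<Omega>. vec_nth (v x) i - vec_nth (v' x) i = 0" for i
  proof (rule fundamental_lemma[OF assms(1)])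
    note L2 = has_weak_gradientD(1)[OF assms(3), of i] has_weak_gradientD(1)[OF assms(4), of i]
    have "L2_on \<Omega> (\<lambda>_. 1)" by (simp add: L2_on_def)
    from L2_on_mult_integrable[OF L2_on_diff[OF L2] this]
    show "integrable (lebesgue_on \<Omega>) (\<lambda>x. vec_nth (v x) i - vec_nth (v' x) i)" by simp
    fix \<phi> assume phi: "test_function \<Omega> \<phi>"
    note L2p = L2_on_test_function(1)[OF assms(1) phi]
    show "(LINT x|lebesgue_on \<Omega>. (vec_nth (v x) i - vec_nth (v' x) i) * \<phi> x) = 0"
      using L2_on_mult_integrable[OF L2(1) L2p] L2_on_mult_integrable[OF L2(2) L2p]
        has_weak_gradientD(2)[OF assms(3) phi, of i] has_weak_gradientD(2)[OF assms(4) phi, of i]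
      by (simp add: left_diff_distrib)
  qed
  then have "AE x in lebesgue_on \<Omega>. \<forall>i. vec_nth (v x) i - vec_nth (v' x) i = 0"
    by (subst AE_all_countable) auto
  then show ?thesis
    by eventually_elim (simp add: Finite_Cartesian_Product.vec_eq_iff)
qed

lemma norm_vec_square: "(norm (x :: real ^ 'm::finite))\<^sup>2 = (\<Sum>i\<in>UNIV. (vec_nth x i)\<^sup>2)"
  by (simp add: norm_vec_def L2_set_def sum_nonneg)

lemma weak_gradient_AE:
  assumes "open \<Omega>" "finite_measure (lebesgue_on \<Omega>)" "has_weak_gradient \<Omega> u v"
  shows "AE x in lebesgue_on \<Omega>. weak_gradient \<Omega> u x = v x"
proof -
  have "has_weak_gradient \<Omega> u (weak_gradient \<Omega> u)"
    unfolding weak_gradient_def by (rule someI[of "has_weak_gradient \<Omega> u", OF assms(3)])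
  from weak_gradient_unique[OF assms(1,2) this assms(3)] show ?thesis .
qed

text \<open>The square of the $H^1$ norm, with the weak gradient as an argument in place of the choice
  made in \<^const>\<open>weak_gradient\<close>.\<close>

definition H1_sq :: "(real ^ 'm::finite) set \<Rightarrow> (real ^ 'm \<Rightarrow> real) \<Rightarrow> (real ^ 'm \<Rightarrow> real ^ 'm) \<Rightarrow> real" where
  "H1_sq \<Omega> u v = (LINT x|lebesgue_on \<Omega>. (u x)\<^sup>2) + (\<Sum>i\<in>UNIV. LINT x|lebesgue_on \<Omega>. (vec_nth (v x) i)\<^sup>2)"

text \<open>By uniqueness the chosen weak gradient agrees almost everywhere with any given one.\<close>

lemma H1_norm_eq:
  assumes "open \<Omega>" "finite_measure (lebesgue_on \<Omega>)" "has_weak_gradient \<Omega> u v"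
  shows "H1_norm \<Omega> u = sqrt (H1_sq \<Omega> u v)"
proof -
  have v: "L2_on \<Omega> (\<lambda>x. vec_nth (v x) i)" for i
    using assms(3) by (rule has_weak_gradientD)
  have "has_weak_gradient \<Omega> u (weak_gradient \<Omega> u)"
    unfolding weak_gradient_def by (rule someI[of "has_weak_gradient \<Omega> u", OF assms(3)])
  then have wv: "L2_on \<Omega> (\<lambda>x. vec_nth (weak_gradient \<Omega> u x) i)" for i
    by (rule has_weak_gradientD)
  have [measurable]: "(\<lambda>x. vec_nth (v x) i) \<in> borel_measurable (lebesgue_on \<Omega>)"
    "(\<lambda>x. vec_nth (weak_gradient \<Omega> u x) i) \<in> borel_measurable (lebesgue_on \<Omega>)" for i
    using v wv by (auto simp: L2_on_def)
  have "(LINT x|lebesgue_on \<Omega>. (norm (weak_gradient \<Omega> u x))\<^sup>2) = (LINT x|lebesgue_on \<Omega>. (norm (v x))\<^sup>2)"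
    using weak_gradient_AE[OF assms]
    by (intro integral_cong_AE) (auto simp: norm_vec_square)
  also have "\<dots> = (\<Sum>i\<in>UNIV. LINT x|lebesgue_on \<Omega>. (vec_nth (v x) i)\<^sup>2)"
    unfolding norm_vec_square using v by (intro Bochner_Integration.integral_sum) (simp add: L2_on_def)
  finally show ?thesis by (simp add: H1_norm_def H1_sq_def)
qed

lemma integral_weak_gradient_cong:
  assumes "open \<Omega>" "finite_measure (lebesgue_on \<Omega>)" "has_weak_gradient \<Omega> u v" "test_function \<Omega> \<phi>"
  shows "(LINT x|lebesgue_on \<Omega>. (\<Sum>i\<in>UNIV. vec_nth (weak_gradient \<Omega> u x) i * pderiv_at i \<phi> x)) =
    (\<Sum>i\<in>UNIV. (LINT x|lebesgue_on \<Omega>. vec_nth (v x) i * pderiv_at i \<phi> x))"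
proof -
  have wg: "has_weak_gradient \<Omega> u (weak_gradient \<Omega> u)"
    unfolding weak_gradient_def by (rule someI[of "has_weak_gradient \<Omega> u", OF assms(3)])
  note int = L2_on_mult_integrable[OF has_weak_gradientD(1) L2_on_test_function(2)[OF assms(1,4)]]
  have "(LINT x|lebesgue_on \<Omega>. (\<Sum>i\<in>UNIV. vec_nth (weak_gradient \<Omega> u x) i * pderiv_at i \<phi> x)) =
      (\<Sum>i\<in>UNIV. LINT x|lebesgue_on \<Omega>. vec_nth (weak_gradient \<Omega> u x) i * pderiv_at i \<phi> x)"
    by (intro Bochner_Integration.integral_sum int[OF wg])
  also have "\<dots> = (\<Sum>i\<in>UNIV. LINT x|lebesgue_on \<Omega>. vec_nth (v x) i * pderiv_at i \<phi> x)"
    using weak_gradient_AE[OF assms(1-3)] borel_measurable_integrable[OF int[OF wg]]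
      borel_measurable_integrable[OF int[OF assms(3)]]
    by (intro sum.cong refl integral_cong_AE) auto
  finally show ?thesis .
qed

text \<open>Membership in $H^1_0(\Omega)$ together with its evidence: test functions that converge to
  $w$ in $L^2$ with gradients that converge to $v$. With both limits in view, every identity for test
  functions passes to $(w, v)$ by \<open>L2_lim_mult\<close>.\<close>

definition test_approx ::
  "(real ^ 'm::finite) set \<Rightarrow> (real ^ 'm \<Rightarrow> real) \<Rightarrow> (real ^ 'm \<Rightarrow> real ^ 'm) \<Rightarrow> (nat \<Rightarrow> real ^ 'm \<Rightarrow> real) \<Rightarrow> bool" where
  "test_approx \<Omega> w v \<phi> \<longleftrightarrow> (\<forall>n. test_function \<Omega> (\<phi> n)) \<and> L2_lim \<Omega> \<phi> w \<and>
     (\<forall>i. L2_lim \<Omega> (\<lambda>n. pderiv_at i (\<phi> n)) (\<lambda>x. vec_nth (v x) i))"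

text \<open>The defining identity of the weak gradient is continuous in $L^2$.\<close>

lemma test_approx_has_weak_gradient:
  assumes "open \<Omega>" "test_approx \<Omega> w v \<phi>"
  shows "has_weak_gradient \<Omega> w v"
  using assms by (intro has_weak_gradient_lim[of \<Omega> \<phi> w "\<lambda>n. grad (\<phi> n)"] has_weak_gradient_test_function)
    (auto simp: test_approx_def)

lemma has_weak_gradient_minus_test:
  assumes "open \<Omega>" "L2_on \<Omega> w" "has_weak_gradient \<Omega> w v" "test_function \<Omega> \<phi>"
  shows "has_weak_gradient \<Omega> (\<lambda>x. w x - \<phi> x) (\<lambda>x. v x - grad \<phi> x)"
  using has_weak_gradient_lin[OF assms(1,2) L2_on_test_function(1)[OF assms(1,4)] assms(3)
      has_weak_gradient_test_function[OF assms(1,4)], of "-1"] by simp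

lemma H1_0_I:
  assumes "open \<Omega>" "finite_measure (lebesgue_on \<Omega>)" "test_approx \<Omega> w v \<phi>"
  shows "H1_0 \<Omega> w"
  unfolding H1_0_def
proof (intro conjI allI impI)
  have L2: "L2_on \<Omega> w" using assms(3) by (simp add: test_approx_def L2_lim_def)
  have v: "has_weak_gradient \<Omega> w v"
    by (rule test_approx_has_weak_gradient[OF assms(1,3)])
  show "H1 \<Omega> w" using L2 v by (auto simp: H1_def)
  fix e :: real assume "e > 0"
  have "(\<lambda>n. sqrt ((LINT x|lebesgue_on \<Omega>. (\<phi> n x - w x)\<^sup>2) +
      (\<Sum>i\<in>UNIV. LINT x|lebesgue_on \<Omega>. (pderiv_at i (\<phi> n) x - vec_nth (v x) i)\<^sup>2))) \<longlonglongrightarrow> sqrt (0 + (\<Sum>i\<in>(UNIV::'a set). 0))"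
    using assms(3) by (intro tendsto_intros) (auto simp: test_approx_def L2_lim_def)
  then obtain n where "sqrt ((LINT x|lebesgue_on \<Omega>. (\<phi> n x - w x)\<^sup>2) +
      (\<Sum>i\<in>UNIV. LINT x|lebesgue_on \<Omega>. (pderiv_at i (\<phi> n) x - vec_nth (v x) i)\<^sup>2)) < e"
    using order_tendstoD(2)[of _ _ _ e] \<open>e > 0\<close> eventually_happens' sequentially_bot by fastforce
  moreover have phi: "test_function \<Omega> (\<phi> n)" using assms(3) by (simp add: test_approx_def)
  ultimately have "H1_norm \<Omega> (\<lambda>x. w x - \<phi> n x) < e"
    by (simp add: H1_norm_eq[OF assms(1,2) has_weak_gradient_minus_test[OF assms(1) L2 v phi]] H1_sq_def power2_commute)
  then show "\<exists>\<phi>. test_function \<Omega> \<phi> \<and> H1_norm \<Omega> (\<lambda>x. w x - \<phi> x) < e" using phi by blast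
qed

lemma test_approxI:
  assumes "open \<Omega>" "L2_on \<Omega> w" "\<And>i. L2_on \<Omega> (\<lambda>x. vec_nth (v x) i)"
    and "\<And>e. e > 0 \<Longrightarrow> \<exists>\<phi>. test_function \<Omega> \<phi> \<and> H1_sq \<Omega> (\<lambda>x. w x - \<phi> x) (\<lambda>x. v x - grad \<phi> x) < e"
  obtains \<phi> where "test_approx \<Omega> w v \<phi>"
proof -
  have "\<forall>n. \<exists>\<phi>. test_function \<Omega> \<phi> \<and> H1_sq \<Omega> (\<lambda>x. w x - \<phi> x) (\<lambda>x. v x - grad \<phi> x) < inverse (real (Suc n))"
    by (intro allI assms(4)) simp
  then obtain \<phi> where phi: "\<And>n. test_function \<Omega> (\<phi> n)"
    "\<And>n. H1_sq \<Omega> (\<lambda>x. w x - \<phi> n x) (\<lambda>x. v x - grad (\<phi> n) x) < inverse (real (Suc n))"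
    by metis
  have lim: "(\<lambda>n. LINT x|lebesgue_on \<Omega>. (a n x)\<^sup>2) \<longlonglongrightarrow> 0"
    if "\<And>n. (LINT x|lebesgue_on \<Omega>. (a n x)\<^sup>2) \<le> H1_sq \<Omega> (\<lambda>x. w x - \<phi> n x) (\<lambda>x. v x - grad (\<phi> n) x)" for a
  proof (rule tendsto_sandwich[OF _ _ tendsto_const LIMSEQ_inverse_real_of_nat])
    show "\<forall>\<^sub>F n in sequentially. (LINT x|lebesgue_on \<Omega>. (a n x)\<^sup>2) \<le> inverse (real (Suc n))"
      using that phi(2) by (intro always_eventually allI) (meson less_imp_le order_trans)
  qed simp
  have "L2_lim \<Omega> \<phi> w"
    unfolding L2_lim_def power2_commute[of "\<phi> _ _"]
    by (intro conjI allI lim assms(2) L2_on_test_function(1)[OF assms(1) phi(1)])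
      (auto simp: H1_sq_def intro!: sum_nonneg)
  moreover have "L2_lim \<Omega> (\<lambda>n. pderiv_at i (\<phi> n)) (\<lambda>x. vec_nth (v x) i)" for i
    unfolding L2_lim_def power2_commute[of "pderiv_at i (\<phi> _) _"]
  proof (intro conjI allI lim assms(3) L2_on_test_function(2)[OF assms(1) phi(1)])
    fix n
    have "(LINT x|lebesgue_on \<Omega>. (vec_nth (v x) i - pderiv_at i (\<phi> n) x)\<^sup>2) \<le>
        (\<Sum>i\<in>UNIV. LINT x|lebesgue_on \<Omega>. (vec_nth (v x) i - pderiv_at i (\<phi> n) x)\<^sup>2)"
      by (rule member_le_sum) auto
    moreover have "0 \<le> (LINT x|lebesgue_on \<Omega>. (w x - \<phi> n x)\<^sup>2)" by simp
    ultimately show "(LINT x|lebesgue_on \<Omega>. (vec_nth (v x) i - pderiv_at i (\<phi> n) x)\<^sup>2) \<le>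
        H1_sq \<Omega> (\<lambda>x. w x - \<phi> n x) (\<lambda>x. v x - grad (\<phi> n) x)"
      unfolding H1_sq_def vector_minus_component grad_nth by linarith
  qed
  ultimately show ?thesis
    using that phi(1) by (auto simp: test_approx_def)
qed

lemma H1_0_E:
  assumes "open \<Omega>" "finite_measure (lebesgue_on \<Omega>)" "H1_0 \<Omega> w" "has_weak_gradient \<Omega> w v"
  obtains \<phi> where "test_approx \<Omega> w v \<phi>"
proof (rule test_approxI[OF assms(1)])
  show L2: "L2_on \<Omega> w" using assms(3) by (simp add: H1_0_def H1_def)
  show "L2_on \<Omega> (\<lambda>x. vec_nth (v x) i)" for i by (rule has_weak_gradientD[OF assms(4)])
  fix e :: real assume "e > 0"
  then obtain \<phi> where phi: "test_function \<Omega> \<phi>" "H1_norm \<Omega> (\<lambda>x. w x - \<phi> x) < sqrt e"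
    using assms(3) unfolding H1_0_def by (metis real_sqrt_gt_zero)
  then show "\<exists>\<phi>. test_function \<Omega> \<phi> \<and> H1_sq \<Omega> (\<lambda>x. w x - \<phi> x) (\<lambda>x. v x - grad \<phi> x) < e"
    using H1_norm_eq[OF assms(1,2) has_weak_gradient_minus_test[OF assms(1) L2 assms(4) phi(1)]] by auto
qed

lemma test_approx_diff:
  assumes "test_approx \<Omega> w v \<phi>" "test_approx \<Omega> w' v' \<phi>'"
  shows "test_approx \<Omega> (\<lambda>x. w x - w' x) (\<lambda>x. v x - v' x) (\<lambda>n x. \<phi> n x - \<phi>' n x)"
  unfolding test_approx_def
proof (intro conjI allI)
  have t: "test_function \<Omega> (\<phi> n)" "test_function \<Omega> (\<phi>' n)" for n
    using assms by (auto simp: test_approx_def)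
  show "test_function \<Omega> (\<lambda>x. \<phi> n x - \<phi>' n x)" for n
    using test_function_lin[OF t, of n "-1" n] by simp
  show "L2_lim \<Omega> (\<lambda>n x. \<phi> n x - \<phi>' n x) (\<lambda>x. w x - w' x)"
    using assms by (intro L2_lim_diff) (auto simp: test_approx_def)
  fix i
  have "pderiv_at i (\<lambda>x. \<phi> n x - \<phi>' n x) = (\<lambda>x. pderiv_at i (\<phi> n) x - pderiv_at i (\<phi>' n) x)" for n
    using pderiv_at_lin[OF t, of i n "-1" n] by (simp add: fun_eq_iff)
  moreover have "L2_lim \<Omega> (\<lambda>n x. pderiv_at i (\<phi> n) x - pderiv_at i (\<phi>' n) x) (\<lambda>x. vec_nth (v x) i - vec_nth (v' x) i)"
    using assms by (intro L2_lim_diff) (auto simp: test_approx_def)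
  ultimately show "L2_lim \<Omega> (\<lambda>n. pderiv_at i (\<lambda>x. \<phi> n x - \<phi>' n x)) (\<lambda>x. vec_nth (v x - v' x) i)"
    by simp
qed

lemma test_approx_cong:
  assumes "\<And>x. x \<in> \<Omega> \<Longrightarrow> w x = w' x" "\<And>x. x \<in> \<Omega> \<Longrightarrow> v x = v' x" "test_approx \<Omega> w v \<phi>"
  shows "test_approx \<Omega> w' v' \<phi>"
proof -
  have "L2_lim \<Omega> s b" if "L2_lim \<Omega> s a" "\<And>x. x \<in> \<Omega> \<Longrightarrow> a x = b x" for s a b
  proof -
    have "(LINT x|lebesgue_on \<Omega>. (s n x - a x)\<^sup>2) = (LINT x|lebesgue_on \<Omega>. (s n x - b x)\<^sup>2)" for n
      using that(2) by (intro Bochner_Integration.integral_cong) (auto simp: space_restrict_space)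
    then show ?thesis
      using that(1) L2_on_cong[of \<Omega> a b] that(2) by (simp add: L2_lim_def)
  qed
  then show ?thesis
    using assms unfolding test_approx_def by (metis (no_types, lifting))
qed

section \<open>Poincare's inequality\<close>

lemma finite_measure_lebesgue_on_bounded:
  fixes \<Omega> :: "'a::euclidean_space set"
  assumes "open \<Omega>" "bounded \<Omega>"
  shows "finite_measure (lebesgue_on \<Omega>)"
proof
  have "emeasure lborel \<Omega> < \<infinity>"
    using assms(2) by (rule emeasure_bounded_finite)
  then show "emeasure (lebesgue_on \<Omega>) (space (lebesgue_on \<Omega>)) \<noteq> \<infinity>"
    using assms(1) by (simp add: emeasure_restrict_space space_restrict_space emeasure_completion)
qed

text \<open>Integrate $\int \phi^2 = \int \phi^2 \, \partial_i x_i$ by parts: this is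
  $- 2 \int x_i \, \phi \, \partial_i \phi$, and $|x_i|$ is bounded on $\Omega$. Young's inequality
  absorbs half of the left-hand side.\<close>

lemma poincare_inequality:
  fixes \<Omega> :: "(real ^ 'm::finite) set"
  assumes "open \<Omega>" "bounded \<Omega>"
  obtains C where "C > 0" "\<And>\<phi>. test_function \<Omega> \<phi> \<Longrightarrow>
    (LINT x|lebesgue_on \<Omega>. (\<phi> x)\<^sup>2) \<le> C * (\<Sum>i\<in>UNIV. (LINT x|lebesgue_on \<Omega>. (pderiv_at i \<phi> x)\<^sup>2))"
proof -
  obtain R where R: "R > 0" "\<And>x. x \<in> \<Omega> \<Longrightarrow> norm x \<le> R"
    using assms(2) bounded_pos by blast
  obtain i :: 'm where True by blast
  have "(LINT x|lebesgue_on \<Omega>. (\<phi> x)\<^sup>2) \<le> 4 * R\<^sup>2 * (\<Sum>i\<in>UNIV. (LINT x|lebesgue_on \<Omega>. (pderiv_at i \<phi> x)\<^sup>2))"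
    if phi: "test_function \<Omega> \<phi>" for \<phi>
  proof -
    \<comment> \<open>The coordinate function has partial derivative $1$.\<close>
    let ?h = "\<lambda>x :: real ^ 'm. vec_nth x i"
    note t = test_functionD[OF phi]
    note L2 = L2_on_test_function[OF assms(1) phi]
    have int: "integrable (lebesgue_on \<Omega>) (\<lambda>x. (\<phi> x)\<^sup>2)" "integrable (lebesgue_on \<Omega>) (\<lambda>x. (pderiv_at i \<phi> x)\<^sup>2)"
      using L2 by (auto simp: L2_on_def)
    have supp2: "compact_support_in \<Omega> (\<lambda>x. \<phi> x * \<phi> x)"
      using t(4) by (simp add: compact_support_in_def)
    have sq: "C_on 1 UNIV (\<lambda>x. \<phi> x * \<phi> x)"
      by (intro C_on_mult t(1)) simp
    have d2: "pderiv_at i (\<lambda>x. \<phi> x * \<phi> x) x = 2 * \<phi> x * pderiv_at i \<phi> x" for x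
      using pderiv_at_mult[OF t(6) t(6), of i] by simp
    have "(LINT x|lebesgue_on \<Omega>. ?h x * pderiv_at i (\<lambda>x. \<phi> x * \<phi> x) x) =
        - (LINT x|lebesgue_on \<Omega>. pderiv_at i ?h x * (\<phi> x * \<phi> x))"
      by (intro integration_by_parts assms(1) C_on_coord sq supp2)
    then have "(LINT x|lebesgue_on \<Omega>. (\<phi> x)\<^sup>2) =
        - (LINT x|lebesgue_on \<Omega>. ?h x * (2 * \<phi> x * pderiv_at i \<phi> x))"
      by (simp add: d2 pderiv_at_coord power2_eq_square)
    also have "\<dots> = (LINT x|lebesgue_on \<Omega>. - (?h x * (2 * \<phi> x * pderiv_at i \<phi> x)))"
      by simp
    also have "\<dots> \<le> (LINT x|lebesgue_on \<Omega>. (1/2) * (\<phi> x)\<^sup>2 + 2 * R\<^sup>2 * (pderiv_at i \<phi> x)\<^sup>2)"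
    proof (rule integral_mono)
      have c: "continuous_on \<Omega> (\<lambda>x. - (?h x * (2 * pderiv_at i \<phi> x)))"
        using t(3)[of i] by (intro continuous_intros) (auto intro: continuous_on_subset)
      show "integrable (lebesgue_on \<Omega>) (\<lambda>x. - (?h x * (2 * \<phi> x * pderiv_at i \<phi> x)))"
        using integrable_mult_compact_support[OF assms(1) c t(2,4)] by (simp add: mult_ac)
      show "integrable (lebesgue_on \<Omega>) (\<lambda>x. (1/2) * (\<phi> x)\<^sup>2 + 2 * R\<^sup>2 * (pderiv_at i \<phi> x)\<^sup>2)"
        using int by simp
      fix x assume "x \<in> space (lebesgue_on \<Omega>)"
      then have "x \<in> \<Omega>" by (simp add: space_restrict_space)
      then have "\<bar>?h x\<bar> \<le> R" using R component_le_norm_cart[of x i] by fastforce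
      then have "(?h x)\<^sup>2 * (pderiv_at i \<phi> x)\<^sup>2 \<le> R\<^sup>2 * (pderiv_at i \<phi> x)\<^sup>2"
        using power_mono[of "\<bar>?h x\<bar>" R 2] by (intro mult_right_mono) auto
      moreover have "0 \<le> (\<phi> x + 2 * ?h x * pderiv_at i \<phi> x)\<^sup>2" by simp
      ultimately show "- (?h x * (2 * \<phi> x * pderiv_at i \<phi> x)) \<le> (1/2) * (\<phi> x)\<^sup>2 + 2 * R\<^sup>2 * (pderiv_at i \<phi> x)\<^sup>2"
        by (simp add: power2_eq_square algebra_simps)
    qed
    also have "\<dots> = (1/2) * (LINT x|lebesgue_on \<Omega>. (\<phi> x)\<^sup>2) + 2 * R\<^sup>2 * (LINT x|lebesgue_on \<Omega>. (pderiv_at i \<phi> x)\<^sup>2)"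
      using int by simp
    finally have "(LINT x|lebesgue_on \<Omega>. (\<phi> x)\<^sup>2) \<le> 4 * R\<^sup>2 * (LINT x|lebesgue_on \<Omega>. (pderiv_at i \<phi> x)\<^sup>2)"
      by simp
    also have "\<dots> \<le> 4 * R\<^sup>2 * (\<Sum>i\<in>UNIV. (LINT x|lebesgue_on \<Omega>. (pderiv_at i \<phi> x)\<^sup>2))"
      by (intro mult_left_mono member_le_sum) auto
    finally show ?thesis .
  qed
  moreover have "4 * R\<^sup>2 > 0" using R by simp
  ultimately show ?thesis using that by blast
qed

section \<open>Mollification\<close>

definition convolve :: "(real ^ 'm::finite \<Rightarrow> real) \<Rightarrow> (real ^ 'm \<Rightarrow> real) \<Rightarrow> real ^ 'm \<Rightarrow> real" where
  "convolve K \<psi> x = (LINT y|lborel. K (x - y) * \<psi> y)"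

lemma lborel_integral_reflection:
  fixes f :: "'a::euclidean_space \<Rightarrow> real"
  assumes "f \<in> borel_measurable borel"
  shows "(LINT y|lborel. f (x - y)) = (LINT y|lborel. f y)"
proof -
  have "lborel = distr lborel borel (\<lambda>y. x - y)"
    using lborel_affine[of "-1" x] by (simp add: density_1)
  then have "(LINT y|lborel. f y) = (LINT y|distr lborel borel (\<lambda>y. x - y). f y)"
    by simp
  also have "\<dots> = (LINT y|lborel. f (x - y))"
    by (rule integral_distr) (use assms in auto)
  finally show ?thesis ..
qed

text \<open>Both orders are needed: derivatives fall on the left factor, which is the smooth kernel
  when smoothness is wanted and the given function when its gradient is to be approximated.\<close>

lemma convolve_commute:
  assumes "continuous_on UNIV K" "continuous_on UNIV \<psi>"
  shows "convolve K \<psi> = convolve \<psi> K"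
proof
  fix x
  have "continuous_on UNIV (\<lambda>y. \<psi> (x - y) * K y)"
    using assms by (intro continuous_intros continuous_on_compose2[OF assms(2)]) auto
  then have "(LINT y|lborel. \<psi> (x - y) * K y) = (LINT y|lborel. \<psi> (x - (x - y)) * K (x - y))"
    by (intro lborel_integral_reflection[symmetric] borel_measurable_continuous_onI)
  then show "convolve K \<psi> x = convolve \<psi> K x"
    by (simp add: convolve_def mult.commute)
qed

lemma convolve_has_integral:
  assumes "continuous_on UNIV K" "continuous_on UNIV \<psi>" "{y. \<psi> y \<noteq> 0} \<subseteq> cbox a b"
  shows "((\<lambda>y. K (x - y) * \<psi> y) has_integral convolve K \<psi> x) (cbox a b)"
proof -
  let ?f = "\<lambda>y. K (x - y) * \<psi> y"
  have "continuous_on UNIV ?f"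
    using assms by (intro continuous_intros continuous_on_compose2[OF assms(1)]) auto
  moreover have "bounded {y. ?f y \<noteq> 0}"
    by (rule bounded_subset[OF bounded_cbox]) (use assms(3) in auto)
  ultimately have "integrable lborel ?f"
    by (rule integrable_continuous_bounded_support)
  then have "(?f has_integral convolve K \<psi> x) UNIV"
    unfolding convolve_def by (rule has_integral_integral_lborel)
  also have "?f = (\<lambda>y. if y \<in> cbox a b then ?f y else 0)"
  proof
    show "?f y = (if y \<in> cbox a b then ?f y else 0)" for y
      using assms(3) by (cases "\<psi> y = 0") auto
  qed
  finally show ?thesis by (simp add: has_integral_restrict_UNIV)
qed

text \<open>Differentiation under the integral sign, over a box that contains the support of $\psi$.\<close>

lemma convolve_has_derivative:
  fixes K :: "real ^ 'm::finite \<Rightarrow> real"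
  assumes K: "C_on 1 UNIV K" and psi: "continuous_on UNIV \<psi>" "bounded {y. \<psi> y \<noteq> 0}"
  shows "(convolve K \<psi> has_derivative
    (\<lambda>h. \<Sum>i\<in>UNIV. vec_nth h i * convolve (pderiv_at i K) \<psi> x)) (at x)"
proof -
  obtain a where a: "{y. \<psi> y \<noteq> 0} \<subseteq> cbox (- a) a"
    using bounded_subset_cbox_symmetric[OF psi(2)] by blast
  have cont: "continuous_on UNIV K" "continuous_on UNIV (pderiv_at i K)" for i
    using K by (auto simp: C_on_Suc C_on_0)
  define F where "F x t = (\<Sum>i\<in>UNIV. (pderiv_at i K (x - t) * \<psi> t) *\<^sub>R blinfun_inner_right (axis i 1 :: real ^ 'm))" for x t
  have F: "blinfun_apply (F x t) = (\<lambda>h. (\<Sum>i\<in>UNIV. vec_nth h i * pderiv_at i K (x - t)) * \<psi> t)" for x t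
    by (rule ext) (simp add: F_def blinfun.sum_left blinfun.scaleR_left inner_axis'
        sum_distrib_left mult_ac)
  have "((\<lambda>x. integral (cbox (- a) a) (\<lambda>t. K (x - t) * \<psi> t)) has_derivative
      blinfun_apply (integral (cbox (- a) a) (F x))) (at x within UNIV)"
  proof (rule leibniz_rule)
    show "((\<lambda>x. K (x - t) * \<psi> t) has_derivative blinfun_apply (F x t)) (at x within UNIV)" for x t
    proof -
      have "((\<lambda>x. x - t) has_derivative (\<lambda>h. h)) (at x)"
        by (auto intro!: derivative_eq_intros)
      from has_derivative_compose[OF this C_on_SucD(1)[OF K[unfolded One_nat_def]]]
      have "((\<lambda>x. K (x - t)) has_derivative (\<lambda>h. \<Sum>i\<in>UNIV. vec_nth h i * pderiv_at i K (x - t))) (at x)"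
        by simp
      then show ?thesis unfolding F by (rule has_derivative_mult_left)
    qed
    show "(\<lambda>t. K (x - t) * \<psi> t) integrable_on cbox (- a) a" for x
      using convolve_has_integral[OF cont(1) psi(1) a] by blast
    show "continuous_on (UNIV \<times> cbox (- a) a) (\<lambda>(x, t). F x t)"
      unfolding F_def case_prod_unfold
      by (intro continuous_intros continuous_on_compose2[OF cont(2)] continuous_on_compose2[OF psi(1)]) auto
  qed auto
  moreover have "integral (cbox (- a) a) (\<lambda>t. K (x - t) * \<psi> t) = convolve K \<psi> x" for x
    using convolve_has_integral[OF cont(1) psi(1) a] by (rule integral_unique)
  moreover have "integral (cbox (- a) a) (F x) =
      (\<Sum>i\<in>UNIV. convolve (pderiv_at i K) \<psi> x *\<^sub>R blinfun_inner_right (axis i 1))"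
    unfolding F_def
    by (intro integral_unique has_integral_sum has_integral_scaleR_left convolve_has_integral cont psi a) auto
  moreover have "blinfun_apply (\<Sum>i\<in>UNIV. convolve (pderiv_at i K) \<psi> x *\<^sub>R blinfun_inner_right (axis i 1)) =
      (\<lambda>h. \<Sum>i\<in>UNIV. vec_nth h i * convolve (pderiv_at i K) \<psi> x)"
    by (rule ext) (simp add: blinfun.sum_left blinfun.scaleR_left inner_axis' mult.commute)
  ultimately show ?thesis by simp
qed

lemma pderiv_at_convolve:
  assumes "C_on 1 UNIV K" "continuous_on UNIV \<psi>" "bounded {y. \<psi> y \<noteq> 0}"
  shows "pderiv_at i (convolve K \<psi>) x = convolve (pderiv_at i K) \<psi> x"
  using pderiv_at_eq[OF convolve_has_derivative[OF assms], of i] by simp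

text \<open>The derivatives of the convolution are the convolutions with the derivatives of the kernel.\<close>

lemma C_on_convolve:
  assumes "continuous_on UNIV \<psi>" "bounded {y. \<psi> y \<noteq> 0}"
  shows "(\<And>k. C_on k UNIV K) \<Longrightarrow> C_on k UNIV (convolve K \<psi>)"
proof (induction k arbitrary: K)
  case 0
  show ?case
    unfolding C_on_0
    using has_derivative_continuous[OF convolve_has_derivative[OF 0 assms]]
    by (intro continuous_at_imp_continuous_on ballI)
next
  case (Suc k)
  have "C_on l UNIV (pderiv_at i K)" for l i
    using Suc.prems[of "Suc l"] by (simp add: C_on_Suc)
  then show ?case
    by (intro C_on_SucI[OF _ convolve_has_derivative[OF Suc.prems assms]] Suc.IH) auto
qed

lemma uniformly_continuous_bounded_support:
  fixes f :: "'a::euclidean_space \<Rightarrow> real"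
  assumes "continuous_on UNIV f" "bounded {x. f x \<noteq> 0}" "e > 0"
  obtains d where "d > 0" "\<And>x y. dist x y \<le> d \<Longrightarrow> \<bar>f x - f y\<bar> \<le> e"
proof -
  obtain R where R: "\<And>x. f x \<noteq> 0 \<Longrightarrow> norm x \<le> R"
    using assms(2) unfolding bounded_iff by auto
  have "uniformly_continuous_on (cball 0 (R + 1)) f"
    by (intro compact_uniformly_continuous) (use assms(1) continuous_on_subset in auto)
  then obtain d where d: "d > 0" "\<And>x y. x \<in> cball 0 (R + 1) \<Longrightarrow> y \<in> cball 0 (R + 1) \<Longrightarrow> dist x y < d \<Longrightarrow> dist (f x) (f y) < e"
    unfolding uniformly_continuous_on_def using assms(3) by metis
  show ?thesis
  proof (rule that[of "min 1 (d / 2)"])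
    fix x y :: 'a assume xy: "dist x y \<le> min 1 (d / 2)"
    show "\<bar>f x - f y\<bar> \<le> e"
    proof (cases "norm x \<le> R \<or> norm y \<le> R")
      case True
      have "\<bar>norm x - norm y\<bar> \<le> 1"
        using xy norm_triangle_ineq3[of x y] by (simp add: dist_norm)
      then have "x \<in> cball 0 (R + 1)" "y \<in> cball 0 (R + 1)" using True by auto
      moreover have "dist x y < d" using xy d(1) by auto
      ultimately show ?thesis using d(2) by (force simp: dist_real_def)
    next
      case False
      then have "f x = 0" "f y = 0" using R by blast+
      then show ?thesis using assms(3) by simp
    qed
  qed (use d in auto)
qed

text \<open>The convolution is an average of values of $\psi$ at distance at most $r$ from $x$.\<close>

lemma convolve_approx:
  assumes rho: "continuous_on UNIV \<rho>" "\<And>x. \<rho> x \<ge> 0" "\<And>x. \<rho> x \<noteq> 0 \<Longrightarrow> norm x \<le> r" "(LINT x|lborel. \<rho> x) = 1"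
    and psi: "continuous_on UNIV \<psi>" "\<And>x y. dist x y \<le> r \<Longrightarrow> \<bar>\<psi> x - \<psi> y\<bar> \<le> e"
  shows "\<bar>convolve \<rho> \<psi> x - \<psi> x\<bar> \<le> e"
proof -
  have supp: "bounded {x. \<rho> x \<noteq> 0}" using rho(3) unfolding bounded_iff by blast
  have int: "integrable lborel \<rho>"
    using rho(1) supp by (rule integrable_continuous_bounded_support)
  have int2: "integrable lborel (\<lambda>y. \<psi> (x - y) * \<rho> y)"
  proof (rule integrable_continuous_bounded_support)
    show "continuous_on UNIV (\<lambda>y. \<psi> (x - y) * \<rho> y)"
      using rho(1) psi(1) by (intro continuous_intros continuous_on_compose2[OF psi(1)]) auto
    show "bounded {y. \<psi> (x - y) * \<rho> y \<noteq> 0}" by (rule bounded_subset[OF supp]) auto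
  qed
  have "convolve \<rho> \<psi> x - \<psi> x = (LINT y|lborel. \<psi> (x - y) * \<rho> y) - \<psi> x * (LINT y|lborel. \<rho> y)"
    unfolding convolve_commute[OF rho(1) psi(1)] by (simp add: convolve_def rho(4))
  also have "\<dots> = (LINT y|lborel. (\<psi> (x - y) - \<psi> x) * \<rho> y)"
    using int int2 by (simp add: left_diff_distrib)
  finally have "\<bar>convolve \<rho> \<psi> x - \<psi> x\<bar> \<le> (LINT y|lborel. \<bar>(\<psi> (x - y) - \<psi> x) * \<rho> y\<bar>)"
    by simp
  also have "\<dots> \<le> (LINT y|lborel. e * \<rho> y)"
  proof (rule integral_mono)
    show "\<bar>(\<psi> (x - y) - \<psi> x) * \<rho> y\<bar> \<le> e * \<rho> y" for y
    proof (cases "\<rho> y = 0")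
      case False
      then have "\<bar>\<psi> (x - y) - \<psi> x\<bar> \<le> e" using rho(3) by (intro psi(2)) (simp add: dist_norm)
      then show ?thesis using rho(2)[of y] by (simp add: abs_mult mult_right_mono)
    qed simp
    show "integrable lborel (\<lambda>y. \<bar>(\<psi> (x - y) - \<psi> x) * \<rho> y\<bar>)"
      using int int2 by (intro integrable_abs) (simp add: left_diff_distrib)
  qed (use int in simp)
  also have "\<dots> = e" using rho(4) by simp
  finally show ?thesis .
qed

text \<open>A bump on a small cube, divided by its integral.\<close>

lemma mollifier_exists:
  assumes "r > 0"
  obtains \<rho> :: "real ^ 'm::finite \<Rightarrow> real" where "\<And>k. C_on k UNIV \<rho>" "\<And>x. \<rho> x \<ge> 0"
    "\<And>x. \<rho> x \<noteq> 0 \<Longrightarrow> norm x \<le> r" "(LINT x|lborel. \<rho> x) = 1"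
proof -
  \<comment> \<open>The Euclidean norm is at most the sum of the absolute values of the coordinates.\<close>
  define s where "s = r / real CARD('m)"
  define a :: "real ^ 'm" where "a = vec_lambda (\<lambda>_. - s)"
  define b :: "real ^ 'm" where "b = vec_lambda (\<lambda>_. s)"
  have s: "s > 0" using assms by (simp add: s_def)
  let ?B = "box_bump 1 a b"
  have cont: "continuous_on UNIV ?B" by (rule C_on_continuous[OF C_on_box_bump[of 0]])
  have supp: "{x. ?B x \<noteq> 0} \<subseteq> box a b" using box_bump_eq_0[of 1 _ a b] by auto
  have int: "integrable lborel ?B"
    using cont by (rule integrable_continuous_bounded_support) (rule bounded_subset[OF bounded_box supp])
  have "(LINT x|lborel. ?B x) \<noteq> 0"
  proof
    assume "(LINT x|lborel. ?B x) = 0"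
    then have "AE x in lborel. ?B x = 0"
      using integral_nonneg_eq_0_iff_AE[OF int] box_bump_nonneg[of 1 a b] by auto
    then have "AE x in lborel. x \<notin> box a b"
      by eventually_elim (use box_bump_pos[of 1 _ a b] in force)
    then have "box a b \<in> null_sets lborel"
      by (subst AE_iff_null_sets) auto
    then have "negligible (box a b)"
      using null_sets_completionI negligible_iff_null_sets by blast
    moreover have "(0 :: real ^ 'm) \<in> box a b"
      using s by (simp add: mem_box_vec a_def b_def)
    ultimately show False using open_not_negligible[OF open_box] by blast
  qed
  moreover have "(LINT x|lborel. ?B x) \<ge> 0" by (simp add: box_bump_nonneg)
  ultimately have c: "(LINT x|lborel. ?B x) > 0" by linarith
  show ?thesis
  proof (rule that[of "\<lambda>x. inverse (LINT x|lborel. ?B x) * ?B x"])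
    show "C_on k UNIV (\<lambda>x. inverse (LINT x|lborel. ?B x) * ?B x)" for k
      by (intro C_on_mult C_on_const C_on_box_bump open_UNIV)
    show "0 \<le> inverse (LINT x|lborel. ?B x) * ?B x" for x
      using c box_bump_nonneg[of 1 a b x] by simp
    show "norm x \<le> r" if "inverse (LINT x|lborel. ?B x) * ?B x \<noteq> 0" for x
    proof -
      have "x \<in> box a b" using that supp by auto
      then have "\<bar>vec_nth x i\<bar> \<le> s" for i
        by (auto simp: mem_box_vec a_def b_def abs_le_iff less_imp_le minus_le_iff)
      then have "(\<Sum>i\<in>UNIV. \<bar>vec_nth x i\<bar>) \<le> (\<Sum>i\<in>(UNIV :: 'm set). s)"
        by (intro sum_mono)
      also have "\<dots> = r" by (simp add: s_def)
      finally show ?thesis using norm_le_l1_cart[of x] by linarith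
    qed
    show "(LINT x|lborel. inverse (LINT x|lborel. ?B x) * ?B x) = 1"
      using c by simp
  qed
qed

text \<open>Mollification on a scale below the distance of the support from the boundary and below the moduli
  of uniform continuity of $\psi$ and of its partial derivatives.\<close>

lemma test_function_approximation:
  fixes \<psi> :: "real ^ 'm::finite \<Rightarrow> real"
  assumes "open \<Omega>" and psi: "C_on 1 UNIV \<psi>" "compact_support_in \<Omega> \<psi>" and "e > 0"
  obtains \<phi> where "test_function \<Omega> \<phi>" "\<And>x. \<bar>\<phi> x - \<psi> x\<bar> \<le> e"
    "\<And>i x. \<bar>pderiv_at i \<phi> x - pderiv_at i \<psi> x\<bar> \<le> e"
proof -
  let ?S = "closure {x. \<psi> x \<noteq> 0}"
  have S: "compact ?S" "?S \<subseteq> \<Omega>" using psi(2) by (auto simp: compact_support_in_def)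
  have cont: "continuous_on UNIV \<psi>" "continuous_on UNIV (pderiv_at i \<psi>)" for i
    using psi(1) by (auto simp: C_on_Suc C_on_0)
  have bdd: "bounded {x. \<psi> x \<noteq> 0}" by (rule compact_support_in_bounded[OF psi(2)])
  obtain r0 where r0: "r0 > 0" "(\<Union>x\<in>?S. cball x r0) \<subseteq> \<Omega>"
    using compact_subset_open_imp_cball_epsilon_subset[OF S(1) assms(1) S(2)] by blast
  obtain d where d: "d > 0" "\<And>x y. dist x y \<le> d \<Longrightarrow> \<bar>\<psi> x - \<psi> y\<bar> \<le> e"
    using uniformly_continuous_bounded_support[OF cont(1) bdd assms(4)] by blast
  have "\<exists>d>0. \<forall>x y. dist x y \<le> d \<longrightarrow> \<bar>pderiv_at i \<psi> x - pderiv_at i \<psi> y\<bar> \<le> e" for i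
    using uniformly_continuous_bounded_support[OF cont(2) pderiv_at_bounded_support[OF bdd] assms(4)] by metis
  then obtain d' where d': "\<And>i. d' i > 0" "\<And>i x y. dist x y \<le> d' i \<Longrightarrow> \<bar>pderiv_at i \<psi> x - pderiv_at i \<psi> y\<bar> \<le> e"
    by metis
  define r where "r = min (min r0 d) (Min (range d'))"
  have r: "r > 0" "r \<le> r0" "r \<le> d" "\<And>i. r \<le> d' i"
    using r0 d d' by (auto simp: r_def min_le_iff_disj)
  obtain \<rho> :: "real ^ 'm \<Rightarrow> real" where rho: "\<And>k. C_on k UNIV \<rho>" "\<And>x. \<rho> x \<ge> 0"
    "\<And>x. \<rho> x \<noteq> 0 \<Longrightarrow> norm x \<le> r" "(LINT x|lborel. \<rho> x) = 1"
    using mollifier_exists[OF r(1)] by blast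
  have crho: "continuous_on UNIV \<rho>" using rho(1) C_on_continuous by blast
  have brho: "bounded {x. \<rho> x \<noteq> 0}" using rho(3) unfolding bounded_iff by blast
  show ?thesis
  proof (rule that[of "convolve \<rho> \<psi>"])
    show "test_function \<Omega> (convolve \<rho> \<psi>)"
      unfolding test_function_iff
    proof (intro conjI allI C_on_convolve cont bdd rho(1))
      show "compact_support_in \<Omega> (convolve \<rho> \<psi>)"
      proof (rule compact_support_inI)
        show "compact {x + y |x y. x \<in> ?S \<and> y \<in> cball 0 r}"
          by (intro compact_sums S compact_cball)
        show "{x + y |x y. x \<in> ?S \<and> y \<in> cball 0 r} \<subseteq> \<Omega>"
          using r0(2) r(2) by (fastforce simp: dist_norm)
        fix x assume x: "x \<notin> {x + y |x y. x \<in> ?S \<and> y \<in> cball 0 r}"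
        have "\<rho> (x - y) * \<psi> y = 0" for y
        proof (rule ccontr)
          assume "\<rho> (x - y) * \<psi> y \<noteq> 0"
          then have "y \<in> ?S" "x - y \<in> cball 0 r"
            using rho(3)[of "x - y"] closure_subset[of "{x. \<psi> x \<noteq> 0}"] by auto
          moreover have "x = y + (x - y)" by simp
          ultimately show False using x by blast
        qed
        then show "convolve \<rho> \<psi> x = 0" unfolding convolve_def by (simp only: integral_zero)
      qed
    qed
    show "\<bar>convolve \<rho> \<psi> x - \<psi> x\<bar> \<le> e" for x
      by (rule convolve_approx[OF crho rho(2,3,4) cont(1)]) (use d r in force)+
    show "\<bar>pderiv_at i (convolve \<rho> \<psi>) x - pderiv_at i \<psi> x\<bar> \<le> e" for i x
    proof -
      \<comment> \<open>Commuting the factors moves the derivative from the kernel to \<open>\<psi>\<close>.\<close>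
      have "pderiv_at i (convolve \<rho> \<psi>) x = pderiv_at i (convolve \<psi> \<rho>) x"
        by (simp add: convolve_commute[OF crho cont(1)])
      also have "\<dots> = convolve (pderiv_at i \<psi>) \<rho> x"
        by (rule pderiv_at_convolve[OF psi(1) crho brho])
      also have "\<dots> = convolve \<rho> (pderiv_at i \<psi>) x"
        by (simp add: convolve_commute[OF crho cont(2)])
      finally show ?thesis
        using convolve_approx[OF crho rho(2,3,4) cont(2)[of i], of e x] d'(2) r(4)
        by (metis order_trans)
    qed
  qed
qed

section \<open>Functions vanishing on the boundary\<close>

text \<open>Dominated convergence, with a constant as the integrable majorant.\<close>

lemma L2_lim_dominated:
  assumes fin: "finite_measure (lebesgue_on \<Omega>)" and L2: "\<And>n. L2_on \<Omega> (s n)" "L2_on \<Omega> w"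
    and bound: "\<And>n x. x \<in> \<Omega> \<Longrightarrow> \<bar>s n x - w x\<bar> \<le> B"
    and lim: "\<And>x. x \<in> \<Omega> \<Longrightarrow> (\<lambda>n. s n x) \<longlonglongrightarrow> w x"
  shows "L2_lim \<Omega> s w"
proof -
  interpret finite_measure "lebesgue_on \<Omega>" by fact
  have "(\<lambda>n. LINT x|lebesgue_on \<Omega>. (s n x - w x)\<^sup>2) \<longlonglongrightarrow> (LINT x|lebesgue_on \<Omega>. 0)"
  proof (rule integral_dominated_convergence)
    show "integrable (lebesgue_on \<Omega>) (\<lambda>_. B\<^sup>2)" by simp
    show "AE x in lebesgue_on \<Omega>. (\<lambda>n. (s n x - w x)\<^sup>2) \<longlonglongrightarrow> 0"
    proof (rule AE_I2)
      fix x assume "x \<in> space (lebesgue_on \<Omega>)"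
      then have "(\<lambda>n. (s n x - w x)\<^sup>2) \<longlonglongrightarrow> (w x - w x)\<^sup>2"
        by (intro tendsto_intros lim) (simp add: space_restrict_space)
      then show "(\<lambda>n. (s n x - w x)\<^sup>2) \<longlonglongrightarrow> 0" by simp
    qed
    show "AE x in lebesgue_on \<Omega>. norm ((s n x - w x)\<^sup>2) \<le> B\<^sup>2" for n
      using power_mono[OF bound abs_ge_zero, of _ n 2]
      by (intro AE_I2) (auto simp: space_restrict_space)
    show "(\<lambda>x. (s n x - w x)\<^sup>2) \<in> borel_measurable (lebesgue_on \<Omega>)" for n
      using L2_on_diff[OF L2(1)[of n] L2(2)] by (auto simp: L2_on_def)
  qed auto
  then show ?thesis using L2 by (simp add: L2_lim_def)
qed

lemma flat_exp_tendsto: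
  "filterlim s at_top F \<Longrightarrow> ((\<lambda>k. flat_exp 0 (s k)) \<longlongrightarrow> 1) F"
  "filterlim s at_top F \<Longrightarrow> ((\<lambda>k. flat_exp (Suc n) (s k)) \<longlongrightarrow> 0) F"
proof -
  assume s: "filterlim s at_top F"
  have pos: "\<forall>\<^sub>F k in F. 0 < s k"
    using s by (simp add: filterlim_at_top_dense)
  have inv: "((\<lambda>k. inverse (s k)) \<longlongrightarrow> 0) F"
    using s by (rule filterlim_compose[OF tendsto_inverse_0_at_top[OF filterlim_ident], rotated])
  have "((\<lambda>k. exp (- inverse (s k))) \<longlongrightarrow> exp (- 0)) F"
    by (intro tendsto_intros inv)
  then have e: "((\<lambda>k. exp (- inverse (s k))) \<longlongrightarrow> 1) F" by simp
  have "\<forall>\<^sub>F k in F. exp (- inverse (s k)) = flat_exp 0 (s k)"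
    using pos by eventually_elim (simp add: flat_exp_def divide_inverse)
  with e show "((\<lambda>k. flat_exp 0 (s k)) \<longlongrightarrow> 1) F"
    by (rule Lim_transform_eventually)
  have "((\<lambda>k. exp (- inverse (s k)) * inverse (s k) ^ Suc n) \<longlongrightarrow> 1 * 0 ^ Suc n) F"
    by (intro tendsto_intros e inv)
  moreover have "\<forall>\<^sub>F k in F. exp (- inverse (s k)) * inverse (s k) ^ Suc n = flat_exp (Suc n) (s k)"
    using pos by eventually_elim (simp add: flat_exp_def divide_inverse power_inverse)
  ultimately show "((\<lambda>k. flat_exp (Suc n) (s k)) \<longlongrightarrow> 0) F"
    by (auto intro: Lim_transform_eventually)
qed

text \<open>A diagonal argument: the $n$-th function is mollified up to a uniform error $1/(n+1)$.\<close>

lemma test_approx_C1_compact_support: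
  fixes \<Omega> :: "(real ^ 'm::finite) set"
  assumes "open \<Omega>" "finite_measure (lebesgue_on \<Omega>)"
    and w: "\<And>n. C_on 1 UNIV (w n)" "\<And>n. compact_support_in \<Omega> (w n)"
    and lim: "L2_lim \<Omega> w z" "\<And>i. L2_lim \<Omega> (\<lambda>n. pderiv_at i (w n)) (\<lambda>x. vec_nth (v x) i)"
  obtains \<phi> where "test_approx \<Omega> z v \<phi>"
proof -
  let ?e = "\<lambda>n. inverse (real (Suc n))"
  have "\<exists>\<phi>. test_function \<Omega> \<phi> \<and> (\<forall>x. \<bar>\<phi> x - w n x\<bar> \<le> ?e n) \<and>
      (\<forall>i x. \<bar>pderiv_at i \<phi> x - pderiv_at i (w n) x\<bar> \<le> ?e n)" for n
    using test_function_approximation[OF assms(1) w, of "?e n"] by (metis inverse_positive_iff_positive of_nat_0_less_iff zero_less_Suc)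
  then obtain \<phi> where phi: "\<And>n. test_function \<Omega> (\<phi> n)" "\<And>n x. \<bar>\<phi> n x - w n x\<bar> \<le> ?e n"
    "\<And>n i x. \<bar>pderiv_at i (\<phi> n) x - pderiv_at i (w n) x\<bar> \<le> ?e n"
    by metis
  have small: "L2_lim \<Omega> s (\<lambda>_. 0)" if "\<And>n. L2_on \<Omega> (s n)" "\<And>n x. \<bar>s n x\<bar> \<le> ?e n" for s
  proof (rule L2_lim_dominated[OF assms(2) that(1)])
    show "\<bar>s n x - 0\<bar> \<le> 1" for n x
    proof -
      have "?e n \<le> 1" by (simp add: field_simps)
      with that(2)[of n x] show ?thesis by linarith
    qed
    show "(\<lambda>n. s n x) \<longlonglongrightarrow> 0" for x
      by (rule Lim_null_comparison[OF _ LIMSEQ_inverse_real_of_nat]) (use that(2) in auto)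
  qed (simp add: L2_on_def)
  have L2: "L2_on \<Omega> (\<phi> n)" "L2_on \<Omega> (w n)" "L2_on \<Omega> (pderiv_at i (\<phi> n))" "L2_on \<Omega> (pderiv_at i (w n))" for n i
    using L2_on_test_function[OF assms(1) phi(1)] lim by (auto simp: L2_lim_def)
  have "L2_lim \<Omega> \<phi> z"
    using L2_lim_add[OF lim(1) small[OF L2_on_diff[OF L2(1,2)] phi(2)]] by simp
  moreover have "L2_lim \<Omega> (\<lambda>n. pderiv_at i (\<phi> n)) (\<lambda>x. vec_nth (v x) i)" for i
    using L2_lim_add[OF lim(2)[of i] small[OF L2_on_diff[OF L2(3)[of i] L2(4)[of i]] phi(3)]] by simp
  ultimately have "test_approx \<Omega> z v \<phi>" using phi(1) by (simp add: test_approx_def)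
  then show ?thesis by (rule that)
qed

text \<open>The cutoff is $\eta_k = e^{-1/s_k}$ with $s_k = k d^2 - 1$, read as $0$ where $s_k \le 0$. It vanishes
  near the boundary, where $d$ is small, and tends to $1$ at every point of $\Omega$, where $d \neq 0$.
  The gradient of the cutoff blows up with $k$, but it is multiplied by $d n$:
  from $k d^2 = s_k + 1$ the dangerous term becomes
  $2 n \, \partial_i d \, (s_k + 1) e^{-1/s_k} / s_k^2$, which is bounded uniformly in $k$ and tends to
  $0$ pointwise. So dominated convergence applies to the functions and to the gradients.\<close>

lemma test_approx_vanishing_on_boundary:
  fixes \<Omega> :: "(real ^ 'm::finite) set"
  assumes "open \<Omega>" "bounded \<Omega>"
    and d: "C_on 1 \<Omega> d" "continuous_on (closure \<Omega>) d" "\<And>x. x \<in> frontier \<Omega> \<Longrightarrow> d x = 0" "\<And>x. x \<in> \<Omega> \<Longrightarrow> d x \<noteq> 0"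
    and n: "C_on 1 \<Omega> n"
    and B: "\<And>x. x \<in> \<Omega> \<Longrightarrow> \<bar>d x\<bar> \<le> B" "\<And>x. x \<in> \<Omega> \<Longrightarrow> \<bar>n x\<bar> \<le> B"
      "\<And>x i. x \<in> \<Omega> \<Longrightarrow> \<bar>pderiv_at i d x\<bar> \<le> B" "\<And>x i. x \<in> \<Omega> \<Longrightarrow> \<bar>pderiv_at i n x\<bar> \<le> B"
  obtains \<phi> where "test_approx \<Omega> (\<lambda>x. d x * n x) (grad (\<lambda>x. d x * n x)) \<phi>"
proof -
  let ?z = "\<lambda>x. d x * n x"
  note fin = finite_measure_lebesgue_on_bounded[OF assms(1,2)]
  define s where "s k x = real k * (d x * d x) - 1" for k x
  define w where "w k x = (if x \<in> \<Omega> then ?z x * flat_exp 0 (s k x) else 0)" for k x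
  define K where "K k = closure \<Omega> \<inter> s k -` {0..}" for k
  have K: "compact (K k)" "K k \<subseteq> \<Omega>" for k
  proof -
    have "continuous_on (closure \<Omega>) (s k)"
      unfolding s_def[abs_def] by (intro continuous_intros d)
    then have "closed (K k)"
      unfolding K_def by (intro continuous_closed_preimage closed_closure closed_atLeast)
    moreover have "bounded (K k)"
      by (rule bounded_subset[OF bounded_closure[OF assms(2)]]) (auto simp: K_def)
    ultimately show "compact (K k)" by (simp add: compact_eq_bounded_closed)
    show "K k \<subseteq> \<Omega>"
    proof
      fix x assume x: "x \<in> K k"
      then have "d x \<noteq> 0" by (auto simp: K_def s_def)
      then have "x \<notin> frontier \<Omega>" using d(3) by blast
      then show "x \<in> \<Omega>" using x assms(1) by (auto simp: K_def frontier_def interior_open)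
    qed
  qed
  have fe0: "flat_exp m (s k x) = 0" if "x \<in> \<Omega> - K k" for m k x
    using that closure_subset[of \<Omega>] by (auto simp: K_def flat_exp_def)
  have diff: "d differentiable (at x)" "n differentiable (at x)" if "x \<in> \<Omega>" for x
    using d(1) n that by (auto simp: C_on_Suc)
  have C1s: "C_on 1 \<Omega> (s k)" for k
    unfolding s_def[abs_def] using assms(1) d(1) by (intro C_on_diff C_on_mult C_on_const)
  have C1z: "C_on 1 \<Omega> ?z" using assms(1) d(1) n by (intro C_on_mult)
  have C1w': "C_on 1 \<Omega> (\<lambda>x. ?z x * flat_exp 0 (s k x))" for k
    by (rule C_on_mult[OF assms(1) C1z C_on_flat_exp[OF assms(1) C1s]])
  have w: "C_on 1 UNIV (w k)" for k
    unfolding w_def[abs_def]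
    by (rule C_on_zero_extension[OF assms(1) C1w' compact_imp_closed[OF K(1)[of k]] K(2)]) (simp add: fe0)
  have wsupp: "compact_support_in \<Omega> (w k)" for k
    by (rule compact_support_inI[OF K, of k]) (auto simp: w_def fe0)
  have pz: "pderiv_at i ?z x = pderiv_at i d x * n x + d x * pderiv_at i n x" if "x \<in> \<Omega>" for i x
    using pderiv_at_mult[OF diff[OF that]] .
  have pw: "pderiv_at i (w k) x = pderiv_at i ?z x * flat_exp 0 (s k x)
      + 2 * n x * pderiv_at i d x * (flat_exp 1 (s k x) + flat_exp 2 (s k x))"
    if "x \<in> \<Omega>" for i k x
  proof -
    have sd: "s k differentiable (at x)" using C1s that by (auto simp: C_on_Suc)
    have "pderiv_at i (s k) x = real k * (2 * d x * pderiv_at i d x)"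
    proof -
      have dd: "(\<lambda>x. d x * d x) differentiable (at x)"
        by (rule differentiable_mult[OF diff(1)[OF that] diff(1)[OF that]])
      have "(\<lambda>x. real k * (d x * d x)) differentiable (at x)"
        by (rule differentiable_mult[OF differentiable_const dd])
      then have "pderiv_at i (s k) x = pderiv_at i (\<lambda>x. real k * (d x * d x)) x"
        unfolding s_def[abs_def] by (subst pderiv_at_diff) (auto simp: pderiv_at_const)
      also have "\<dots> = real k * (2 * d x * pderiv_at i d x)"
        using pderiv_at_cmult[OF dd] pderiv_at_mult[OF diff(1)[OF that] diff(1)[OF that]] by simp
      finally show ?thesis .
    qed
    then have pf: "pderiv_at i (\<lambda>x. flat_exp 0 (s k x)) x = flat_exp 2 (s k x) * (real k * (2 * d x * pderiv_at i d x))"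
      using pderiv_at_compose[OF sd has_real_derivative_flat_exp[of 0]] by (simp add: numeral_2_eq_2)
    have fd: "(\<lambda>x. flat_exp 0 (s k x)) differentiable (at x)"
      using C_on_flat_exp[OF assms(1) C1s] that by (auto simp: C_on_Suc)
    have zd: "?z differentiable (at x)"
      using C1z that by (auto simp: C_on_Suc)
    have "pderiv_at i (w k) x = pderiv_at i (\<lambda>x. ?z x * flat_exp 0 (s k x)) x"
      by (rule pderiv_at_cong[OF assms(1) that]) (simp add: w_def)
    also have "\<dots> = pderiv_at i ?z x * flat_exp 0 (s k x) + ?z x * (flat_exp 2 (s k x) * (real k * (2 * d x * pderiv_at i d x)))"
      using pderiv_at_mult[OF zd fd] pf by simp
    \<comment> \<open>Here \<open>real k * (d x * d x) = s k x + 1\<close> removes the factor \<open>k\<close>.\<close>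
    also have "?z x * (flat_exp 2 (s k x) * (real k * (2 * d x * pderiv_at i d x))) =
        2 * n x * pderiv_at i d x * ((s k x + 1) * flat_exp 2 (s k x))"
      by (simp add: s_def)
    also have "(s k x + 1) * flat_exp 2 (s k x) = flat_exp 1 (s k x) + flat_exp 2 (s k x)"
      using flat_exp_Suc[of 1 "s k x"] by (simp add: distrib_right numeral_2_eq_2)
    finally show ?thesis .
  qed
  have s_lim: "filterlim (\<lambda>k. s k x) at_top sequentially" if "x \<in> \<Omega>" for x
  proof -
    have "d x * d x > 0" using d(4)[OF that] by (simp add: zero_less_mult_iff) linarith
    then have "filterlim (\<lambda>k. - 1 + real k * (d x * d x)) at_top sequentially"
      by (intro filterlim_tendsto_add_at_top[OF tendsto_const] filterlim_at_top_mult_tendsto_pos[OF tendsto_const] filterlim_real_sequentially)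
    then show ?thesis by (simp add: s_def)
  qed
  have fe01: "0 \<le> flat_exp 0 t" "flat_exp 0 t \<le> 1" "0 \<le> flat_exp 1 t" "flat_exp 1 t \<le> 1" "0 \<le> flat_exp 2 t" "flat_exp 2 t \<le> 2" for t
    using flat_exp_nonneg flat_exp_le_fact[of 0 t] flat_exp_le_fact[of 1 t] flat_exp_le_fact[of 2 t] by auto
  have mult_bound: "\<bar>a * b\<bar> \<le> B * B" if "\<bar>a\<bar> \<le> B" "\<bar>b\<bar> \<le> B" for a b
    unfolding abs_mult using that by (intro mult_mono) auto
  have zb: "\<bar>?z x\<bar> \<le> B * B" if "x \<in> \<Omega>" for x
    by (rule mult_bound) (use B that in auto)
  have pzb: "\<bar>pderiv_at i ?z x\<bar> \<le> 2 * (B * B)" if "x \<in> \<Omega>" for i x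
    using mult_bound[OF B(3)[OF that] B(2)[OF that], of i] mult_bound[OF B(1)[OF that] B(4)[OF that], of i]
    unfolding pz[OF that] by linarith
  have damp: "\<bar>a * t - a\<bar> \<le> \<bar>a\<bar>" if "0 \<le> t" "t \<le> 1" for a t :: real
  proof -
    have "\<bar>a * t - a\<bar> = \<bar>a\<bar> * \<bar>t - 1\<bar>" by (simp add: right_diff_distrib flip: abs_mult)
    also have "\<dots> \<le> \<bar>a\<bar> * 1" using that by (intro mult_left_mono) auto
    finally show ?thesis by simp
  qed
  have L2z: "L2_on \<Omega> ?z"
    by (rule L2_on_continuous_bounded[OF assms(1) fin C_on_continuous[OF C1z] zb])
  have L2pz: "L2_on \<Omega> (pderiv_at i ?z)" for i
    using C1z by (intro L2_on_continuous_bounded[OF assms(1) fin _ pzb]) (auto simp: C_on_Suc C_on_0)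
  have L2w: "L2_on \<Omega> (w k)" "L2_on \<Omega> (pderiv_at i (w k))" for k i
    using w[of k] wsupp[of k] compact_support_in_pderiv_at[OF wsupp[of k], of i]
    by (auto intro!: L2_on_compact_support assms(1) simp: C_on_Suc C_on_0)
  have lim1: "L2_lim \<Omega> w ?z"
  proof (rule L2_lim_dominated[OF fin L2w(1) L2z])
    fix x assume x: "x \<in> \<Omega>"
    show "\<bar>w k x - ?z x\<bar> \<le> B * B" for k
      using order_trans[OF damp[OF fe01(1,2)] zb[OF x]] x by (simp add: w_def)
    have "(\<lambda>k. ?z x * flat_exp 0 (s k x)) \<longlonglongrightarrow> ?z x * 1"
      by (intro tendsto_intros flat_exp_tendsto s_lim x)
    then show "(\<lambda>k. w k x) \<longlonglongrightarrow> ?z x" using x by (simp add: w_def)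
  qed
  have lim2: "L2_lim \<Omega> (\<lambda>k. pderiv_at i (w k)) (\<lambda>x. vec_nth (grad ?z x) i)" for i
    unfolding grad_nth
  proof (rule L2_lim_dominated[OF fin L2w(2) L2pz])
    fix x assume x: "x \<in> \<Omega>"
    show "\<bar>pderiv_at i (w k) x - pderiv_at i ?z x\<bar> \<le> 2 * (B * B) + 2 * (B * B) * 3" for k
    proof -
      have "\<bar>2 * n x * pderiv_at i d x * (flat_exp 1 (s k x) + flat_exp 2 (s k x))\<bar> \<le> 2 * (B * B) * 3"
        unfolding abs_mult[of "2 * n x * pderiv_at i d x"]
        using mult_bound[OF B(2)[OF x] B(3)[OF x], of i] fe01[of "s k x"]
        by (intro mult_mono) (auto simp: abs_mult)
      then show ?thesis
        using order_trans[OF damp[OF fe01(1,2)] pzb[OF x], of i "s k x"]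
        unfolding pw[OF x] by linarith
    qed
    have "(\<lambda>k. pderiv_at i ?z x * flat_exp 0 (s k x) + 2 * n x * pderiv_at i d x * (flat_exp (Suc 0) (s k x) + flat_exp (Suc (Suc 0)) (s k x)))
        \<longlonglongrightarrow> pderiv_at i ?z x * 1 + 2 * n x * pderiv_at i d x * (0 + 0)"
      by (intro tendsto_intros flat_exp_tendsto s_lim x)
    then show "(\<lambda>k. pderiv_at i (w k) x) \<longlonglongrightarrow> pderiv_at i ?z x"
      unfolding pw[OF x] by (simp add: numeral_2_eq_2)
  qed
  show ?thesis
    using test_approx_C1_compact_support[OF assms(1) fin w wsupp lim1 lim2] that by blast
qed

section \<open>The weak Dirichlet problem\<close>

text \<open>The Riesz representation theorem without completeness. The functional $Q(\phi) = E(\phi, \phi) - 2 F(\phi)$ is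
  bounded below; by the parallelogram identity a minimizing sequence is a Cauchy sequence for $E$,
  and by comparison with $\phi_n + t \psi$ it satisfies the Euler-Lagrange equation
  $E(\phi, \psi) = F(\psi)$ in the limit. Completion is left to the application.\<close>

lemma quadratic_minimizing_sequence:
  fixes V :: "('a \<Rightarrow> real) set" and E :: "('a \<Rightarrow> real) \<Rightarrow> ('a \<Rightarrow> real) \<Rightarrow> real" and F :: "('a \<Rightarrow> real) \<Rightarrow> real"
  assumes V: "V \<noteq> {}" "\<And>\<phi> \<psi> t. \<phi> \<in> V \<Longrightarrow> \<psi> \<in> V \<Longrightarrow> (\<lambda>x. \<phi> x + t * \<psi> x) \<in> V"
    and sym: "\<And>\<phi> \<psi>. E \<phi> \<psi> = E \<psi> \<phi>"
    and E_lin: "\<And>\<phi> \<psi> \<chi> t. \<phi> \<in> V \<Longrightarrow> \<psi> \<in> V \<Longrightarrow> \<chi> \<in> V \<Longrightarrow> E (\<lambda>x. \<phi> x + t * \<psi> x) \<chi> = E \<phi> \<chi> + t * E \<psi> \<chi>"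
    and F_lin: "\<And>\<phi> \<psi> t. \<phi> \<in> V \<Longrightarrow> \<psi> \<in> V \<Longrightarrow> F (\<lambda>x. \<phi> x + t * \<psi> x) = F \<phi> + t * F \<psi>"
    and nonneg: "\<And>\<phi>. E \<phi> \<phi> \<ge> 0"
    and bound: "\<And>\<phi>. \<phi> \<in> V \<Longrightarrow> 2 * F \<phi> \<le> E \<phi> \<phi> + K"
  obtains \<phi> where "\<And>n :: nat. \<phi> n \<in> V"
    "\<And>e. e > 0 \<Longrightarrow> \<exists>N. \<forall>i\<ge>N. \<forall>j\<ge>N. E (\<lambda>x. \<phi> i x - \<phi> j x) (\<lambda>x. \<phi> i x - \<phi> j x) < e"
    "\<And>\<psi>. \<psi> \<in> V \<Longrightarrow> (\<lambda>n. E (\<phi> n) \<psi>) \<longlonglongrightarrow> F \<psi>"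
proof -
  define Q where "Q \<phi> = E \<phi> \<phi> - 2 * F \<phi>" for \<phi>
  define m where "m = Inf (Q ` V)"
  have E_quad: "E (\<lambda>x. \<phi> x + t * \<psi> x) (\<lambda>x. \<phi> x + t * \<psi> x) = E \<phi> \<phi> + 2 * t * E \<phi> \<psi> + t\<^sup>2 * E \<psi> \<psi>"
    if "\<phi> \<in> V" "\<psi> \<in> V" for \<phi> \<psi> t
  proof -
    have c: "(\<lambda>x. \<phi> x + t * \<psi> x) \<in> V" using V(2) that by blast
    have "E \<phi> (\<lambda>x. \<phi> x + t * \<psi> x) = E \<phi> \<phi> + t * E \<phi> \<psi>"
      using E_lin[OF that that(1), of t] sym by metis
    moreover have "E \<psi> (\<lambda>x. \<phi> x + t * \<psi> x) = E \<phi> \<psi> + t * E \<psi> \<psi>"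
      using E_lin[OF that that(2), of t] sym by metis
    ultimately show ?thesis
      using E_lin[OF that c, of t] by (simp add: power2_eq_square algebra_simps)
  qed
  have "bdd_below (Q ` V)"
    unfolding bdd_below_def using bound by (intro exI[of _ "- K"]) (force simp: Q_def)
  then have m: "m \<le> Q \<phi>" if "\<phi> \<in> V" for \<phi>
    unfolding m_def using that by (intro cInf_lower) auto
  have "\<exists>\<phi>. \<phi> \<in> V \<and> Q \<phi> < m + inverse (real (Suc n))" for n
  proof -
    have "Inf (Q ` V) < m + inverse (real (Suc n))" by (simp add: m_def)
    then show ?thesis using V(1) by (auto dest: cInf_lessD[rotated])
  qed
  then obtain \<phi> where phi: "\<And>n. \<phi> n \<in> V" "\<And>n. Q (\<phi> n) < m + inverse (real (Suc n))" by metis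
  show ?thesis
  proof (rule that[OF phi(1)])
    fix e :: real assume "e > 0"
    then obtain N where N: "inverse (real (Suc N)) < e / 4"
      using reals_Archimedean[of "e / 4"] by auto
    have "E (\<lambda>x. \<phi> i x - \<phi> j x) (\<lambda>x. \<phi> i x - \<phi> j x) < e" if "i \<ge> N" "j \<ge> N" for i j
    proof -
      let ?d = "\<lambda>x. \<phi> j x + (-1) * \<phi> i x"
      have d: "?d \<in> V" by (intro V(2) phi(1))
      have mid: "(\<lambda>x. \<phi> i x + (1/2) * ?d x) \<in> V" by (intro V(2)[OF phi(1)] d)
      have Ed: "E ?d (\<phi> i) = E (\<phi> j) (\<phi> i) - E (\<phi> i) (\<phi> i)"
        using E_lin[OF phi(1)[of j] phi(1)[of i] phi(1)[of i], of "-1"] by simp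
      have Edd: "E ?d ?d = E (\<phi> j) (\<phi> j) - 2 * E (\<phi> j) (\<phi> i) + E (\<phi> i) (\<phi> i)"
        using E_quad[OF phi(1)[of j] phi(1)[of i], of "-1"] by simp
      have "E (\<lambda>x. \<phi> i x + (1/2) * ?d x) (\<lambda>x. \<phi> i x + (1/2) * ?d x) =
          E (\<phi> i) (\<phi> i) + E (\<phi> i) ?d + (1/4) * E ?d ?d"
        using E_quad[OF phi(1)[of i] d, of "1/2"] by (simp add: power2_eq_square)
      moreover have "F (\<lambda>x. \<phi> i x + (1/2) * ?d x) = F (\<phi> i) + (1/2) * (F (\<phi> j) - F (\<phi> i))"
        using F_lin[OF phi(1)[of i] d, of "1/2"] F_lin[OF phi(1)[of j] phi(1)[of i], of "-1"] by simp
      \<comment> \<open>The parallelogram identity; the last argument is the midpoint of \<open>\<phi> i\<close> and \<open>\<phi> j\<close>.\<close>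
      ultimately have "E ?d ?d = 2 * Q (\<phi> i) + 2 * Q (\<phi> j) - 4 * Q (\<lambda>x. \<phi> i x + (1/2) * ?d x)"
        using Ed Edd sym[of "\<phi> i" ?d] unfolding Q_def by (simp add: algebra_simps)
      also have "\<dots> < 2 * inverse (real (Suc i)) + 2 * inverse (real (Suc j))"
        using phi(2)[of i] phi(2)[of j] m[OF mid] by linarith
      also have "\<dots> \<le> 2 * inverse (real (Suc N)) + 2 * inverse (real (Suc N))"
        using that by (intro add_mono mult_left_mono le_imp_inverse_le) auto
      also have "\<dots> < e" using N by simp
      finally have "E ?d ?d < e" .
      moreover have "E (\<lambda>x. \<phi> i x - \<phi> j x) (\<lambda>x. \<phi> i x - \<phi> j x) = E ?d ?d"
        using E_quad[OF phi(1)[of i] phi(1)[of j], of "-1"] Edd sym[of "\<phi> i" "\<phi> j"] by simp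
      ultimately show ?thesis by simp
    qed
    then show "\<exists>N. \<forall>i\<ge>N. \<forall>j\<ge>N. E (\<lambda>x. \<phi> i x - \<phi> j x) (\<lambda>x. \<phi> i x - \<phi> j x) < e" by blast
  next
    fix \<psi> assume psi: "\<psi> \<in> V"
    define D where "D = E \<psi> \<psi>"
    define a where "a n = E (\<phi> n) \<psi> - F \<psi>" for n
    have D: "D \<ge> 0" by (simp add: D_def nonneg)
    have sq: "(a n)\<^sup>2 \<le> inverse (real (Suc n)) * (D + 1)" for n
    proof -
      \<comment> \<open>Nearly the minimizer of $2 t a_n + t^2 D$; the summand $1$ avoids a division by zero.\<close>
      define t where "t = - a n / (D + 1)"
      have "m \<le> Q (\<lambda>x. \<phi> n x + t * \<psi> x)" by (intro m V(2) phi psi)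
      also have "\<dots> = Q (\<phi> n) + 2 * t * a n + t\<^sup>2 * D"
        unfolding Q_def a_def D_def E_quad[OF phi(1) psi] F_lin[OF phi(1) psi] by (simp add: algebra_simps)
      also have "\<dots> \<le> Q (\<phi> n) + 2 * t * a n + t\<^sup>2 * (D + 1)"
        by (simp add: algebra_simps)
      also have "2 * t * a n = - 2 * ((a n)\<^sup>2 / (D + 1))"
        by (simp add: t_def power2_eq_square)
      also have "t\<^sup>2 * (D + 1) = (a n)\<^sup>2 / (D + 1)"
        using D by (simp add: t_def power_divide power2_eq_square[of "D + 1"])
      finally have "(a n)\<^sup>2 / (D + 1) \<le> inverse (real (Suc n))"
        using phi(2)[of n] by linarith
      then show ?thesis using D by (simp only: pos_divide_le_eq[of "D + 1"] add_nonneg_pos zero_less_one)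
    qed
    have "a \<longlonglongrightarrow> 0"
    proof (rule Lim_null_comparison)
      show "\<forall>\<^sub>F n in sequentially. norm (a n) \<le> sqrt (inverse (real (Suc n)) * (D + 1))"
        using sq by (intro always_eventually allI) (metis real_norm_def real_sqrt_abs real_sqrt_le_iff)
      have "(\<lambda>n. sqrt (inverse (real (Suc n)) * (D + 1))) \<longlonglongrightarrow> sqrt (0 * (D + 1))"
        by (intro tendsto_intros LIMSEQ_inverse_real_of_nat)
      then show "(\<lambda>n. sqrt (inverse (real (Suc n)) * (D + 1))) \<longlonglongrightarrow> 0" by simp
    qed
    then show "(\<lambda>n. E (\<phi> n) \<psi>) \<longlonglongrightarrow> F \<psi>"
      unfolding a_def by (simp add: LIM_zero_iff)
  qed
qed

text \<open>Expand $\int (t u - v)^2 \ge 0$.\<close>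

lemma L2_young:
  assumes "L2_on \<Omega> u" "L2_on \<Omega> v" "t > 0"
  shows "2 * (LINT x|lebesgue_on \<Omega>. u x * v x) \<le>
    t * (LINT x|lebesgue_on \<Omega>. (u x)\<^sup>2) + (LINT x|lebesgue_on \<Omega>. (v x)\<^sup>2) / t"
proof -
  have "0 \<le> (LINT x|lebesgue_on \<Omega>. (t * u x + (-1) * v x)\<^sup>2)" by simp
  then have "2 * t * (LINT x|lebesgue_on \<Omega>. u x * v x) \<le>
      t\<^sup>2 * (LINT x|lebesgue_on \<Omega>. (u x)\<^sup>2) + (LINT x|lebesgue_on \<Omega>. (v x)\<^sup>2)"
    unfolding integral_square_sum[OF assms(1,2)] by simp
  then show ?thesis
    using assms(3) by (simp add: field_simps power2_eq_square)
qed

text \<open>Minimize the Dirichlet energy over test functions. Poincare's inequality bounds the linear part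
  by the quadratic one, and it makes the minimizing sequence, whose gradients form a Cauchy
  sequence in $L^2$, a Cauchy sequence in $L^2$ itself. The functions $q_i$ stand for the partial
  derivatives of the boundary data, which enter when $\hat u = w + \tilde g$ is substituted into the equation.\<close>

lemma weak_dirichlet_problem_solvable:
  fixes \<Omega> :: "(real ^ 'm::finite) set" and q :: "'m \<Rightarrow> real ^ 'm \<Rightarrow> real"
  assumes "open \<Omega>" "bounded \<Omega>" "L2_on \<Omega> f" "\<And>i. L2_on \<Omega> (q i)"
  obtains w v \<phi> where "test_approx \<Omega> w v \<phi>"
    "\<And>\<psi>. test_function \<Omega> \<psi> \<Longrightarrow> (\<Sum>i\<in>UNIV. (LINT x|lebesgue_on \<Omega>. vec_nth (v x) i * pderiv_at i \<psi> x)) =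
      (LINT x|lebesgue_on \<Omega>. f x * \<psi> x) - (\<Sum>i\<in>UNIV. (LINT x|lebesgue_on \<Omega>. q i x * pderiv_at i \<psi> x))"
proof -
  note fin = finite_measure_lebesgue_on_bounded[OF assms(1,2)]
  obtain C where C: "C > 0" "\<And>\<phi>. test_function \<Omega> \<phi> \<Longrightarrow>
    (LINT x|lebesgue_on \<Omega>. (\<phi> x)\<^sup>2) \<le> C * (\<Sum>i\<in>UNIV. (LINT x|lebesgue_on \<Omega>. (pderiv_at i \<phi> x)\<^sup>2))"
    using poincare_inequality[OF assms(1,2)] by blast
  define E where "E \<phi> \<psi> = (\<Sum>i\<in>UNIV. (LINT x|lebesgue_on \<Omega>. pderiv_at i \<phi> x * pderiv_at i \<psi> x))" for \<phi> \<psi>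
  define F where "F \<phi> = (LINT x|lebesgue_on \<Omega>. f x * \<phi> x) - (\<Sum>i\<in>UNIV. (LINT x|lebesgue_on \<Omega>. q i x * pderiv_at i \<phi> x))" for \<phi>
  define K where "K = 2 * C * (LINT x|lebesgue_on \<Omega>. (f x)\<^sup>2) + (\<Sum>i\<in>UNIV. 2 * (LINT x|lebesgue_on \<Omega>. (q i x)\<^sup>2))"
  note L2 = L2_on_test_function[OF assms(1)]
  have Esq: "E \<phi> \<phi> = (\<Sum>i\<in>UNIV. (LINT x|lebesgue_on \<Omega>. (pderiv_at i \<phi> x)\<^sup>2))" for \<phi>
    by (simp add: E_def power2_eq_square)
  obtain \<phi> where phi: "\<And>n :: nat. \<phi> n \<in> Collect (test_function \<Omega>)"
    "\<And>e. e > 0 \<Longrightarrow> \<exists>N. \<forall>i\<ge>N. \<forall>j\<ge>N. E (\<lambda>x. \<phi> i x - \<phi> j x) (\<lambda>x. \<phi> i x - \<phi> j x) < e"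
    "\<And>\<psi>. \<psi> \<in> Collect (test_function \<Omega>) \<Longrightarrow> (\<lambda>n. E (\<phi> n) \<psi>) \<longlonglongrightarrow> F \<psi>"
  proof (rule quadratic_minimizing_sequence[of "Collect (test_function \<Omega>)" E F K])
    show "Collect (test_function \<Omega>) \<noteq> {}" using test_function_0 by blast
    show "E \<phi> \<psi> = E \<psi> \<phi>" for \<phi> \<psi> by (simp add: E_def mult.commute)
    show "E \<phi> \<phi> \<ge> 0" for \<phi> unfolding Esq by (intro sum_nonneg) simp
    fix \<phi> \<psi> t assume "\<phi> \<in> Collect (test_function \<Omega>)" "\<psi> \<in> Collect (test_function \<Omega>)"
    then have p: "test_function \<Omega> \<phi>" "test_function \<Omega> \<psi>" by auto
    show "(\<lambda>x. \<phi> x + t * \<psi> x) \<in> Collect (test_function \<Omega>)"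
      using test_function_lin[OF p] by simp
    show "F (\<lambda>x. \<phi> x + t * \<psi> x) = F \<phi> + t * F \<psi>"
      using L2_on_mult_integrable[OF assms(3) L2(1)[OF p(1)]] L2_on_mult_integrable[OF assms(3) L2(1)[OF p(2)]]
        L2_on_mult_integrable[OF assms(4) L2(2)[OF p(1)]] L2_on_mult_integrable[OF assms(4) L2(2)[OF p(2)]]
      by (simp add: F_def pderiv_at_lin[OF p] distrib_left sum.distrib mult.left_commute[of _ t]
          right_diff_distrib flip: sum_distrib_left)
    show "E (\<lambda>x. \<phi> x + t * \<psi> x) \<chi> = E \<phi> \<chi> + t * E \<psi> \<chi>" if "\<chi> \<in> Collect (test_function \<Omega>)" for \<chi>
    proof -
      have c: "test_function \<Omega> \<chi>" using that by simp
      show ?thesis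
        using L2_on_mult_integrable[OF L2(2)[OF p(1)] L2(2)[OF c]] L2_on_mult_integrable[OF L2(2)[OF p(2)] L2(2)[OF c]]
        by (simp add: E_def pderiv_at_lin[OF p] distrib_right sum.distrib mult.assoc flip: sum_distrib_left)
    qed
    have "2 * (LINT x|lebesgue_on \<Omega>. f x * \<phi> x) \<le> (2 * C) * (LINT x|lebesgue_on \<Omega>. (f x)\<^sup>2) + (LINT x|lebesgue_on \<Omega>. (\<phi> x)\<^sup>2) / (2 * C)"
      using C(1) by (intro L2_young assms(3) L2(1)[OF p(1)]) simp
    also have "(LINT x|lebesgue_on \<Omega>. (\<phi> x)\<^sup>2) / (2 * C) \<le> (C * E \<phi> \<phi>) / (2 * C)"
      using C p(1) by (intro divide_right_mono) (auto simp: Esq)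
    also have "\<dots> = E \<phi> \<phi> / 2" using C(1) by simp
    finally have 1: "2 * (LINT x|lebesgue_on \<Omega>. f x * \<phi> x) \<le> 2 * C * (LINT x|lebesgue_on \<Omega>. (f x)\<^sup>2) + E \<phi> \<phi> / 2" by simp
    have "2 * (LINT x|lebesgue_on \<Omega>. (-1 * q i x) * pderiv_at i \<phi> x) \<le>
        2 * (LINT x|lebesgue_on \<Omega>. (-1 * q i x)\<^sup>2) + (LINT x|lebesgue_on \<Omega>. (pderiv_at i \<phi> x)\<^sup>2) / 2" for i
      by (intro L2_young L2_on_cmult assms(4) L2(2)[OF p(1)]) simp
    then have "(\<Sum>i\<in>UNIV. - 2 * (LINT x|lebesgue_on \<Omega>. q i x * pderiv_at i \<phi> x)) \<le>
        (\<Sum>i\<in>UNIV. 2 * (LINT x|lebesgue_on \<Omega>. (q i x)\<^sup>2) + (LINT x|lebesgue_on \<Omega>. (pderiv_at i \<phi> x)\<^sup>2) / 2)"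
      by (intro sum_mono) simp
    then have "- 2 * (\<Sum>i\<in>UNIV. (LINT x|lebesgue_on \<Omega>. q i x * pderiv_at i \<phi> x)) \<le>
        (\<Sum>i\<in>UNIV. 2 * (LINT x|lebesgue_on \<Omega>. (q i x)\<^sup>2)) + E \<phi> \<phi> / 2"
      by (simp only: Esq sum.distrib sum_distrib_left sum_divide_distrib)
    moreover have "2 * (a - b) \<le> e + (k + l)" if "2 * a \<le> k + e / 2" "- 2 * b \<le> l + e / 2" for a b e k l :: real
      using that by simp
    ultimately show "2 * F \<phi> \<le> E \<phi> \<phi> + K" unfolding F_def K_def using 1 by blast
  qed blast
  have t: "test_function \<Omega> (\<phi> n)" for n using phi(1) by simp
  have td: "test_function \<Omega> (\<lambda>x. \<phi> i x - \<phi> j x)" for i j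
    using test_function_lin[OF t t, of i "-1" j] by simp
  have pd: "pderiv_at k (\<lambda>x. \<phi> i x - \<phi> j x) x = pderiv_at k (\<phi> i) x - pderiv_at k (\<phi> j) x" for i j k x
    using pderiv_at_lin[OF t t, of k i "-1" j x] by simp
  have part: "(LINT x|lebesgue_on \<Omega>. (pderiv_at k (\<phi> i) x - pderiv_at k (\<phi> j) x)\<^sup>2) \<le> E (\<lambda>x. \<phi> i x - \<phi> j x) (\<lambda>x. \<phi> i x - \<phi> j x)" for i j k
  proof -
    have "(LINT x|lebesgue_on \<Omega>. (pderiv_at k (\<lambda>x. \<phi> i x - \<phi> j x) x)\<^sup>2) \<le> E (\<lambda>x. \<phi> i x - \<phi> j x) (\<lambda>x. \<phi> i x - \<phi> j x)"
      unfolding Esq by (rule member_le_sum) auto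
    then show ?thesis by (simp add: pd)
  qed
  have "\<exists>u. L2_lim \<Omega> (\<lambda>n. pderiv_at k (\<phi> n)) u" for k
  proof (rule L2_complete[OF fin, of "\<lambda>n. pderiv_at k (\<phi> n)"])
    show "L2_on \<Omega> (pderiv_at k (\<phi> n))" for n by (rule L2(2)[OF t])
    fix e :: real assume "e > 0"
    then obtain N where "\<And>i j. i \<ge> N \<Longrightarrow> j \<ge> N \<Longrightarrow> E (\<lambda>x. \<phi> i x - \<phi> j x) (\<lambda>x. \<phi> i x - \<phi> j x) < e"
      using phi(2) by meson
    then show "\<exists>N. \<forall>i\<ge>N. \<forall>j\<ge>N. (LINT x|lebesgue_on \<Omega>. (pderiv_at k (\<phi> i) x - pderiv_at k (\<phi> j) x)\<^sup>2) < e"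
      using part by (meson le_less_trans)
  qed blast
  then obtain vv where vv: "\<And>k. L2_lim \<Omega> (\<lambda>n. pderiv_at k (\<phi> n)) (vv k)" by metis
  obtain w where w: "L2_lim \<Omega> \<phi> w"
  proof (rule L2_complete[OF fin L2(1)[OF t]])
    fix e :: real assume "e > 0"
    then have "e / C > 0" using C(1) by simp
    then obtain N where N: "\<And>i j. i \<ge> N \<Longrightarrow> j \<ge> N \<Longrightarrow> E (\<lambda>x. \<phi> i x - \<phi> j x) (\<lambda>x. \<phi> i x - \<phi> j x) < e / C"
      using phi(2) by meson
    have "(LINT x|lebesgue_on \<Omega>. (\<phi> i x - \<phi> j x)\<^sup>2) < e" if "i \<ge> N" "j \<ge> N" for i j
    proof -
      have "(LINT x|lebesgue_on \<Omega>. (\<phi> i x - \<phi> j x)\<^sup>2) \<le> C * E (\<lambda>x. \<phi> i x - \<phi> j x) (\<lambda>x. \<phi> i x - \<phi> j x)"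
        using C(2)[OF td] by (simp add: Esq)
      also have "\<dots> < e" using N[OF that] C(1) by (simp add: field_simps)
      finally show ?thesis .
    qed
    then show "\<exists>N. \<forall>i\<ge>N. \<forall>j\<ge>N. (LINT x|lebesgue_on \<Omega>. (\<phi> i x - \<phi> j x)\<^sup>2) < e" by blast
  qed blast
  define v where "v x = vec_lambda (\<lambda>i. vv i x)" for x
  have vn: "(\<lambda>x. vec_nth (v x) i) = vv i" for i by (simp add: v_def)
  show ?thesis
  proof (rule that)
    show "test_approx \<Omega> w v \<phi>"
      unfolding test_approx_def vn using t w vv by blast
    fix \<psi> assume psi: "test_function \<Omega> \<psi>"
    have "(\<lambda>n. E (\<phi> n) \<psi>) \<longlonglongrightarrow> (\<Sum>i\<in>UNIV. (LINT x|lebesgue_on \<Omega>. vv i x * pderiv_at i \<psi> x))"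
      unfolding E_def by (intro tendsto_sum L2_lim_mult vv L2(2)[OF psi])
    moreover have "(\<lambda>n. E (\<phi> n) \<psi>) \<longlonglongrightarrow> F \<psi>" using phi(3) psi by simp
    ultimately have "(\<Sum>i\<in>UNIV. (LINT x|lebesgue_on \<Omega>. vv i x * pderiv_at i \<psi> x)) = F \<psi>"
      by (rule LIMSEQ_unique)
    then show "(\<Sum>i\<in>UNIV. (LINT x|lebesgue_on \<Omega>. vec_nth (v x) i * pderiv_at i \<psi> x)) =
      (LINT x|lebesgue_on \<Omega>. f x * \<psi> x) - (\<Sum>i\<in>UNIV. (LINT x|lebesgue_on \<Omega>. q i x * pderiv_at i \<psi> x))"
      by (simp add: F_def v_def)
  qed
qed

text \<open>The equation extends from test functions to $w$, so that $\|\nabla w\|^2 = \int r w$. With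
  $A = \|\nabla w\|^2$, $W = \|w\|^2$ and $R = \|r\|^2$ the inequalities of Cauchy-Schwarz and
  Poincare give $A^2 \le W R \le C A R$, hence $A \le C R$ and $W \le C^2 R$.\<close>

lemma energy_estimate:
  fixes \<Omega> :: "(real ^ 'm::finite) set"
  assumes "open \<Omega>" "C > 0"
    and C: "\<And>\<phi>. test_function \<Omega> \<phi> \<Longrightarrow>
      (LINT x|lebesgue_on \<Omega>. (\<phi> x)\<^sup>2) \<le> C * (\<Sum>i\<in>UNIV. (LINT x|lebesgue_on \<Omega>. (pderiv_at i \<phi> x)\<^sup>2))"
    and approx: "test_approx \<Omega> w v \<phi>" and r: "L2_on \<Omega> r"
    and eq: "\<And>\<psi>. test_function \<Omega> \<psi> \<Longrightarrow>
      (\<Sum>i\<in>UNIV. (LINT x|lebesgue_on \<Omega>. vec_nth (v x) i * pderiv_at i \<psi> x)) = (LINT x|lebesgue_on \<Omega>. r x * \<psi> x)"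
  shows "H1_sq \<Omega> w v \<le> (C\<^sup>2 + C) * (LINT x|lebesgue_on \<Omega>. (r x)\<^sup>2)"
proof -
  define R where "R = (LINT x|lebesgue_on \<Omega>. (r x)\<^sup>2)"
  define W where "W = (LINT x|lebesgue_on \<Omega>. (w x)\<^sup>2)"
  define A where "A = (\<Sum>i\<in>UNIV. (LINT x|lebesgue_on \<Omega>. (vec_nth (v x) i)\<^sup>2))"
  have t: "test_function \<Omega> (\<phi> n)" and lw: "L2_lim \<Omega> \<phi> w"
    and lv: "L2_lim \<Omega> (\<lambda>n. pderiv_at i (\<phi> n)) (\<lambda>x. vec_nth (v x) i)" for n i
    using approx by (auto simp: test_approx_def)
  have L2: "L2_on \<Omega> w" "L2_on \<Omega> (\<lambda>x. vec_nth (v x) i)" for i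
    using lw lv by (auto simp: L2_lim_def)
  have nn: "R \<ge> 0" "W \<ge> 0" "A \<ge> 0" by (auto simp: R_def W_def A_def intro: sum_nonneg)
  have W: "W \<le> C * A"
    unfolding W_def A_def
    by (rule LIMSEQ_le[OF L2_lim_square[OF lw] tendsto_mult[OF tendsto_const tendsto_sum[OF L2_lim_square[OF lv]]]])
      (use C[OF t] in blast)
  have "(\<lambda>n. \<Sum>i\<in>UNIV. (LINT x|lebesgue_on \<Omega>. pderiv_at i (\<phi> n) x * vec_nth (v x) i)) \<longlonglongrightarrow>
      (\<Sum>i\<in>UNIV. (LINT x|lebesgue_on \<Omega>. vec_nth (v x) i * vec_nth (v x) i))"
    by (intro tendsto_sum L2_lim_mult lv L2)
  moreover have "(\<Sum>i\<in>UNIV. (LINT x|lebesgue_on \<Omega>. pderiv_at i (\<phi> n) x * vec_nth (v x) i)) = (LINT x|lebesgue_on \<Omega>. \<phi> n x * r x)" for n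
    using eq[OF t[of n]] by (simp add: mult.commute)
  ultimately have "(\<lambda>n. LINT x|lebesgue_on \<Omega>. \<phi> n x * r x) \<longlonglongrightarrow> A"
    by (simp add: A_def power2_eq_square)
  moreover have "(\<lambda>n. LINT x|lebesgue_on \<Omega>. \<phi> n x * r x) \<longlonglongrightarrow> (LINT x|lebesgue_on \<Omega>. w x * r x)"
    by (rule L2_lim_mult[OF lw r])
  ultimately have "A = (LINT x|lebesgue_on \<Omega>. w x * r x)" by (rule LIMSEQ_unique)
  then have "A\<^sup>2 \<le> W * R"
    using L2_Cauchy_Schwarz[OF L2(1) r] by (simp add: W_def R_def)
  also have "\<dots> \<le> (C * A) * R" using W nn by (intro mult_right_mono)
  finally have "A * A \<le> A * (C * R)" by (simp add: power2_eq_square mult_ac)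
  then have A: "A \<le> C * R"
    using nn assms(2) by (cases "A = 0") auto
  have "W \<le> C * (C * R)" using W mult_left_mono[OF A, of C] assms(2) by linarith
  then have "W + A \<le> (C\<^sup>2 + C) * R"
    using A by (simp add: power2_eq_square algebra_simps)
  then show ?thesis
    by (simp add: H1_sq_def W_def A_def R_def)
qed

section \<open>Network ansatz functions\<close>

text \<open>The input vector is generalized to a $C^k$ function of $x$, so that the induction over the layers
  can feed the output of one layer into the next.\<close>

lemma C_on_eval_layers:
  fixes Y :: "real ^ 'm::finite \<Rightarrow> real Matrix.vec"
  assumes "layers_dims n n' ls" "\<And>x. Y x \<in> carrier_vec n"
    and "\<And>j. j < n \<Longrightarrow> C_on k UNIV (\<lambda>x. vec_index (Y x) j)" and "j < n'"
  shows "C_on k UNIV (\<lambda>x. vec_index (eval_layers ls (Y x)) j)"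
  using assms
proof (induction ls arbitrary: n Y)
  case (Cons a ls)
  obtain W b where a: "a = (W, b)" by (cases a)
  have affine: "C_on k UNIV (\<lambda>x. vec_index (W *\<^sub>v Y x + b) i)"
    if "W \<in> carrier_mat m n" "b \<in> carrier_vec m" "i < m" for m i
  proof -
    have "vec_index (W *\<^sub>v Y x + b) i = (\<Sum>l\<in>{0..<n}. W $$ (i, l) * vec_index (Y x) l) + vec_index b i" for x
      using that Cons.prems(2)[of x] by (simp add: scalar_prod_def)
    then show ?thesis
      using Cons.prems(3) by (auto intro!: C_on_add C_on_sum C_on_mult C_on_const)
  qed
  show ?case
  proof (cases ls)
    case Nil
    then have "W \<in> carrier_mat n' n" "b \<in> carrier_vec n'"
      using Cons.prems(1) a by auto
    from affine[OF this Cons.prems(4)] show ?thesis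
      by (simp only: a Nil eval_layers.simps)
  next
    case (Cons l ls')
    obtain m where m: "W \<in> carrier_mat m n" "b \<in> carrier_vec m" "layers_dims m n' ls"
      using Cons.prems(1) a Cons by auto
    have "C_on k UNIV (\<lambda>x. vec_index (eval_layers ls (map_vec tanh (W *\<^sub>v Y x + b))) j)"
    proof (rule Cons.IH[OF m(3) _ _ Cons.prems(4)])
      show "map_vec tanh (W *\<^sub>v Y x + b) \<in> carrier_vec m" for x
        using mult_mat_vec_carrier[OF m(1) Cons.prems(2)] m(2) by auto
      show "C_on k UNIV (\<lambda>x. vec_index (map_vec tanh (W *\<^sub>v Y x + b)) i)" if "i < m" for i
        using C_on_tanh[OF open_UNIV affine[OF m(1,2) that]] m(2) that by simp
    qed
    then show ?thesis using a Cons by simp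
  qed
qed simp

lemma neural_network_C_on:
  assumes "neural_network (u :: real ^ 'm::finite \<Rightarrow> real)"
  shows "C_on k UNIV u"
proof -
  obtain ls where ls: "layers_dims CARD('m) 1 ls" "\<And>x. u x = vec_index (eval_layers ls (coord_vec x)) 0"
    using assms by (auto simp: neural_network_def)
  have "C_on k UNIV (\<lambda>x :: real ^ 'm. vec_index (eval_layers ls (coord_vec x)) 0)"
    by (rule C_on_eval_layers[OF ls(1)]) (auto simp: coord_vec_def intro: C_on_coord)
  also have "(\<lambda>x. vec_index (eval_layers ls (coord_vec x)) 0) = u"
    using ls(2) by auto
  finally show ?thesis .
qed

lemma neural_network_0: "neural_network (\<lambda>x :: real ^ 'm::finite. 0)"
  unfolding neural_network_def
  by (intro exI[of _ "[(0\<^sub>m 1 CARD('m), 0\<^sub>v 1)]"]) (simp add: coord_vec_def scalar_prod_def)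

lemma continuous_closure_bounded:
  fixes h :: "'a::euclidean_space \<Rightarrow> real"
  assumes "bounded \<Omega>" "continuous_on (closure \<Omega>) h"
  obtains B where "\<And>x. x \<in> \<Omega> \<Longrightarrow> \<bar>h x\<bar> \<le> B"
proof -
  have "bounded (h ` closure \<Omega>)"
    using assms by (intro compact_imp_bounded compact_continuous_image) auto
  then obtain B where "\<And>x. x \<in> closure \<Omega> \<Longrightarrow> \<bar>h x\<bar> \<le> B"
    unfolding bounded_iff by auto
  then show ?thesis using that closure_subset[of \<Omega>] by (meson subsetD)
qed

lemma C_closure_bounded:
  assumes "bounded \<Omega>" "C_closure k \<Omega> h" "length is \<le> k"
  obtains B where "\<And>x. x \<in> \<Omega> \<Longrightarrow> \<bar>pderivs is h x\<bar> \<le> B"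
proof -
  obtain F where F: "continuous_on (closure \<Omega>) F" "\<And>x. x \<in> \<Omega> \<Longrightarrow> F x = pderivs is h x"
    using assms unfolding C_closure_def by metis
  obtain B where "\<And>x. x \<in> \<Omega> \<Longrightarrow> \<bar>F x\<bar> \<le> B"
    using continuous_closure_bounded[OF assms(1) F(1)] by blast
  then have "\<And>x. x \<in> \<Omega> \<Longrightarrow> \<bar>pderivs is h x\<bar> \<le> B" using F(2) by simp
  then show ?thesis by (rule that)
qed

lemma C_on_nn_ansatz:
  assumes "open \<Omega>" "C_on k \<Omega> d" "C_on k \<Omega> g" "nn_ansatz \<Omega> d g u"
  shows "C_on k \<Omega> u"
proof -
  obtain n where n: "neural_network n" "\<And>x. x \<in> \<Omega> \<Longrightarrow> u x = d x * n x + g x"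
    using assms(4) closure_subset[of \<Omega>] unfolding nn_ansatz_def by blast
  have "C_on k \<Omega> n" using C_on_subset[OF neural_network_C_on[OF n(1)]] by simp
  then have "C_on k \<Omega> (\<lambda>x. d x * n x + g x)"
    by (intro C_on_add C_on_mult assms)
  then show ?thesis
    by (rule C_on_cong[OF assms(1), rotated]) (simp add: n(2))
qed

text \<open>On $\Omega$ the difference $u - g$ is the product of $d$ and a network. Both factors and
  their first derivatives are bounded, since they extend continuously to the compact closure.\<close>

lemma test_approx_nn_ansatz:
  fixes \<Omega> :: "(real ^ 'm::finite) set"
  assumes "open \<Omega>" "bounded \<Omega>" and d: "C_closure 1 \<Omega> d" and g: "C_on 1 \<Omega> g"
    and "\<And>x. x \<in> frontier \<Omega> \<Longrightarrow> d x = 0" "\<And>x. x \<in> \<Omega> \<Longrightarrow> d x \<noteq> 0"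
    and "nn_ansatz \<Omega> d g u"
  obtains \<phi> where "test_approx \<Omega> (\<lambda>x. u x - g x) (\<lambda>x. grad u x - grad g x) \<phi>"
proof -
  obtain n where n: "neural_network n" "\<And>x. x \<in> \<Omega> \<Longrightarrow> u x = d x * n x + g x"
    using assms(7) closure_subset[of \<Omega>] unfolding nn_ansatz_def by blast
  have d1: "C_on 1 \<Omega> d" and dc: "continuous_on (closure \<Omega>) d"
    using d by (auto simp: C_closure_def)
  have nC: "C_on 1 \<Omega> n" using C_on_subset[OF neural_network_C_on[OF n(1)]] by simp
  obtain B1 where B1: "\<And>x. x \<in> \<Omega> \<Longrightarrow> \<bar>d x\<bar> \<le> B1"
    using C_closure_bounded[OF assms(2) d, of "[]"] by auto
  have "\<exists>B. \<forall>x\<in>\<Omega>. \<bar>pderiv_at i d x\<bar> \<le> B" for i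
    using C_closure_bounded[OF assms(2) d, of "[i]"] by (simp add: pderivs_Cons) metis
  then obtain B2 where B2: "\<And>i x. x \<in> \<Omega> \<Longrightarrow> \<bar>pderiv_at i d x\<bar> \<le> B2 i" by metis
  have n1: "C_on 1 UNIV n" by (rule neural_network_C_on[OF n(1)])
  have cn: "continuous_on (closure \<Omega>) n" "continuous_on (closure \<Omega>) (pderiv_at i n)" for i
    by (rule continuous_on_subset[OF _ subset_UNIV]; use n1 in \<open>simp add: C_on_Suc C_on_0\<close>)+
  obtain B3 where B3: "\<And>x. x \<in> \<Omega> \<Longrightarrow> \<bar>n x\<bar> \<le> B3"
    using continuous_closure_bounded[OF assms(2) cn(1)] by blast
  have "\<exists>B. \<forall>x\<in>\<Omega>. \<bar>pderiv_at i n x\<bar> \<le> B" for i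
    using continuous_closure_bounded[OF assms(2) cn(2)[of i]] by metis
  then obtain B4 where B4: "\<And>i x. x \<in> \<Omega> \<Longrightarrow> \<bar>pderiv_at i n x\<bar> \<le> B4 i" by metis
  define B where "B = Max ({B1, B3} \<union> range B2 \<union> range B4)"
  have B: "B1 \<le> B" "B3 \<le> B" "B2 i \<le> B" "B4 i \<le> B" for i
    unfolding B_def by (intro Max_ge; simp)+
  obtain \<phi> where "test_approx \<Omega> (\<lambda>x. d x * n x) (grad (\<lambda>x. d x * n x)) \<phi>"
  proof (rule test_approx_vanishing_on_boundary[OF assms(1,2) d1 dc assms(5,6) nC, of B])
    show "\<bar>d x\<bar> \<le> B" if "x \<in> \<Omega>" for x using B1[OF that] B(1) by linarith
    show "\<bar>n x\<bar> \<le> B" if "x \<in> \<Omega>" for x using B3[OF that] B(2) by linarith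
    show "\<bar>pderiv_at i d x\<bar> \<le> B" if "x \<in> \<Omega>" for x i using B2[OF that, of i] B(3)[of i] by linarith
    show "\<bar>pderiv_at i n x\<bar> \<le> B" if "x \<in> \<Omega>" for x i using B4[OF that, of i] B(4)[of i] by linarith
  qed
  then have "test_approx \<Omega> (\<lambda>x. u x - g x) (\<lambda>x. grad u x - grad g x) \<phi>"
  proof (rule test_approx_cong[rotated 2])
    fix x assume x: "x \<in> \<Omega>"
    show "d x * n x = u x - g x" using n(2)[OF x] by simp
    have z: "(\<lambda>x. d x * n x) differentiable (at x)" "g differentiable (at x)"
      using C_on_mult[OF assms(1) d1 nC] g x by (auto simp: C_on_Suc)
    have "pderiv_at i u x = pderiv_at i (\<lambda>x. d x * n x) x + pderiv_at i g x" for i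
      using pderiv_at_cong[of \<Omega> x u "\<lambda>x. d x * n x + g x" i] assms(1) x n(2) pderiv_at_add[OF z] by simp
    then show "grad (\<lambda>x. d x * n x) x = grad u x - grad g x"
      by (simp add: Finite_Cartesian_Product.vec_eq_iff)
  qed
  then show ?thesis by (rule that)
qed

section \<open>The loss controls the residual in $L^2$\<close>

text \<open>Where $t^2 > s$, the factor $(t^2 / s)^{q/2 - 1}$ is at least $1$. The split at the level $s$
  replaces Jensen's inequality.\<close>

lemma square_le_powr:
  fixes t s q :: real
  assumes "s > 0" "q \<ge> 2"
  shows "t\<^sup>2 \<le> s + s powr (1 - q / 2) * \<bar>t\<bar> powr q"
proof (cases "t\<^sup>2 \<le> s")
  case True
  moreover have "0 \<le> s powr (1 - q / 2) * \<bar>t\<bar> powr q" by simp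
  ultimately show ?thesis by linarith
next
  case False
  then have t: "\<bar>t\<bar> > 0" using assms(1) by auto
  have "\<bar>t\<bar> powr q = (\<bar>t\<bar> powr 2) powr (q / 2)" unfolding powr_powr by simp
  also have "\<bar>t\<bar> powr 2 = t\<^sup>2" using t by (simp flip: powr_realpow)
  also have "(t\<^sup>2) powr (q / 2) = t\<^sup>2 * (t\<^sup>2) powr (q / 2 - 1)"
    using t by (simp add: powr_diff)
  finally have eq: "\<bar>t\<bar> powr q = t\<^sup>2 * (t\<^sup>2) powr (q / 2 - 1)" .
  have "1 = s powr (1 - q / 2) * s powr (q / 2 - 1)"
    using assms(1) by (simp flip: powr_add)
  also have "\<dots> \<le> s powr (1 - q / 2) * (t\<^sup>2) powr (q / 2 - 1)"
    using False assms by (intro mult_left_mono powr_mono2) auto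
  finally have "t\<^sup>2 * 1 \<le> t\<^sup>2 * (s powr (1 - q / 2) * (t\<^sup>2) powr (q / 2 - 1))"
    by (intro mult_left_mono) auto
  then show ?thesis using assms(1) unfolding eq by (simp add: mult_ac)
qed

text \<open>For $p = \infty$ the residual is bounded by $\delta$ almost everywhere. For finite $p$ the pointwise
  inequality $r^2 \le s + s^{1 - p/2} |r|^p$ is integrated, with $s$ chosen so that the first term
  contributes half of $\eta$, and $\delta$ so that the second one contributes the other half.\<close>

lemma poisson_loss_controls_L2:
  fixes \<Omega> :: "(real ^ 'm::finite) set"
  assumes "open \<Omega>" "bounded \<Omega>" "\<Omega> \<noteq> {}" "2 \<le> p" "\<eta> > 0"
  obtains \<delta> where "\<delta> > 0" "\<And>u. (\<lambda>x. - laplacian u x - f x) \<in> borel_measurable (lebesgue_on \<Omega>) \<Longrightarrow>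
    poisson_loss \<Omega> f p u < ennreal \<delta> \<Longrightarrow>
    L2_on \<Omega> (\<lambda>x. - laplacian u x - f x) \<and> (LINT x|lebesgue_on \<Omega>. (- laplacian u x - f x)\<^sup>2) \<le> \<eta>"
proof -
  let ?M = "lebesgue_on \<Omega>"
  define \<mu> where "\<mu> = measure ?M (space ?M)"
  interpret finite_measure ?M by (rule finite_measure_lebesgue_on_bounded[OF assms(1,2)])
  have em: "emeasure ?M (space ?M) = ennreal \<mu>" by (simp add: \<mu>_def emeasure_eq_measure)
  have em': "emeasure lebesgue \<Omega> = ennreal \<mu>"
    using em assms(1) by (simp add: emeasure_restrict_space space_restrict_space)
  have "\<mu> \<noteq> 0"
  proof
    assume "\<mu> = 0"
    then have "\<Omega> \<in> null_sets lebesgue" using em' assms(1) by auto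
    then show False using open_not_negligible[OF assms(1,3)] by (simp add: negligible_iff_null_sets)
  qed
  then have mu: "\<mu> > 0" using measure_nonneg[of ?M "space ?M"] by (simp add: \<mu>_def less_le)
  have concl: "L2_on \<Omega> r \<and> (LINT x|?M. (r x)\<^sup>2) \<le> \<eta>"
    if "r \<in> borel_measurable ?M" "(\<integral>\<^sup>+ x. ennreal ((r x)\<^sup>2) \<partial>?M) \<le> ennreal \<eta>" for r
  proof
    show "L2_on \<Omega> r" unfolding L2_on_def
      using that by (auto intro!: integrableI_bounded simp: le_less_trans)
    show "(LINT x|?M. (r x)\<^sup>2) \<le> \<eta>"
      using that assms(5) by (intro integral_real_bounded) auto
  qed
  show ?thesis
  proof (cases "p = \<infinity>")
    case True
    define \<delta> where "\<delta> = sqrt (\<eta> / \<mu>)"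
    have d: "\<delta> > 0" "\<delta>\<^sup>2 = \<eta> / \<mu>" using mu assms(5) by (auto simp: \<delta>_def)
    show ?thesis
    proof (rule that[OF d(1)], rule concl)
      fix u assume meas: "(\<lambda>x. - laplacian u x - f x) \<in> borel_measurable ?M"
        and loss: "poisson_loss \<Omega> f p u < ennreal \<delta>"
      let ?r = "\<lambda>x. - laplacian u x - f x"
      have "AE x in ?M. ennreal \<bar>?r x\<bar> \<le> esssup ?M (\<lambda>x. ennreal \<bar>?r x\<bar>)"
        by (rule esssup_AE)
      then have "AE x in ?M. ennreal ((?r x)\<^sup>2) \<le> ennreal (\<eta> / \<mu>)"
      proof eventually_elim
        fix x assume "ennreal \<bar>?r x\<bar> \<le> esssup ?M (\<lambda>x. ennreal \<bar>?r x\<bar>)"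
        then have "ennreal \<bar>?r x\<bar> < ennreal \<delta>"
          using loss True by (simp add: poisson_loss_def)
        then have "\<bar>?r x\<bar> \<le> \<delta>" by (simp add: ennreal_less_iff)
        then have "(?r x)\<^sup>2 \<le> \<eta> / \<mu>" using power_mono[of "\<bar>?r x\<bar>" \<delta> 2] d(2) by simp
        then show "ennreal ((?r x)\<^sup>2) \<le> ennreal (\<eta> / \<mu>)" by (rule ennreal_leI)
      qed
      then have "(\<integral>\<^sup>+ x. ennreal ((?r x)\<^sup>2) \<partial>?M) \<le> (\<integral>\<^sup>+ x. ennreal (\<eta> / \<mu>) \<partial>?M)"
        by (rule nn_integral_mono_AE)
      also have "\<dots> = ennreal \<eta>"
        using mu assms(5) em by (simp add: ennreal_mult''[symmetric])
      finally show "(\<integral>\<^sup>+ x. ennreal ((?r x)\<^sup>2) \<partial>?M) \<le> ennreal \<eta>" .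
    qed
  next
    case False
    define q where "q = enn2real p"
    have "ennreal q = p" using False by (simp add: q_def ennreal_enn2real_if)
    then have "ennreal 2 \<le> ennreal q" using assms(4) by simp
    then have q: "q \<ge> 2" by (subst (asm) ennreal_le_iff) (simp_all add: q_def)
    define s where "s = \<eta> / (2 * \<mu>)"
    define c where "c = s powr (1 - q / 2)"
    define \<delta> where "\<delta> = \<eta> / (2 * \<mu> * c)"
    have s: "s > 0" using mu assms(5) by (simp add: s_def)
    then have c: "c > 0" by (simp add: c_def)
    have d: "\<delta> > 0" using mu c assms(5) by (simp add: \<delta>_def)
    show ?thesis
    proof (rule that[OF d], rule concl)
      fix u assume meas: "(\<lambda>x. - laplacian u x - f x) \<in> borel_measurable ?M"
        and loss: "poisson_loss \<Omega> f p u < ennreal \<delta>"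
      let ?r = "\<lambda>x. - laplacian u x - f x"
      have [measurable]: "?r \<in> borel_measurable ?M" by fact
      have "(\<integral>\<^sup>+ x. ennreal (\<bar>?r x\<bar> powr q) \<partial>?M) / ennreal \<mu> < ennreal \<delta>"
        using loss False by (simp add: poisson_loss_def q_def em')
      then have le: "(\<integral>\<^sup>+ x. ennreal (\<bar>?r x\<bar> powr q) \<partial>?M) \<le> ennreal (\<delta> * \<mu>)"
        using mu d by (simp add: divide_less_ennreal ennreal_mult less_imp_le)
      have "(\<integral>\<^sup>+ x. ennreal ((?r x)\<^sup>2) \<partial>?M) \<le> (\<integral>\<^sup>+ x. ennreal s + ennreal c * ennreal (\<bar>?r x\<bar> powr q) \<partial>?M)"
      proof (rule nn_integral_mono)
        fix x
        have "ennreal ((?r x)\<^sup>2) \<le> ennreal (s + c * \<bar>?r x\<bar> powr q)"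
          unfolding c_def by (intro ennreal_leI square_le_powr s q)
        then show "ennreal ((?r x)\<^sup>2) \<le> ennreal s + ennreal c * ennreal (\<bar>?r x\<bar> powr q)"
          using s c by (simp add: ennreal_plus ennreal_mult)
      qed
      also have "\<dots> = ennreal s * ennreal \<mu> + ennreal c * (\<integral>\<^sup>+ x. ennreal (\<bar>?r x\<bar> powr q) \<partial>?M)"
        using em' assms(1) by (simp add: nn_integral_add nn_integral_cmult emeasure_restrict_space)
      also have "\<dots> \<le> ennreal s * ennreal \<mu> + ennreal c * ennreal (\<delta> * \<mu>)"
        by (intro add_left_mono mult_left_mono le) simp
      also have "\<dots> = ennreal (s * \<mu> + c * (\<delta> * \<mu>))"
        using s c d mu by (simp add: ennreal_mult)
      also have "s * \<mu> + c * (\<delta> * \<mu>) = \<eta>"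
        using mu c by (simp add: s_def \<delta>_def field_simps)
      finally show "(\<integral>\<^sup>+ x. ennreal ((?r x)\<^sup>2) \<partial>?M) \<le> ennreal \<eta>" .
    qed
  qed
qed

section \<open>Stability and the main estimate\<close>

text \<open>Integration by parts for each first derivative of $u$. The compact support of $\phi$ keeps the
  integrals finite even if the second derivatives of $u$ grow towards the boundary.\<close>

lemma integral_grad_eq_laplacian:
  fixes u :: "real ^ 'm::finite \<Rightarrow> real"
  assumes "open \<Omega>" and u: "C_on 2 \<Omega> u" and phi: "test_function \<Omega> \<phi>"
  shows "(\<Sum>i\<in>UNIV. (LINT x|lebesgue_on \<Omega>. pderiv_at i u x * pderiv_at i \<phi> x)) =
    (LINT x|lebesgue_on \<Omega>. - laplacian u x * \<phi> x)"
proof -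
  note t = test_functionD[OF phi]
  have u2: "C_on 1 \<Omega> (pderiv_at i u)" for i
    using u by (simp add: C_on_Suc numeral_2_eq_2)
  then have cont: "continuous_on \<Omega> (pderiv_at i (pderiv_at i u))" for i
    by (simp add: C_on_Suc C_on_0)
  have lap: "laplacian u x = (\<Sum>i\<in>UNIV. pderiv_at i (pderiv_at i u) x)" for x
    by (simp add: laplacian_def pderivs_Cons)
  have "(\<Sum>i\<in>UNIV. (LINT x|lebesgue_on \<Omega>. pderiv_at i u x * pderiv_at i \<phi> x)) =
      (\<Sum>i\<in>UNIV. - (LINT x|lebesgue_on \<Omega>. pderiv_at i (pderiv_at i u) x * \<phi> x))"
    by (intro sum.cong refl integration_by_parts assms(1) u2 t(1,4))
  also have "\<dots> = - (LINT x|lebesgue_on \<Omega>. (\<Sum>i\<in>UNIV. pderiv_at i (pderiv_at i u) x * \<phi> x))"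
    by (subst Bochner_Integration.integral_sum)
      (auto simp: sum_negf intro!: integrable_mult_compact_support assms(1) cont t(2,4))
  also have "\<dots> = (LINT x|lebesgue_on \<Omega>. - laplacian u x * \<phi> x)"
    by (simp add: lap sum_distrib_right)
  finally show ?thesis .
qed

text \<open>The energy estimate for the difference of two weak solutions with right-hand sides $h$ and
  $h'$. With $h = h'$ it gives uniqueness, and with $h = - \Delta u$ the bound by the residual.\<close>

lemma poisson_error_estimate:
  fixes \<Omega> :: "(real ^ 'm::finite) set"
  assumes "open \<Omega>" "C > 0"
    and C: "\<And>\<phi>. test_function \<Omega> \<phi> \<Longrightarrow>
      (LINT x|lebesgue_on \<Omega>. (\<phi> x)\<^sup>2) \<le> C * (\<Sum>i\<in>UNIV. (LINT x|lebesgue_on \<Omega>. (pderiv_at i \<phi> x)\<^sup>2))"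
    and approx: "test_approx \<Omega> (\<lambda>x. u x - u' x) (\<lambda>x. G x - G' x) \<phi>"
    and L2: "\<And>i. L2_on \<Omega> (\<lambda>x. vec_nth (G' x) i)" "L2_on \<Omega> h" "L2_on \<Omega> h'"
    and eq: "\<And>\<psi>. test_function \<Omega> \<psi> \<Longrightarrow>
      (\<Sum>i\<in>UNIV. (LINT x|lebesgue_on \<Omega>. vec_nth (G x) i * pderiv_at i \<psi> x)) = (LINT x|lebesgue_on \<Omega>. h x * \<psi> x)"
    and eq': "\<And>\<psi>. test_function \<Omega> \<psi> \<Longrightarrow>
      (\<Sum>i\<in>UNIV. (LINT x|lebesgue_on \<Omega>. vec_nth (G' x) i * pderiv_at i \<psi> x)) = (LINT x|lebesgue_on \<Omega>. h' x * \<psi> x)"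
  shows "H1_sq \<Omega> (\<lambda>x. u x - u' x) (\<lambda>x. G x - G' x) \<le> (C\<^sup>2 + C) * (LINT x|lebesgue_on \<Omega>. (h x - h' x)\<^sup>2)"
proof (rule energy_estimate[OF assms(1,2) C approx L2_on_diff[OF L2(2,3)]])
  fix \<psi> assume psi: "test_function \<Omega> \<psi>"
  note p = L2_on_test_function[OF assms(1) psi]
  have GG': "L2_on \<Omega> (\<lambda>x. vec_nth (G x - G' x) i)" for i
    using approx by (simp add: test_approx_def L2_lim_def)
  have "L2_on \<Omega> (\<lambda>x. vec_nth (G x) i)" for i
    using L2_on_add[OF GG'[of i] L2(1)[of i]] by simp
  then have "(\<Sum>i\<in>UNIV. (LINT x|lebesgue_on \<Omega>. vec_nth (G x - G' x) i * pderiv_at i \<psi> x)) =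
      (\<Sum>i\<in>UNIV. (LINT x|lebesgue_on \<Omega>. vec_nth (G x) i * pderiv_at i \<psi> x)) -
      (\<Sum>i\<in>UNIV. (LINT x|lebesgue_on \<Omega>. vec_nth (G' x) i * pderiv_at i \<psi> x))"
    using L2_on_mult_integrable[OF _ p(2)] L2(1) by (simp add: left_diff_distrib sum_subtractf)
  also have "\<dots> = (LINT x|lebesgue_on \<Omega>. (h x - h' x) * \<psi> x)"
    using L2_on_mult_integrable[OF L2(2) p(1)] L2_on_mult_integrable[OF L2(3) p(1)]
    by (simp add: eq[OF psi] eq'[OF psi] left_diff_distrib)
  finally show "(\<Sum>i\<in>UNIV. (LINT x|lebesgue_on \<Omega>. vec_nth (G x - G' x) i * pderiv_at i \<psi> x)) =
      (LINT x|lebesgue_on \<Omega>. (h x - h' x) * \<psi> x)" .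
qed

theorem theorem3p4:
  fixes \<Omega> :: "(real ^ 'm::finite) set"
    and f g d :: "real ^ 'm \<Rightarrow> real"
    and \<alpha> :: real
  assumes "0 < \<alpha>" and "\<alpha> < 1"
    and "open \<Omega>" and "connected \<Omega>" and "\<Omega> \<noteq> {}" and "bounded \<Omega>"
    and "C_hoelder_boundary 2 \<alpha> \<Omega>"
    and "C_hoelder 2 \<alpha> \<Omega> g"
    and "C_hoelder 0 \<alpha> \<Omega> f"
    and "C_closure 2 \<Omega> d"
    and "\<forall>x\<in>frontier \<Omega>. d x = 0"
    and "\<forall>x\<in>\<Omega>. d x \<noteq> 0"
  shows "\<exists>u_hat. poisson_solution \<Omega> f g u_hat \<and>
     (\<forall>v. poisson_solution \<Omega> f g v \<longrightarrow> (AE x in lebesgue_on \<Omega>. v x = u_hat x)) \<and>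
     (\<forall>p::ennreal. 2 \<le> p \<longrightarrow>
        (\<exists>u. H1 \<Omega> u \<and> nn_ansatz \<Omega> d g u \<and>
           (\<forall>\<epsilon>>0. \<exists>\<delta>>0. poisson_loss \<Omega> f p u < ennreal \<delta> \<longrightarrow>
              H1_norm \<Omega> (\<lambda>x. u x - u_hat x) < \<epsilon>)) \<and>
        (\<forall>\<epsilon>>0. \<exists>\<delta>>0. \<forall>u. H1 \<Omega> u \<longrightarrow> nn_ansatz \<Omega> d g u \<longrightarrow>
           poisson_loss \<Omega> f p u < ennreal \<delta> \<longrightarrow>
              H1_norm \<Omega> (\<lambda>x. u x - u_hat x) < \<epsilon>))"
proof -
  note open_\<Omega> = \<open>open \<Omega>\<close> and bounded_\<Omega> = \<open>bounded \<Omega>\<close>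
  note fin = finite_measure_lebesgue_on_bounded[OF open_\<Omega> bounded_\<Omega>]
  have g: "C_closure 2 \<Omega> g" and f: "C_closure 0 \<Omega> f"
    using assms(8,9) by (auto simp: C_hoelder_def)
  have d: "C_closure 1 \<Omega> d"
    using assms(10) C_on_mono[of 2 \<Omega> d 1] by (auto simp: C_closure_def)
  have g2: "C_on 2 \<Omega> g" and d2: "C_on 2 \<Omega> d" and fc: "continuous_on \<Omega> f"
    using g assms(10) f by (auto simp: C_closure_def C_on_0)
  have g1: "C_on 1 \<Omega> g" using g2 by (rule C_on_mono) simp
  obtain Bf where Bf: "\<And>x. x \<in> \<Omega> \<Longrightarrow> \<bar>f x\<bar> \<le> Bf"
    using C_closure_bounded[OF bounded_\<Omega> f, of "[]"] by auto
  have L2f: "L2_on \<Omega> f"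
    by (rule L2_on_continuous_bounded[OF open_\<Omega> fin fc Bf])
  obtain Bg where Bg: "\<And>x. x \<in> \<Omega> \<Longrightarrow> \<bar>g x\<bar> \<le> Bg"
    using C_closure_bounded[OF bounded_\<Omega> g, of "[]"] by auto
  have L2g: "L2_on \<Omega> g"
    by (rule L2_on_continuous_bounded[OF open_\<Omega> fin C_on_continuous[OF g2] Bg])
  have L2dg: "L2_on \<Omega> (pderiv_at i g)" for i
  proof -
    obtain B where "\<And>x. x \<in> \<Omega> \<Longrightarrow> \<bar>pderivs [i] g x\<bar> \<le> B"
      using C_closure_bounded[OF bounded_\<Omega> g, of "[i]"] by auto
    then show ?thesis
      using g1 by (intro L2_on_continuous_bounded[OF open_\<Omega> fin]) (auto simp: pderivs_Cons C_on_Suc C_on_0)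
  qed
  have wg: "has_weak_gradient \<Omega> g (grad g)"
    by (rule has_weak_gradient_grad[OF open_\<Omega> g1 L2dg])
  obtain C where C: "C > 0" "\<And>\<phi>. test_function \<Omega> \<phi> \<Longrightarrow>
    (LINT x|lebesgue_on \<Omega>. (\<phi> x)\<^sup>2) \<le> C * (\<Sum>i\<in>UNIV. (LINT x|lebesgue_on \<Omega>. (pderiv_at i \<phi> x)\<^sup>2))"
    using poincare_inequality[OF open_\<Omega> bounded_\<Omega>] by blast
  obtain w v \<phi> where w: "test_approx \<Omega> w v \<phi>"
    and weq: "\<And>\<psi>. test_function \<Omega> \<psi> \<Longrightarrow> (\<Sum>i\<in>UNIV. (LINT x|lebesgue_on \<Omega>. vec_nth (v x) i * pderiv_at i \<psi> x)) =
      (LINT x|lebesgue_on \<Omega>. f x * \<psi> x) - (\<Sum>i\<in>UNIV. (LINT x|lebesgue_on \<Omega>. pderiv_at i g x * pderiv_at i \<psi> x))"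
    by (rule weak_dirichlet_problem_solvable[where q = "\<lambda>i. pderiv_at i g", OF open_\<Omega> bounded_\<Omega> L2f L2dg]) blast
  have L2w: "L2_on \<Omega> w" and L2v: "\<And>i. L2_on \<Omega> (\<lambda>x. vec_nth (v x) i)"
    using w by (auto simp: test_approx_def L2_lim_def)
  have wv: "has_weak_gradient \<Omega> w v" by (rule test_approx_has_weak_gradient[OF open_\<Omega> w])
  define u_hat where "u_hat x = w x + g x" for x
  define G_hat where "G_hat x = v x + grad g x" for x
  have L2u: "L2_on \<Omega> u_hat" unfolding u_hat_def[abs_def] by (intro L2_on_add L2w L2g)
  have L2G: "L2_on \<Omega> (\<lambda>x. vec_nth (G_hat x) i)" for i
    using L2_on_add[OF L2v L2dg] by (simp add: G_hat_def)
  have wu: "has_weak_gradient \<Omega> u_hat G_hat"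
    using has_weak_gradient_lin[OF open_\<Omega> L2w L2g wv wg, of 1] by (simp add: u_hat_def[abs_def] G_hat_def[abs_def])
  have G_eq: "(\<Sum>i\<in>UNIV. (LINT x|lebesgue_on \<Omega>. vec_nth (G_hat x) i * pderiv_at i \<psi> x)) =
      (LINT x|lebesgue_on \<Omega>. f x * \<psi> x)" if "test_function \<Omega> \<psi>" for \<psi>
    using L2_on_mult_integrable[OF L2v L2_on_test_function(2)[OF open_\<Omega> that]]
      L2_on_mult_integrable[OF L2dg L2_on_test_function(2)[OF open_\<Omega> that]] weq[OF that]
    by (simp add: G_hat_def distrib_right sum.distrib)
  have sol: "poisson_solution \<Omega> f g u_hat"
    unfolding poisson_solution_def
  proof (intro conjI allI impI)
    show "H1 \<Omega> u_hat" using L2u wu by (auto simp: H1_def)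
    show "(LINT x|lebesgue_on \<Omega>. (\<Sum>i\<in>UNIV. vec_nth (weak_gradient \<Omega> u_hat x) i * pderiv_at i \<psi> x)) =
        (LINT x|lebesgue_on \<Omega>. f x * \<psi> x)" if "test_function \<Omega> \<psi>" for \<psi>
      unfolding integral_weak_gradient_cong[OF open_\<Omega> fin wu that] by (rule G_eq[OF that])
    show "H1_0 \<Omega> (\<lambda>x. u_hat x - g x)"
      using H1_0_I[OF open_\<Omega> fin w] by (simp add: u_hat_def)
  qed
  have minus_u_hat: "test_approx \<Omega> (\<lambda>x. u x - u_hat x) (\<lambda>x. G x - G_hat x) (\<lambda>n x. \<phi>' n x - \<phi> n x)"
    if "test_approx \<Omega> (\<lambda>x. u x - g x) (\<lambda>x. G x - grad g x) \<phi>'" for u G \<phi>'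
    by (rule test_approx_cong[OF _ _ test_approx_diff[OF that w]]) (simp_all add: u_hat_def G_hat_def)
  have unique: "AE x in lebesgue_on \<Omega>. u x = u_hat x" if u: "poisson_solution \<Omega> f g u" for u
  proof -
    have L2u': "L2_on \<Omega> u" using u by (simp add: poisson_solution_def H1_def)
    obtain G where G: "has_weak_gradient \<Omega> u G" using u by (auto simp: poisson_solution_def H1_def)
    have wG: "has_weak_gradient \<Omega> (\<lambda>x. u x - g x) (\<lambda>x. G x - grad g x)"
      using has_weak_gradient_lin[OF open_\<Omega> L2u' L2g G wg, of "-1"] by simp
    have "H1_0 \<Omega> (\<lambda>x. u x - g x)" using u by (simp add: poisson_solution_def)
    then obtain \<phi>' where "test_approx \<Omega> (\<lambda>x. u x - g x) (\<lambda>x. G x - grad g x) \<phi>'"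
      using H1_0_E[OF open_\<Omega> fin _ wG] by blast
    note approx = minus_u_hat[OF this]
    have "H1_sq \<Omega> (\<lambda>x. u x - u_hat x) (\<lambda>x. G x - G_hat x) \<le> (C\<^sup>2 + C) * (LINT x|lebesgue_on \<Omega>. (f x - f x)\<^sup>2)"
    proof (rule poisson_error_estimate[OF open_\<Omega> C approx L2G L2f L2f _ G_eq])
      fix \<psi> assume psi: "test_function \<Omega> \<psi>"
      then show "(\<Sum>i\<in>UNIV. (LINT x|lebesgue_on \<Omega>. vec_nth (G x) i * pderiv_at i \<psi> x)) = (LINT x|lebesgue_on \<Omega>. f x * \<psi> x)"
        using u integral_weak_gradient_cong[OF open_\<Omega> fin G psi] by (simp add: poisson_solution_def)
    qed
    moreover have "0 \<le> (\<Sum>i\<in>UNIV. (LINT x|lebesgue_on \<Omega>. (vec_nth (G x - G_hat x) i)\<^sup>2))"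
      by (intro sum_nonneg) simp
    ultimately have le: "(LINT x|lebesgue_on \<Omega>. (u x - u_hat x)\<^sup>2) \<le> 0"
      unfolding H1_sq_def by simp
    have "integrable (lebesgue_on \<Omega>) (\<lambda>x. (u x - u_hat x)\<^sup>2)"
      using L2_on_diff[OF L2u' L2u] by (simp add: L2_on_def)
    from integral_nonneg_eq_0_iff_AE[OF this] le
    have "AE x in lebesgue_on \<Omega>. (u x - u_hat x)\<^sup>2 = 0"
      by (simp add: antisym)
    then show ?thesis by eventually_elim simp
  qed
  have estimate: "\<exists>\<delta>>0. \<forall>u. H1 \<Omega> u \<longrightarrow> nn_ansatz \<Omega> d g u \<longrightarrow>
           poisson_loss \<Omega> f p u < ennreal \<delta> \<longrightarrow> H1_norm \<Omega> (\<lambda>x. u x - u_hat x) < \<epsilon>"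
    if p: "2 \<le> p" and e: "\<epsilon> > 0" for p :: ennreal and \<epsilon> :: real
  proof -
    define c where "c = C\<^sup>2 + C"
    \<comment> \<open>The factor $2$ makes the final inequality strict.\<close>
    define \<eta> where "\<eta> = \<epsilon>\<^sup>2 / (2 * c)"
    have c: "c > 0" using C(1) by (simp add: c_def add_pos_pos)
    have eta: "\<eta> > 0" using c e by (simp add: \<eta>_def)
    obtain \<delta> where delta: "\<delta> > 0" "\<And>u. (\<lambda>x. - laplacian u x - f x) \<in> borel_measurable (lebesgue_on \<Omega>) \<Longrightarrow>
      poisson_loss \<Omega> f p u < ennreal \<delta> \<Longrightarrow>
      L2_on \<Omega> (\<lambda>x. - laplacian u x - f x) \<and> (LINT x|lebesgue_on \<Omega>. (- laplacian u x - f x)\<^sup>2) \<le> \<eta>"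
      using poisson_loss_controls_L2[OF open_\<Omega> bounded_\<Omega> assms(5) p eta] by blast
    have "H1_norm \<Omega> (\<lambda>x. u x - u_hat x) < \<epsilon>"
      if ansatz: "nn_ansatz \<Omega> d g u" and loss: "poisson_loss \<Omega> f p u < ennreal \<delta>" for u
    proof -
      have u2: "C_on 2 \<Omega> u" by (rule C_on_nn_ansatz[OF open_\<Omega> d2 g2 ansatz])
      have "C_on 0 \<Omega> (\<lambda>x. \<Sum>i\<in>UNIV. pderivs [i, i] u x)"
        using u2 by (intro C_on_sum open_\<Omega>) (simp add: C_on_0 C_on_def)
      then have "continuous_on \<Omega> (laplacian u)"
        by (simp add: C_on_0 laplacian_def[abs_def])
      then have meas: "(\<lambda>x. - laplacian u x - f x) \<in> borel_measurable (lebesgue_on \<Omega>)"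
        using open_\<Omega> fc by (intro continuous_imp_measurable_on_sets_lebesgue continuous_intros) auto
      have r: "L2_on \<Omega> (\<lambda>x. - laplacian u x - f x)" "(LINT x|lebesgue_on \<Omega>. (- laplacian u x - f x)\<^sup>2) \<le> \<eta>"
        using delta(2)[OF meas loss] by blast+
      have L2lap: "L2_on \<Omega> (\<lambda>x. - laplacian u x)" using L2_on_add[OF r(1) L2f] by simp
      obtain \<phi>' where "test_approx \<Omega> (\<lambda>x. u x - g x) (\<lambda>x. grad u x - grad g x) \<phi>'"
        using test_approx_nn_ansatz[OF open_\<Omega> bounded_\<Omega> d g1 _ _ ansatz] assms(11,12) by blast
      note approx = minus_u_hat[OF this]
      have "H1_sq \<Omega> (\<lambda>x. u x - u_hat x) (\<lambda>x. grad u x - G_hat x) \<le> c * (LINT x|lebesgue_on \<Omega>. (- laplacian u x - f x)\<^sup>2)"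
        unfolding c_def by (rule poisson_error_estimate[OF open_\<Omega> C approx L2G L2lap L2f _ G_eq])
          (simp_all only: grad_nth integral_grad_eq_laplacian[OF open_\<Omega> u2])
      also have "\<dots> \<le> c * \<eta>" using c r(2) by (intro mult_left_mono) auto
      also have "\<dots> = \<epsilon>\<^sup>2 / 2" using c by (simp add: \<eta>_def)
      also have "\<dots> < \<epsilon>\<^sup>2" using e by simp
      finally have "sqrt (H1_sq \<Omega> (\<lambda>x. u x - u_hat x) (\<lambda>x. grad u x - G_hat x)) < \<epsilon>"
        using e by (intro real_less_lsqrt) auto
      then show ?thesis
        by (simp add: H1_norm_eq[OF open_\<Omega> fin test_approx_has_weak_gradient[OF open_\<Omega> approx]])
    qed
    then show ?thesis using delta(1) by blast
  qed
  have H1g: "H1 \<Omega> g" using L2g wg by (auto simp: H1_def)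
  have ansatz_g: "nn_ansatz \<Omega> d g g"
    unfolding nn_ansatz_def using neural_network_0 by (intro exI[of _ "\<lambda>_. 0"]) auto
  have "\<exists>u. H1 \<Omega> u \<and> nn_ansatz \<Omega> d g u \<and>
      (\<forall>\<epsilon>>0. \<exists>\<delta>>0. poisson_loss \<Omega> f p u < ennreal \<delta> \<longrightarrow> H1_norm \<Omega> (\<lambda>x. u x - u_hat x) < \<epsilon>)"
    if "2 \<le> p" for p :: ennreal
    using estimate[OF that] H1g ansatz_g by meson
  with sol unique estimate show ?thesis by blast
qed

end
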